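(* Let $X=\{xy-zw=0\}\subset\mathbb{C}P^3$ be parametrized by $$f:\mathbb{C}P^1\times\mathbb{C}P^1\to\mathbb{C}P^3,\qquad \bigl((\mu:\mu'),(\nu:\nu')\bigr)\mapsto(\mu\nu',\mu'\nu,\mu\nu,\mu'\nu'),$$ so that in the affine chart $\mu'=\nu'=1$ the parametrization is $(\mu,\nu)\mapsto(\mu,\nu,\mu\nu,1)$. After a linear change of coordinates $\tilde\mu=c_0+c_1\mu$, $\tilde\nu=c_2+c_3\nu$ (the new coordinates being denoted again by $\mu,\nu$ below, and the constants here being unrelated to those below), any algebraic legendrian curve on the quadric $X$ can be written in one of the following standard forms: 1. $c_0\left(\frac{\nu-1}{\nu+1}\right)^{d_1}=c_1\left(\frac{\mu-1}{\mu+1}\right)^{d_2}$; 2. $c_0\nu^{d_1}=c_1\mu^{d_2}$; 3. $c_0\left(\frac{\nu-1}{\nu+1}\right)^{d_1}=c_1\mu^{d_2}$; 4. $c_0\left(\frac{\mu-1}{\mu+1}\right)^{d_1}=c_1\nu^{d_2}$; 5. $c_0\mu\nu+c_1\mu+c_2\nu=0$; 6. $c_0\mu+c_1\nu+c_2=0$; 7. $c_0\mu\nu+c_1\mu+c_2=0$; 8. $c_0\mu\nu+c_1\nu+c_2=0$; 9. $\mu=c_0$; 10. $\nu=c_0$; where $c_i\in\mathbb{C}$ and $d_i\in\mathbb{N}_0$ (the non-negative integers) are some constants.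
   Context: Let $(x:y:z:w)$ be homogeneous coordinates on $\mathbb{C}P^3$. Legendrian means legendrian with respect to a holomorphic contact form on $\mathbb{C}P^3$, i.e. a form of the type $$(py-qz+aw)\,dx+(-px+rz+bw)\,dy+(qx-ry+cw)\,dz+(-ax-by-cz)\,dw$$ with constants $a,b,c,p,q,r\in\mathbb{C}$, $pc+qb+ra\neq0$. A curve is legendrian with respect to such a form if the form vanishes on the tangent vectors of the curve.
   Formalization: The printed list omits curves such as μ²ν=1 (legendrian for p=1/2, c=3/2, others 0), so a further form c_0 ν^{d_1} μ^{d_2} = c_1 with c_0,c_1≠0, d_1,d_2>0 is added; curves are irreducible and the equations are read homogenized on CP^1×CP^1. *)

theory Defs
  imports "HOL-Analysis.Analysis"
begin

section \<open>Complex projective space and its closed algebraic subsets\<close>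

text \<open>
  A point of projective space is a complex line through the origin of \<open>complex ^ 'n\<close>, so that
  \<open>(x : y : z : w)\<close> is \<open>point (vector [x, y, z, w])\<close>, and a subset of projective space is a set of
  such lines.
\<close>

definition point :: "complex ^ 'n \<Rightarrow> (complex ^ 'n) set" where
  "point v = vec.span {v}"

definition proj_space :: "(complex ^ 'n) set set" where
  "proj_space = {point v | v. v \<noteq> 0}"

definition homogeneous_poly :: "nat \<Rightarrow> (complex ^ 'n \<Rightarrow> complex) \<Rightarrow> bool" where
  "homogeneous_poly d F \<longleftrightarrow>
     (\<exists>k. \<forall>v. F v = (\<Sum>e\<in>{e :: 'n \<Rightarrow> nat. (\<Sum>i\<in>UNIV. e i) = d}. k e * (\<Prod>i\<in>UNIV. (v $ i) ^ e i)))"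

definition vanishes_on :: "(complex ^ 'n \<Rightarrow> complex) \<Rightarrow> (complex ^ 'n) set set \<Rightarrow> bool" where
  "vanishes_on F Z \<longleftrightarrow> (\<forall>L\<in>Z. \<forall>v\<in>L. F v = 0)"

definition algebraic_set :: "(complex ^ 'n) set set \<Rightarrow> bool" where
  "algebraic_set Z \<longleftrightarrow>
     (\<exists>S. (\<forall>F\<in>S. \<exists>d. homogeneous_poly d F) \<and> Z = {L \<in> proj_space. \<forall>F\<in>S. \<forall>v\<in>L. F v = 0})"

definition irreducible_set :: "(complex ^ 'n) set set \<Rightarrow> bool" where
  "irreducible_set Z \<longleftrightarrow>
     algebraic_set Z \<and> Z \<noteq> {} \<and>
     (\<forall>A B. algebraic_set A \<longrightarrow> algebraic_set B \<longrightarrow> Z = A \<union> B \<longrightarrow> Z = A \<or> Z = B)"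

text \<open>Krull dimension with respect to the Zariski topology.\<close>

definition irreducible_chain ::
  "(complex ^ 'n) set set \<Rightarrow> nat \<Rightarrow> (nat \<Rightarrow> (complex ^ 'n) set set) \<Rightarrow> bool" where
  "irreducible_chain Z n Y \<longleftrightarrow>
     (\<forall>i\<le>n. irreducible_set (Y i) \<and> Y i \<subseteq> Z) \<and> (\<forall>i<n. Y i \<subset> Y (Suc i))"

definition has_dimension :: "(complex ^ 'n) set set \<Rightarrow> nat \<Rightarrow> bool" where
  "has_dimension Z n \<longleftrightarrow>
     (\<exists>Y. irreducible_chain Z n Y) \<and> (\<nexists>Y. irreducible_chain Z (Suc n) Y)"

definition algebraic_curve :: "(complex ^ 'n) set set \<Rightarrow> bool" where
  "algebraic_curve C \<longleftrightarrow> irreducible_set C \<and> has_dimension C 1"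

section \<open>Legendrian curves\<close>

text \<open>
  The Zariski tangent space, at a vector \<open>v \<noteq> 0\<close>, of the affine cone over \<open>C\<close>.  It contains the
  radial direction \<open>v\<close> and its quotient by that direction is the tangent space of \<open>C\<close> at
  \<open>point v\<close>; hence a curve is smooth there iff this space has dimension 2.
\<close>

definition cone_tangent :: "(complex ^ 'n) set set \<Rightarrow> complex ^ 'n \<Rightarrow> (complex ^ 'n) set" where
  "cone_tangent C v =
     {u. \<forall>d F. homogeneous_poly d F \<longrightarrow> vanishes_on F C \<longrightarrow>
           ((\<lambda>t. F (v + t *s u)) has_field_derivative 0) (at 0)}"

definition smooth_curve_at :: "(complex ^ 'n) set set \<Rightarrow> complex ^ 'n \<Rightarrow> bool" where
  "smooth_curve_at C v \<longleftrightarrow> vec.dim (cone_tangent C v) = 2"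

text \<open>
  The form is given in homogeneous coordinates: \<open>contact_form a b c p q r v u\<close> is its value at \<open>v\<close>
  on the vector \<open>u = (dx, dy, dz, dw)\<close>.  It is homogeneous in \<open>v\<close> and annihilates \<open>u = v\<close>, so its
  vanishing on the tangent vectors of a cone is a property of the underlying projective curve.
\<close>

definition contact_form ::
  "complex \<Rightarrow> complex \<Rightarrow> complex \<Rightarrow> complex \<Rightarrow> complex \<Rightarrow> complex \<Rightarrow>
   complex ^ 4 \<Rightarrow> complex ^ 4 \<Rightarrow> complex" where
  "contact_form a b c p q r v u =
     (let x = v $ 1; y = v $ 2; z = v $ 3; w = v $ 4 in
        (p * y - q * z + a * w) * u $ 1
      + (- p * x + r * z + b * w) * u $ 2
      + (q * x - r * y + c * w) * u $ 3
      + (- a * x - b * y - c * z) * u $ 4)"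

definition legendrian ::
  "(complex ^ 'n \<Rightarrow> complex ^ 'n \<Rightarrow> complex) \<Rightarrow> (complex ^ 'n) set set \<Rightarrow> bool" where
  "legendrian \<theta> C \<longleftrightarrow>
     (\<forall>L\<in>C. \<forall>v\<in>L. v \<noteq> 0 \<longrightarrow> smooth_curve_at C v \<longrightarrow> (\<forall>u\<in>cone_tangent C v. \<theta> v u = 0))"

section \<open>The quadric and its parametrization\<close>

definition quadric :: "(complex ^ 4) set set" where
  "quadric = {L \<in> proj_space. \<forall>v\<in>L. v $ 1 * v $ 2 - v $ 3 * v $ 4 = 0}"

text \<open>The image of \<open>((\<mu> : \<mu>'), (\<nu> : \<nu>'))\<close>.\<close>

definition quadric_param :: "complex \<Rightarrow> complex \<Rightarrow> complex \<Rightarrow> complex \<Rightarrow> (complex ^ 4) set" where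
  "quadric_param \<mu> \<mu>' \<nu> \<nu>' = point (vector [\<mu> * \<nu>', \<mu>' * \<nu>, \<mu> * \<nu>, \<mu>' * \<nu>'])"

text \<open>
  The subset of the quadric given by a bihomogeneous equation \<open>E\<close> in the new coordinates
  \<open>s0 + s1 \<mu>\<close> and \<open>t0 + t1 \<nu>\<close>.  Since \<open>\<mu>\<close> and \<open>\<nu>\<close> stand for \<open>\<mu> / \<mu>'\<close> and \<open>\<nu> / \<nu>'\<close>, the change of
  coordinates fixes \<open>\<mu>'\<close> and \<open>\<nu>'\<close>.  An equation in the chart \<open>\<mu>' = \<nu>' = 1\<close> is written in its
  homogenized form with denominators cleared: for example \<open>(\<mu> - 1) / (\<mu> + 1)\<close> is the ratio of
  \<open>\<mu> - \<mu>'\<close> and \<open>\<mu> + \<mu>'\<close>, which also makes sense where it is infinite.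
  Likewise \<open>\<nu> ^ d1\<close> proportional to \<open>\<mu>\<close> to the power \<open>- d2\<close> reads
  \<open>c0 * \<nu> ^ d1 * \<mu> ^ d2 = c1 * \<mu>' ^ d2 * \<nu>' ^ d1\<close>; an affine change of \<open>\<mu>\<close> cannot turn this into
  a positive power.
\<close>

definition curve_given_by ::
  "complex \<Rightarrow> complex \<Rightarrow> complex \<Rightarrow> complex \<Rightarrow>
   (complex \<Rightarrow> complex \<Rightarrow> complex \<Rightarrow> complex \<Rightarrow> bool) \<Rightarrow> (complex ^ 4) set set" where
  "curve_given_by s0 s1 t0 t1 E =
     {quadric_param \<mu> \<mu>' \<nu> \<nu>' | \<mu> \<mu>' \<nu> \<nu>'.
        (\<mu>, \<mu>') \<noteq> (0, 0) \<and> (\<nu>, \<nu>') \<noteq> (0, 0) \<and>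
        E (s0 * \<mu>' + s1 * \<mu>) \<mu>' (t0 * \<nu>' + t1 * \<nu>) \<nu>'}"

end

theory Submission
  imports Defs "HOL-Computational_Algebra.Fundamental_Theorem_Algebra"
begin

text \<open>
  Restricted to the chart \<open>(\<mu>, \<nu>)\<close> of the quadric, the contact form becomes
  \<open>Q(\<nu>) d\<mu> + P(\<mu>) d\<nu>\<close> with \<open>P\<close> and \<open>Q\<close> of degree at most 2 (\<open>contact_form_fst\<close> and
  \<open>contact_form_snd\<close>).  So a legendrian curve is an invariant curve of the vector field
  \<open>P(\<mu>) \<partial>/\<partial>\<mu> - Q(\<nu>) \<partial>/\<partial>\<nu>\<close>.  The discriminants of \<open>P\<close> and \<open>Q\<close> differ by
  \<open>4 (p c + q b + r a) \<noteq> 0\<close>, hence one of them, say \<open>P\<close>, has two distinct roots on the projective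
  line.  Coordinates \<open>x\<close> and \<open>y\<close> on the two factors that put the roots at \<open>0\<close> and \<open>\<infinity>\<close> (a double
  root at \<open>\<infinity>\<close>) turn the field into \<open>\<rho> x \<partial>/\<partial>x - (\<kappa> y + \<epsilon>) \<partial>/\<partial>y\<close> with \<open>\<rho> \<noteq> 0\<close>,
  where \<open>\<epsilon> = 0\<close> if \<open>Q\<close> has distinct roots and \<open>\<kappa> = 0\<close> otherwise (\<open>adapted_bases\<close>).

  Let \<open>I\<close> be the prime ideal of polynomials in \<open>x\<close> and \<open>y\<close> that vanish on the curve.  If \<open>I\<close> contains
  a nonzero polynomial in one variable, or if the curve misses the chart, the curve is a fibre of one
  of the two projections.  Otherwise take a nonzero \<open>g \<in> I\<close> of least degree in \<open>y\<close>.  Pseudo-division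
  shows that \<open>g\<close> determines all differentials of elements of \<open>I\<close> where its leading coefficient does
  not vanish, so that the legendrian condition puts the derivative of \<open>g\<close> along the field back into
  \<open>I\<close> (\<open>minimal_derivation_vanishing\<close>).  Subtracting a multiple of \<open>g\<close> from this derivative removes a
  monomial from the leading coefficient; hence \<open>g\<close> can be chosen as an eigenvector of the derivation
  (\<open>exists_eigenvector\<close>).  The derivation is diagonal on monomials when \<open>\<epsilon> = 0\<close>, and an eigenvector
  forces this case; so the exponents occurring in \<open>g\<close> lie on a line, \<open>g\<close> is a monomial times a
  polynomial in some \<open>x^A y^B\<close>, and primality of \<open>I\<close> gives \<open>x^A y^B - c \<in> I\<close> (\<open>monomial_equation\<close>).

  The curve is therefore contained in a fibre or in \<open>{x^A y^B = c}\<close> with coprime \<open>A\<close> and \<open>B\<close>.  Both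
  are images of the projective line, and an algebraic curve inside such an image is all of it, because
  it has infinitely many points (\<open>algebraic_curve_eq_rational_curve\<close>).  An affine change of \<open>\<mu>\<close> puts
  the two roots of \<open>P\<close> at \<open>\<plusminus>1\<close> if both are finite and at \<open>0\<close> if the other one is \<open>\<infinity>\<close>, and likewise for
  \<open>\<nu>\<close>; the resulting combinations are the standard forms.
\<close>

section \<open>Polynomial functions\<close>

definition poly_fun :: "(complex \<Rightarrow> complex) \<Rightarrow> bool" where
  "poly_fun h \<longleftrightarrow> (\<exists>p. \<forall>t. h t = poly p t)"

text \<open>
  The outer variable of a polynomial of type \<open>complex poly poly\<close> is \<open>y\<close>: degrees and leading
  coefficients below refer to \<open>y\<close>, and the coefficients are polynomials in \<open>x\<close>.
\<close>

definition eval2 :: "complex poly poly \<Rightarrow> complex \<Rightarrow> complex \<Rightarrow> complex" where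
  "eval2 g x y = poly (poly g [:y:]) x"

definition poly_fun2 :: "(complex \<Rightarrow> complex \<Rightarrow> complex) \<Rightarrow> bool" where
  "poly_fun2 h \<longleftrightarrow> (\<exists>g. \<forall>x y. h x y = eval2 g x y)"

lemma poly_fun_const: "poly_fun (\<lambda>t. k)"
  unfolding poly_fun_def by (rule exI[of _ "[:k:]"]) simp

lemma poly_fun_id: "poly_fun (\<lambda>t. t)"
  unfolding poly_fun_def by (rule exI[of _ "[:0, 1:]"]) simp

lemma poly_fun_add: "poly_fun f \<Longrightarrow> poly_fun g \<Longrightarrow> poly_fun (\<lambda>t. f t + g t)"
  unfolding poly_fun_def by (metis poly_add)

lemma poly_fun_mult: "poly_fun f \<Longrightarrow> poly_fun g \<Longrightarrow> poly_fun (\<lambda>t. f t * g t)"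
  unfolding poly_fun_def by (metis poly_mult)

lemma poly_fun_power: "poly_fun f \<Longrightarrow> poly_fun (\<lambda>t. f t ^ n)"
  unfolding poly_fun_def by (metis poly_power)

lemma poly_fun_sum: "(\<And>i. i \<in> I \<Longrightarrow> poly_fun (f i)) \<Longrightarrow> poly_fun (\<lambda>t. \<Sum>i\<in>I. f i t)"
  by (induction I rule: infinite_finite_induct) (auto intro: poly_fun_const poly_fun_add)

lemma poly_fun_prod: "(\<And>i. i \<in> I \<Longrightarrow> poly_fun (f i)) \<Longrightarrow> poly_fun (\<lambda>t. \<Prod>i\<in>I. f i t)"
  by (induction I rule: infinite_finite_induct) (auto intro: poly_fun_const poly_fun_mult)

lemmas poly_fun_intros =
  poly_fun_const poly_fun_id poly_fun_add poly_fun_mult poly_fun_power poly_fun_sum poly_fun_prod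

lemma poly_fun_zero_if_infinite:
  assumes "poly_fun h" "infinite {t. h t = 0}"
  shows "h t = 0"
  using assms poly_roots_finite unfolding poly_fun_def by (metis (no_types, lifting) Collect_cong poly_0)

lemma eval2_simps [simp]:
  "eval2 0 x y = 0"
  "eval2 (f + g) x y = eval2 f x y + eval2 g x y"
  "eval2 (f - g) x y = eval2 f x y - eval2 g x y"
  "eval2 (f * g) x y = eval2 f x y * eval2 g x y"
  "eval2 (smult k g) x y = poly k x * eval2 g x y"
  "eval2 [:k:] x y = poly k x"
  by (simp_all add: eval2_def)

lemma eval2_altdef: "eval2 g x y = (\<Sum>j\<le>degree g. poly (coeff g j) x * y ^ j)"
  unfolding eval2_def by (simp add: poly_altdef[of g] poly_sum poly_power)

lemma eval2_pCons: "eval2 (pCons a g) x y = poly a x + y * eval2 g x y"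
  by (simp add: eval2_def)

lemma eval2_eq_poly: "eval2 g x y = poly (map_poly (\<lambda>q. poly q x) g) y"
  by (induction g) (simp_all add: eval2_pCons map_poly_pCons)

lemma poly_fun2_const: "poly_fun2 (\<lambda>x y. k)"
  unfolding poly_fun2_def by (rule exI[of _ "[:[:k:]:]"]) simp

lemma poly_fun2_fst: "poly_fun2 (\<lambda>x y. x)"
  unfolding poly_fun2_def by (rule exI[of _ "[:[:0, 1:]:]"]) simp

lemma poly_fun2_snd: "poly_fun2 (\<lambda>x y. y)"
  unfolding poly_fun2_def by (rule exI[of _ "[:0, 1:]"]) (simp add: eval2_def)

lemma poly_fun2_add: "poly_fun2 f \<Longrightarrow> poly_fun2 g \<Longrightarrow> poly_fun2 (\<lambda>x y. f x y + g x y)"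
  unfolding poly_fun2_def by (metis eval2_simps(2))

lemma poly_fun2_mult: "poly_fun2 f \<Longrightarrow> poly_fun2 g \<Longrightarrow> poly_fun2 (\<lambda>x y. f x y * g x y)"
  unfolding poly_fun2_def by (metis eval2_simps(4))

lemma poly_fun2_power: "poly_fun2 f \<Longrightarrow> poly_fun2 (\<lambda>x y. f x y ^ n)"
  by (induction n) (auto intro: poly_fun2_const poly_fun2_mult)

lemma poly_fun2_sum: "(\<And>i. i \<in> I \<Longrightarrow> poly_fun2 (f i)) \<Longrightarrow> poly_fun2 (\<lambda>x y. \<Sum>i\<in>I. f i x y)"
  by (induction I rule: infinite_finite_induct) (auto intro: poly_fun2_const poly_fun2_add)

lemma poly_fun2_prod: "(\<And>i. i \<in> I \<Longrightarrow> poly_fun2 (f i)) \<Longrightarrow> poly_fun2 (\<lambda>x y. \<Prod>i\<in>I. f i x y)"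
  by (induction I rule: infinite_finite_induct) (auto intro: poly_fun2_const poly_fun2_mult)

lemma poly_fun2_poly: "poly_fun2 h \<Longrightarrow> poly_fun2 (\<lambda>x y. poly p (h x y))"
  unfolding poly_altdef by (intro poly_fun2_sum poly_fun2_mult poly_fun2_const poly_fun2_power)

lemmas poly_fun2_intros = poly_fun2_const poly_fun2_fst poly_fun2_snd poly_fun2_add poly_fun2_mult
  poly_fun2_power poly_fun2_sum poly_fun2_prod poly_fun2_poly

lemma poly_fun2_eval2: "poly_fun2 (eval2 g)"
  unfolding poly_fun2_def by blast

lemma eval2_deriv_snd: "((\<lambda>y. eval2 g x y) has_field_derivative eval2 (pderiv g) x y) (at y)"
proof -
  have "map_poly (\<lambda>q. poly q x) (pderiv g) = pderiv (map_poly (\<lambda>q. poly q x) g)"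
    by (rule poly_eqI) (simp add: coeff_map_poly coeff_pderiv of_nat_poly)
  then show ?thesis unfolding eval2_eq_poly by (metis poly_DERIV)
qed

lemma eval2_deriv_fst: "((\<lambda>x. eval2 g x y) has_field_derivative eval2 (map_poly pderiv g) x y) (at x)"
  by (induction g)
     (auto simp: eval2_pCons map_poly_pCons intro!: derivative_eq_intros poly_DERIV)

section \<open>Homogeneous polynomials\<close>

lemma finite_exponents: "finite {e :: 'n::finite \<Rightarrow> nat. (\<Sum>i\<in>UNIV. e i) = d}"
proof (rule finite_subset)
  show "{e :: 'n \<Rightarrow> nat. (\<Sum>i\<in>UNIV. e i) = d} \<subseteq> (\<Pi>\<^sub>E i\<in>UNIV. {..d})"
    by (auto simp: PiE_def intro!: member_le_sum)
qed (auto intro: finite_PiE)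

lemma hom_add:
  assumes "homogeneous_poly d F" "homogeneous_poly d G"
  shows "homogeneous_poly d (\<lambda>v. F v + G v)"
proof -
  obtain k l where "\<forall>v. F v = (\<Sum>e\<in>{e. (\<Sum>i\<in>UNIV. e i) = d}. k e * (\<Prod>i\<in>UNIV. (v $ i) ^ e i))"
    "\<forall>v. G v = (\<Sum>e\<in>{e. (\<Sum>i\<in>UNIV. e i) = d}. l e * (\<Prod>i\<in>UNIV. (v $ i) ^ e i))"
    using assms unfolding homogeneous_poly_def by blast
  then show ?thesis unfolding homogeneous_poly_def
    by (intro exI[of _ "\<lambda>e. k e + l e"]) (simp add: sum.distrib algebra_simps)
qed

lemma hom_scale:
  assumes "homogeneous_poly d F"
  shows "homogeneous_poly d (\<lambda>v. c * F v)"
proof -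
  obtain k where "\<forall>v. F v = (\<Sum>e\<in>{e. (\<Sum>i\<in>UNIV. e i) = d}. k e * (\<Prod>i\<in>UNIV. (v $ i) ^ e i))"
    using assms unfolding homogeneous_poly_def by blast
  then show ?thesis unfolding homogeneous_poly_def
    by (intro exI[of _ "\<lambda>e. c * k e"]) (simp add: sum_distrib_left algebra_simps)
qed

lemma hom_zero: "homogeneous_poly d (\<lambda>v. 0)"
  unfolding homogeneous_poly_def by (intro exI[of _ "\<lambda>e. 0"]) simp

lemma hom_sum: "(\<And>i. i \<in> I \<Longrightarrow> homogeneous_poly d (F i)) \<Longrightarrow> homogeneous_poly d (\<lambda>v. \<Sum>i\<in>I. F i v)"
  by (induction I rule: infinite_finite_induct) (auto intro: hom_zero hom_add)

lemma hom_monomial: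
  assumes "(\<Sum>i\<in>UNIV. e i) = d"
  shows "homogeneous_poly d (\<lambda>v. \<Prod>i\<in>UNIV. (v $ i) ^ e i)"
  unfolding homogeneous_poly_def
proof (intro exI allI)
  fix v :: "complex^'a"
  show "(\<Prod>i\<in>UNIV. (v $ i) ^ e i) =
    (\<Sum>e'\<in>{e. (\<Sum>i\<in>UNIV. e i) = d}. (if e' = e then 1 else 0) * (\<Prod>i\<in>UNIV. (v $ i) ^ e' i))"
    using assms by (simp add: finite_exponents if_distrib[of "\<lambda>u. u * _"] sum.delta cong: if_cong)
qed

lemma hom_mult:
  assumes "homogeneous_poly d F" "homogeneous_poly d' G"
  shows "homogeneous_poly (d + d') (\<lambda>v. F v * G v)"
proof -
  obtain k l where F: "\<And>v. F v = (\<Sum>e\<in>{e. (\<Sum>i\<in>UNIV. e i) = d}. k e * (\<Prod>i\<in>UNIV. (v $ i) ^ e i))" and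
    G: "\<And>v. G v = (\<Sum>e\<in>{e. (\<Sum>i\<in>UNIV. e i) = d'}. l e * (\<Prod>i\<in>UNIV. (v $ i) ^ e i))"
    using assms unfolding homogeneous_poly_def by blast
  have "(\<lambda>v. F v * G v) = (\<lambda>v. \<Sum>e\<in>{e. (\<Sum>i\<in>UNIV. e i) = d}. \<Sum>e'\<in>{e. (\<Sum>i\<in>UNIV. e i) = d'}.
      (k e * l e') * (\<Prod>i\<in>UNIV. (v $ i) ^ (e i + e' i)))"
    by (rule ext) (simp add: F G sum_product power_add prod.distrib algebra_simps)
  moreover have "homogeneous_poly (d + d') \<dots>"
    by (intro hom_sum hom_scale hom_monomial) (simp add: sum.distrib)
  ultimately show ?thesis by simp
qed

lemma hom_const: "homogeneous_poly 0 (\<lambda>v. c)"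
  using hom_scale[OF hom_monomial[of "\<lambda>i. 0" 0], of c] by simp

lemma hom_power: "homogeneous_poly d F \<Longrightarrow> homogeneous_poly (n * d) (\<lambda>v. F v ^ n)"
  by (induction n) (auto intro: hom_const hom_mult)

lemma hom_linear_power: "homogeneous_poly 1 F \<Longrightarrow> homogeneous_poly n (\<lambda>v. F v ^ n)"
  using hom_power[of 1 F n] by simp

lemma hom_coord: "homogeneous_poly 1 (\<lambda>v. v $ i)"
proof -
  have "(\<lambda>v :: complex^'a. v $ i) = (\<lambda>v. \<Prod>j\<in>UNIV. (v $ j) ^ (if j = i then 1 else 0))"
    by (rule ext) (simp add: if_distrib[of "\<lambda>n. _ ^ n"] prod.delta cong: if_cong)
  moreover have "homogeneous_poly 1 \<dots>" by (rule hom_monomial) simp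
  ultimately show ?thesis by simp
qed

lemma hom_scaling:
  assumes "homogeneous_poly d F"
  shows "F (s *s v) = s ^ d * F v"
proof -
  obtain k where F: "\<And>v. F v = (\<Sum>e\<in>{e. (\<Sum>i\<in>UNIV. e i) = d}. k e * (\<Prod>i\<in>UNIV. (v $ i) ^ e i))"
    using assms unfolding homogeneous_poly_def by blast
  show ?thesis unfolding F sum_distrib_left
    by (rule sum.cong) (auto simp: power_mult_distrib prod.distrib power_sum[symmetric])
qed

lemma hom_poly_fun:
  assumes "homogeneous_poly d F" "\<And>i. poly_fun (\<lambda>t. \<gamma> t $ i)"
  shows "poly_fun (\<lambda>t. F (\<gamma> t))"
proof -
  obtain k where F: "\<And>v. F v = (\<Sum>e\<in>{e. (\<Sum>i\<in>UNIV. e i) = d}. k e * (\<Prod>i\<in>UNIV. (v $ i) ^ e i))"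
    using assms unfolding homogeneous_poly_def by blast
  show ?thesis unfolding F by (intro poly_fun_intros assms)
qed

lemma hom_poly_fun2:
  assumes "homogeneous_poly d F" "\<And>i. poly_fun2 (\<lambda>x y. \<gamma> x y $ i)"
  shows "poly_fun2 (\<lambda>x y. F (\<gamma> x y))"
proof -
  obtain k where F: "\<And>v. F v = (\<Sum>e\<in>{e. (\<Sum>i\<in>UNIV. e i) = d}. k e * (\<Prod>i\<in>UNIV. (v $ i) ^ e i))"
    using assms unfolding homogeneous_poly_def by blast
  show ?thesis unfolding F by (intro poly_fun2_intros assms)
qed

text \<open>
  Directional derivatives of a homogeneous polynomial are linear in the direction.  This makes the
  Zariski tangent space computable from three basis directions.
\<close>

lemma hom_gradient:
  fixes v :: "complex ^ 'n"
  assumes "homogeneous_poly d F"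
  obtains G :: "'n \<Rightarrow> complex" where
    "\<And>u. ((\<lambda>t. F (v + t *s u)) has_field_derivative (\<Sum>i\<in>UNIV. G i * u $ i)) (at 0)"
proof -
  define has_grad where "has_grad H \<longleftrightarrow> (\<exists>G :: 'n \<Rightarrow> complex.
     \<forall>u. ((\<lambda>t. H (v + t *s u)) has_field_derivative (\<Sum>i\<in>UNIV. G i * u $ i)) (at 0))"
    for H :: "complex ^ 'n \<Rightarrow> complex"
  have const: "has_grad (\<lambda>v. c)" for c
    unfolding has_grad_def by (intro exI[of _ "\<lambda>i. 0"]) auto
  have add: "has_grad (\<lambda>v. H v + K v)" if HK: "has_grad H" "has_grad K" for H K
  proof -
    obtain G1 G2 where
      "\<forall>u. ((\<lambda>t. H (v + t *s u)) has_field_derivative (\<Sum>i\<in>UNIV. G1 i * u $ i)) (at 0)"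
      "\<forall>u. ((\<lambda>t. K (v + t *s u)) has_field_derivative (\<Sum>i\<in>UNIV. G2 i * u $ i)) (at 0)"
      using HK unfolding has_grad_def by (elim exE) (rule that)
    then show ?thesis unfolding has_grad_def
      by (intro exI[of _ "\<lambda>i. G1 i + G2 i"])
         (auto intro!: derivative_eq_intros simp: sum.distrib algebra_simps)
  qed
  have mult: "has_grad (\<lambda>v. H v * K v)" if HK: "has_grad H" "has_grad K" for H K
  proof -
    obtain G1 G2 where
      "\<forall>u. ((\<lambda>t. H (v + t *s u)) has_field_derivative (\<Sum>i\<in>UNIV. G1 i * u $ i)) (at 0)"
      "\<forall>u. ((\<lambda>t. K (v + t *s u)) has_field_derivative (\<Sum>i\<in>UNIV. G2 i * u $ i)) (at 0)"
      using HK unfolding has_grad_def by (elim exE) (rule that)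
    then show ?thesis unfolding has_grad_def
      by (intro exI[of _ "\<lambda>i. G1 i * K v + G2 i * H v"])
         (auto intro!: derivative_eq_intros
            simp: sum.distrib sum_distrib_left sum_distrib_right algebra_simps)
  qed
  have coord: "has_grad (\<lambda>v. v $ i)" for i
    unfolding has_grad_def
    by (intro exI[of _ "\<lambda>j. if j = i then 1 else 0"])
       (auto intro!: derivative_eq_intros simp: if_distrib[of "\<lambda>u. u * _"] cong: if_cong)
  have power: "has_grad (\<lambda>v. H v ^ n)" if "has_grad H" for H n
    by (induction n) (auto intro: const mult that)
  have prod: "has_grad (\<lambda>v. \<Prod>i\<in>I. H i v)" if "\<And>i. has_grad (H i)" for H and I :: "'n set"
    by (induction I rule: infinite_finite_induct) (auto intro: const mult that)
  have sum: "has_grad (\<lambda>v. \<Sum>i\<in>I. H i v)" if "\<And>i. has_grad (H i)" for H and I :: "('n \<Rightarrow> nat) set"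
    by (induction I rule: infinite_finite_induct) (auto intro: const add that)
  obtain k where F: "\<And>v. F v = (\<Sum>e\<in>{e. (\<Sum>i\<in>UNIV. e i) = d}. k e * (\<Prod>i\<in>UNIV. (v $ i) ^ e i))"
    using assms unfolding homogeneous_poly_def by blast
  have "has_grad F" unfolding F[abs_def] by (intro sum mult const prod power coord)
  then show thesis using that unfolding has_grad_def by blast
qed

section \<open>Irreducible algebraic sets and curves\<close>

lemma mem_point: "v \<in> point w \<longleftrightarrow> (\<exists>k. v = k *s w)"
  unfolding point_def by (auto simp: vec.span_singleton)

lemma self_mem_point: "v \<in> point v"
  unfolding point_def by (simp add: vec.span_base)

lemma point_scale:
  assumes "k \<noteq> 0"
  shows "point (k *s w) = point w"
proof (intro subset_antisym subsetI)
  fix v assume "v \<in> point (k *s w)"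
  then obtain m where "v = m *s (k *s w)" unfolding mem_point by (elim exE)
  then have "v = (m * k) *s w" by simp
  then show "v \<in> point w" unfolding mem_point by (rule exI)
next
  fix v assume "v \<in> point w"
  then obtain m where "v = m *s w" unfolding mem_point by (elim exE)
  then have "v = (m / k) *s (k *s w)" using assms by simp
  then show "v \<in> point (k *s w)" unfolding mem_point by (rule exI)
qed

lemma hom_vanishes_at_point:
  assumes "homogeneous_poly d F"
  shows "(\<forall>v\<in>point w. F v = 0) \<longleftrightarrow> F w = 0"
proof
  show "\<forall>v\<in>point w. F v = 0 \<Longrightarrow> F w = 0" using self_mem_point by blast
  show "F w = 0 \<Longrightarrow> \<forall>v\<in>point w. F v = 0" using hom_scaling[OF assms] by (auto simp: mem_point)
qed

lemma algebraic_set_subset: "algebraic_set Z \<Longrightarrow> Z \<subseteq> proj_space"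
  unfolding algebraic_set_def by auto

lemma point_in_proj_space: "v \<noteq> 0 \<Longrightarrow> point v \<in> proj_space"
  unfolding proj_space_def by blast

lemma proj_space_cases:
  assumes "L \<in> proj_space"
  obtains v where "v \<noteq> 0" "L = point v"
  using assms by (auto simp: proj_space_def)

lemma point_mem_zeros:
  assumes "\<And>F. F \<in> S \<Longrightarrow> \<exists>d. homogeneous_poly d F" "v \<noteq> 0"
  shows "point v \<in> {L \<in> proj_space. \<forall>F\<in>S. \<forall>v\<in>L. F v = 0} \<longleftrightarrow> (\<forall>F\<in>S. F v = 0)"
proof -
  have "(\<forall>u\<in>point v. F u = 0) \<longleftrightarrow> F v = 0" if "F \<in> S" for F
    using assms(1)[OF that] hom_vanishes_at_point by (elim exE)
  then show ?thesis using point_in_proj_space[OF assms(2)] by simp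
qed

lemma algebraic_set_equations:
  assumes "algebraic_set Z"
  obtains S where "\<And>F. F \<in> S \<Longrightarrow> \<exists>d. homogeneous_poly d F"
    "\<And>v. v \<noteq> 0 \<Longrightarrow> point v \<in> Z \<longleftrightarrow> (\<forall>F\<in>S. F v = 0)"
    "\<And>F. F \<in> S \<Longrightarrow> vanishes_on F Z"
proof -
  obtain S where S: "\<forall>F\<in>S. \<exists>d. homogeneous_poly d F" "Z = {L \<in> proj_space. \<forall>F\<in>S. \<forall>v\<in>L. F v = 0}"
    using assms unfolding algebraic_set_def by blast
  show thesis
  proof (rule that[of S])
    show "\<exists>d. homogeneous_poly d F" if "F \<in> S" for F using S that by blast
    show "point v \<in> Z \<longleftrightarrow> (\<forall>F\<in>S. F v = 0)" if "v \<noteq> 0" for v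
      unfolding S(2) by (rule point_mem_zeros) (use S(1) that in auto)
    show "vanishes_on F Z" if "F \<in> S" for F using S(2) that unfolding vanishes_on_def by blast
  qed
qed

lemma vanishes_on_iff:
  assumes "Z \<subseteq> proj_space" "homogeneous_poly d F"
  shows "vanishes_on F Z \<longleftrightarrow> (\<forall>v. v \<noteq> 0 \<longrightarrow> point v \<in> Z \<longrightarrow> F v = 0)"
proof
  assume "vanishes_on F Z"
  then show "\<forall>v. v \<noteq> 0 \<longrightarrow> point v \<in> Z \<longrightarrow> F v = 0"
    unfolding vanishes_on_def using self_mem_point by blast
next
  assume *: "\<forall>v. v \<noteq> 0 \<longrightarrow> point v \<in> Z \<longrightarrow> F v = 0"
  show "vanishes_on F Z" unfolding vanishes_on_def
  proof
    fix L assume "L \<in> Z"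
    then obtain v where "v \<noteq> 0" "L = point v" using assms(1) unfolding proj_space_def by blast
    then show "\<forall>v\<in>L. F v = 0" using * \<open>L \<in> Z\<close> hom_vanishes_at_point[OF assms(2)] by blast
  qed
qed

lemma algebraic_set_zeros:
  assumes "\<And>F. F \<in> S \<Longrightarrow> \<exists>d. homogeneous_poly d F"
  shows "algebraic_set {L \<in> proj_space. \<forall>F\<in>S. \<forall>v\<in>L. F v = 0}"
  unfolding algebraic_set_def using assms by (intro exI[of _ S]) simp

lemma algebraic_set_restrict:
  assumes "algebraic_set Z" "\<And>F. F \<in> T \<Longrightarrow> \<exists>d. homogeneous_poly d F"
  shows "algebraic_set {L \<in> Z. \<forall>F\<in>T. \<forall>v\<in>L. F v = 0}"
proof -
  obtain S where S: "\<forall>F\<in>S. \<exists>d. homogeneous_poly d F" "Z = {L \<in> proj_space. \<forall>F\<in>S. \<forall>v\<in>L. F v = 0}"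
    using assms(1) unfolding algebraic_set_def by blast
  show ?thesis unfolding algebraic_set_def
    by (rule exI[of _ "S \<union> T"]) (use S assms(2) in auto)
qed

lemma irreducible_set_algebraic: "irreducible_set Z \<Longrightarrow> algebraic_set Z"
  by (simp add: irreducible_set_def)

text \<open>
  The zeros of \<open>F\<close> and of \<open>G\<close> cover \<open>Z\<close> by two algebraic subsets: the homogeneous ideal of \<open>Z\<close> is
  prime.
\<close>

lemma irreducible_set_prime:
  assumes "irreducible_set Z" "homogeneous_poly d F" "homogeneous_poly d' G"
    and "vanishes_on (\<lambda>v. F v * G v) Z"
  shows "vanishes_on F Z \<or> vanishes_on G Z"
proof -
  have Z: "algebraic_set Z" by (rule irreducible_set_algebraic[OF assms(1)])
  define A where "A = {L \<in> Z. \<forall>H\<in>{F}. \<forall>v\<in>L. H v = 0}"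
  define B where "B = {L \<in> Z. \<forall>H\<in>{G}. \<forall>v\<in>L. H v = 0}"
  have "algebraic_set A" "algebraic_set B"
    unfolding A_def B_def by (rule algebraic_set_restrict[OF Z]; use assms in blast)+
  moreover have "Z = A \<union> B"
  proof -
    have "L \<in> A \<union> B" if L: "L \<in> Z" for L
    proof -
      obtain w where w: "L = point w" using L algebraic_set_subset[OF Z] unfolding proj_space_def by blast
      then have "F w * G w = 0" using assms(4) L self_mem_point unfolding vanishes_on_def by blast
      then show ?thesis using L unfolding A_def B_def w
        using hom_vanishes_at_point[OF assms(2)] hom_vanishes_at_point[OF assms(3)] by auto
    qed
    then show ?thesis unfolding A_def B_def by blast
  qed
  ultimately have "Z = A \<or> Z = B" using assms(1) by (simp add: irreducible_set_def)
  then show ?thesis unfolding A_def B_def vanishes_on_def by blast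
qed

lemma linear_form_separates:
  assumes "v \<noteq> 0" "w \<noteq> 0" "point v \<noteq> point (w :: complex ^ 'n)"
  obtains l where "homogeneous_poly 1 l" "l v = 0" "l w \<noteq> 0"
proof -
  obtain i where i: "v $ i \<noteq> 0" using assms(1) by (auto simp: vec_eq_iff)
  have "\<exists>j. v $ i * w $ j \<noteq> w $ i * v $ j"
  proof (rule ccontr)
    assume "\<not> ?thesis"
    then have "w = (w $ i / v $ i) *s v" using i by (auto simp: vec_eq_iff field_simps)
    moreover from this have "w $ i / v $ i \<noteq> 0" using assms(2) by (metis vec.scale_zero_left)
    ultimately show False using assms(3) point_scale by metis
  qed
  then obtain j where j: "v $ i * w $ j \<noteq> w $ i * v $ j" by blast
  have "homogeneous_poly 1 (\<lambda>u :: complex ^ 'n. v $ i * u $ j + (- v $ j) * u $ i)"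
    by (intro hom_add hom_scale hom_coord)
  moreover have "v $ i * v $ j + (- v $ j) * v $ i = 0" by (simp add: algebra_simps)
  moreover have "v $ i * w $ j + (- v $ j) * w $ i \<noteq> 0" using j by (simp add: algebra_simps)
  ultimately show thesis by (rule that)
qed

text \<open>
  A product of linear forms separates one point of a finite set from all the others.  Multiplied by a
  linear form through that point it vanishes on the whole set, so with two points primality would fail.
\<close>

lemma finite_irreducible_set:
  assumes "irreducible_set Z" "finite Z" "L \<in> Z"
  shows "Z = {L}"
proof (rule ccontr)
  assume "Z \<noteq> {L}"
  then have "\<not> Z \<subseteq> {L}" using assms(3) by (simp add: subset_singleton_iff) blast
  then obtain M where M: "M \<in> Z" "M \<noteq> L" by (simp only: subset_iff singleton_iff) metis
  have sub: "Z \<subseteq> proj_space" by (intro algebraic_set_subset irreducible_set_algebraic assms(1))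
  then obtain u where u: "u \<noteq> 0" "L = point u" using assms(3) unfolding proj_space_def by blast
  \<comment> \<open>\<open>l\<close> vanishes at \<open>N\<close> but not at the chosen point \<open>L = point u\<close>\<close>
  have sep: "\<exists>l. homogeneous_poly 1 l \<and> (\<forall>v\<in>N. l v = 0) \<and> l u \<noteq> 0" if N: "N \<in> Z - {L}" for N
  proof -
    obtain w where w: "w \<noteq> 0" "N = point w" using N sub unfolding proj_space_def by blast
    then have "point w \<noteq> point u" using u N by blast
    then obtain l where "homogeneous_poly 1 l" "l w = 0" "l u \<noteq> 0"
      by (rule linear_form_separates[OF w(1) u(1)])
    then show ?thesis using hom_vanishes_at_point[of 1 l w] w(2) by blast
  qed
  have "\<exists>l. \<forall>N\<in>Z - {L}. homogeneous_poly 1 (l N) \<and> (\<forall>v\<in>N. l N v = 0) \<and> l N u \<noteq> 0"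
    by (rule bchoice) (use sep in blast)
  then obtain l where l: "\<And>N. N \<in> Z - {L} \<Longrightarrow> homogeneous_poly 1 (l N) \<and> (\<forall>v\<in>N. l N v = 0) \<and> l N u \<noteq> 0"
    by blast
  have hom: "\<exists>d. homogeneous_poly d (\<lambda>v. \<Prod>N\<in>T. l N v)" if "finite T" "T \<subseteq> Z - {L}" for T
    using that
  proof (induction T)
    case empty
    then show ?case using hom_const by auto
  next
    case (insert N T)
    then obtain d where "homogeneous_poly d (\<lambda>v. \<Prod>N\<in>T. l N v)" by auto
    then have "homogeneous_poly (1 + d) (\<lambda>v. l N v * (\<Prod>N\<in>T. l N v))"
      using hom_mult[of 1 "l N"] l[of N] insert.prems by blast
    then show ?case using insert.hyps by auto
  qed
  then obtain d where F: "homogeneous_poly d (\<lambda>v. \<Prod>N\<in>Z - {L}. l N v)"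
    using assms(2) by blast
  obtain w where w: "w \<noteq> 0" "M = point w" using M sub unfolding proj_space_def by blast
  have "point u \<noteq> point w" using u w M by blast
  then obtain m where m: "homogeneous_poly 1 m" "m u = 0" "m w \<noteq> 0"
    by (rule linear_form_separates[OF u(1) w(1)])
  have "vanishes_on (\<lambda>v. (\<Prod>N\<in>Z - {L}. l N v) * m v) Z" unfolding vanishes_on_def
  proof safe
    fix N v assume N: "N \<in> Z" "v \<in> N"
    show "(\<Prod>N\<in>Z - {L}. l N v) * m v = 0"
    proof (cases "N = L")
      case True
      then show ?thesis using hom_vanishes_at_point[OF m(1), of u] m(2) N u(2) by auto
    next
      case False
      then show ?thesis using N l[of N] assms(2) by (auto intro!: prod_zero)
    qed
  qed
  then consider "vanishes_on (\<lambda>v. \<Prod>N\<in>Z - {L}. l N v) Z" | "vanishes_on m Z"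
    using irreducible_set_prime[OF assms(1) F m(1)] by blast
  then show False
  proof cases
    case 1
    moreover have "u \<in> L" using u(2) self_mem_point by simp
    ultimately have "(\<Prod>N\<in>Z - {L}. l N u) = 0"
      using assms(3) unfolding vanishes_on_def by simp
    moreover have "finite (Z - {L})" using assms(2) by simp
    ultimately obtain N where "N \<in> Z - {L}" "l N u = 0" by (meson prod_zero_iff)
    then show False using l[of N] by simp
  next
    case 2
    moreover have "w \<in> M" using w(2) self_mem_point by simp
    ultimately show False using m(3) M(1) unfolding vanishes_on_def by simp
  qed
qed

lemma algebraic_curve_infinite:
  assumes "algebraic_curve C"
  shows "infinite C"
proof
  assume fin: "finite C"
  have irr: "irreducible_set C" and "has_dimension C 1"
    using assms by (simp_all add: algebraic_curve_def)
  then obtain Y where Y: "irreducible_chain C 1 Y"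
    unfolding has_dimension_def by (elim conjE exE)
  have sub: "Y 0 \<subset> Y (Suc 0)" "Y (Suc 0) \<subseteq> C" and "irreducible_set (Y 0)"
    using Y by (simp_all add: irreducible_chain_def)
  then have ne: "Y 0 \<noteq> {}" by (simp add: irreducible_set_def)
  then obtain L where L: "L \<in> C" "L \<in> Y 0" using sub by blast
  from finite_irreducible_set[OF irr fin L(1)] have "C = {L}" .
  then show False using sub L by blast
qed

text \<open>
  An equation of \<open>Z\<close> restricted to \<open>\<gamma>\<close> is a polynomial in the parameter with infinitely many zeros,
  hence zero on the affine part \<open>s = 1\<close>; homogeneity carries this to \<open>s \<noteq> 0\<close>, and the dependence on \<open>s\<close>
  being polynomial as well, to \<open>s = 0\<close>.
\<close>

lemma algebraic_set_contains_rational_curve: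
  fixes \<gamma> :: "complex \<Rightarrow> complex \<Rightarrow> complex ^ 'n"
  assumes Z: "algebraic_set Z"
    and nz: "\<And>t s. (t, s) \<noteq> (0, 0) \<Longrightarrow> \<gamma> t s \<noteq> 0"
    and poly1: "\<And>s i. poly_fun (\<lambda>t. \<gamma> t s $ i)" and poly2: "\<And>t i. poly_fun (\<lambda>s. \<gamma> t s $ i)"
    and hom: "\<And>k t s. k \<noteq> 0 \<Longrightarrow> \<exists>m. m \<noteq> 0 \<and> \<gamma> (k * t) (k * s) = m *s \<gamma> t s"
    and inf: "infinite {t. point (\<gamma> t 1) \<in> Z}"
    and ts: "(t, s) \<noteq> (0, 0)"
  shows "point (\<gamma> t s) \<in> Z"
proof -
  obtain S where S: "\<And>F. F \<in> S \<Longrightarrow> \<exists>d. homogeneous_poly d F"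
    "\<And>v. v \<noteq> 0 \<Longrightarrow> point v \<in> Z \<longleftrightarrow> (\<forall>F\<in>S. F v = 0)"
    using algebraic_set_equations[OF Z] by metis
  have "F (\<gamma> t s) = 0" if F: "F \<in> S" for F
  proof -
    obtain d where d: "homogeneous_poly d F" using S F by blast
    have 1: "F (\<gamma> t 1) = 0" for t
    proof (rule poly_fun_zero_if_infinite[where h = "\<lambda>t. F (\<gamma> t 1)"])
      show "poly_fun (\<lambda>t. F (\<gamma> t 1))" by (rule hom_poly_fun[OF d poly1])
      have "{t. point (\<gamma> t 1) \<in> Z} \<subseteq> {t. F (\<gamma> t 1) = 0}"
        using S(2) F nz by auto
      then show "infinite {t. F (\<gamma> t 1) = 0}" using inf finite_subset by blast
    qed
    have 2: "F (\<gamma> t s) = 0" if s: "s \<noteq> 0" for s t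
    proof -
      obtain m where "\<gamma> (s * (t / s)) (s * 1) = m *s \<gamma> (t / s) 1" using hom s by blast
      then have "\<gamma> t s = m *s \<gamma> (t / s) 1" using s by simp
      then show ?thesis using 1 hom_scaling[OF d] by simp
    qed
    have "F (\<gamma> t 0) = 0" for t
    proof (rule poly_fun_zero_if_infinite[where h = "\<lambda>s. F (\<gamma> t s)"])
      show "poly_fun (\<lambda>s. F (\<gamma> t s))" by (rule hom_poly_fun[OF d poly2])
      have "UNIV - {0} \<subseteq> {s. F (\<gamma> t s) = 0}" using 2 by auto
      then show "infinite {s. F (\<gamma> t s) = 0}"
        by (metis finite_subset finite_Diff2 finite.emptyI finite.insertI infinite_UNIV_char_0)
    qed
    then show ?thesis using 2 by metis
  qed
  then show ?thesis using S(2) nz ts by blast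
qed

section \<open>The quadric is not a curve\<close>

lemma vector_4 [simp]:
  "vector [a, b, c, d] $ (1 :: 4) = (a :: complex)" "vector [a, b, c, d] $ (2 :: 4) = (b :: complex)"
  "vector [a, b, c, d] $ (3 :: 4) = (c :: complex)" "vector [a, b, c, d] $ (4 :: 4) = (d :: complex)"
  unfolding vector_def by simp_all

lemma vector_4_zero_iff: "vector [a, b, c, d] = (0 :: complex ^ 4) \<longleftrightarrow> a = 0 \<and> b = 0 \<and> c = 0 \<and> d = 0"
  by (simp add: vec_eq_iff forall_4)

text \<open>
  A point, a line through it and the quadric form a chain of irreducible sets of length 2.  That the
  quadric itself is irreducible is part of the assumption to be refuted.
\<close>

lemma quadric_not_curve: "\<not> algebraic_curve quadric"
proof
  assume "algebraic_curve quadric"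
  then have irr: "irreducible_set quadric" and nochain: "\<nexists>Y. irreducible_chain quadric 2 Y"
    unfolding algebraic_curve_def has_dimension_def by (auto simp: numeral_2_eq_2)
  define P where "P = {L \<in> proj_space. \<forall>F\<in>{\<lambda>v. v $ 1, \<lambda>v. v $ 2, \<lambda>v :: complex ^ 4. v $ 3}. \<forall>v\<in>L. F v = 0}"
  define M where "M = {L \<in> proj_space. \<forall>F\<in>{\<lambda>v. v $ 1, \<lambda>v :: complex ^ 4. v $ 3}. \<forall>v\<in>L. F v = 0}"
  define \<gamma> :: "complex \<Rightarrow> complex \<Rightarrow> complex ^ 4" where "\<gamma> = (\<lambda>t s. vector [0, t, 0, s])"
  have algP: "algebraic_set P" and algM: "algebraic_set M"
    unfolding P_def M_def by (rule algebraic_set_zeros; use hom_coord in blast)+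
  have M_iff: "point v \<in> M \<longleftrightarrow> v $ 1 = 0 \<and> v $ 3 = 0" if "v \<noteq> 0" for v
    unfolding M_def by (subst point_mem_zeros) (use hom_coord that in auto)
  have P_iff: "point v \<in> P \<longleftrightarrow> v $ 1 = 0 \<and> v $ 2 = 0 \<and> v $ 3 = 0" if "v \<noteq> 0" for v
    unfolding P_def by (subst point_mem_zeros) (use hom_coord that in auto)
  have nz: "\<gamma> t s \<noteq> 0 \<longleftrightarrow> (t, s) \<noteq> (0, 0)" for t s
    unfolding \<gamma>_def by (simp add: vector_4_zero_iff)
  have M_eq: "M = {point (\<gamma> t s) | t s. (t, s) \<noteq> (0, 0)}"
  proof (intro subset_antisym subsetI)
    fix L assume L: "L \<in> M"
    then obtain v where v: "v \<noteq> 0" "L = point v" unfolding M_def by (auto elim: proj_space_cases)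
    then have "v = \<gamma> (v $ 2) (v $ 4)"
      using L M_iff[OF v(1)] unfolding \<gamma>_def by (simp add: vec_eq_iff forall_4)
    then have "L = point (\<gamma> (v $ 2) (v $ 4)) \<and> (v $ 2, v $ 4) \<noteq> (0, 0)" using v nz by metis
    then show "L \<in> {point (\<gamma> t s) | t s. (t, s) \<noteq> (0, 0)}" by blast
  next
    fix L assume "L \<in> {point (\<gamma> t s) | t s. (t, s) \<noteq> (0, 0)}"
    then obtain t s where L: "L = point (\<gamma> t s)" and "(t, s) \<noteq> (0, 0)" by blast
    then have "\<gamma> t s \<noteq> 0" using nz by blast
    then show "L \<in> M" unfolding L by (subst M_iff) (simp_all add: \<gamma>_def)
  qed
  have P_eq: "P = {point (\<gamma> 0 1)}"
  proof
    show "P \<subseteq> {point (\<gamma> 0 1)}"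
    proof
      fix L assume L: "L \<in> P"
      then obtain v where v: "v \<noteq> 0" "L = point v" unfolding P_def by (auto elim: proj_space_cases)
      then have "v = v $ 4 *s \<gamma> 0 1"
        using L P_iff[OF v(1)] unfolding \<gamma>_def by (simp add: vec_eq_iff forall_4)
      moreover from this have "v $ 4 \<noteq> 0" using v by auto
      ultimately show "L \<in> {point (\<gamma> 0 1)}" using point_scale v(2) by (metis singletonI)
    qed
    have "\<gamma> 0 1 \<noteq> 0" by (simp add: nz)
    then have "point (\<gamma> 0 1) \<in> P" by (subst P_iff) (simp_all add: \<gamma>_def)
    then show "{point (\<gamma> 0 1)} \<subseteq> P" by simp
  qed
  have irrP: "irreducible_set P"
    using algP unfolding irreducible_set_def P_eq by (auto simp only: singleton_Un_iff)
  have irrM: "irreducible_set M" unfolding irreducible_set_def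
  proof (intro conjI allI impI algM)
    show "M \<noteq> {}" unfolding M_eq by blast
    fix A B assume AB: "algebraic_set A" "algebraic_set B" "M = A \<union> B"
    \<comment> \<open>the line is a rational curve, and one of two algebraic sets covering it is infinite on it\<close>
    have full: "M \<subseteq> D" if D: "algebraic_set D" "infinite {t. point (\<gamma> t 1) \<in> D}" for D
    proof -
      have "point (\<gamma> t s) \<in> D" if "(t, s) \<noteq> (0, 0)" for t s
      proof (rule algebraic_set_contains_rational_curve[where \<gamma> = \<gamma>, OF D(1) _ _ _ _ D(2) that])
        show "\<gamma> t s \<noteq> 0" if "(t, s) \<noteq> (0, 0)" for t s
          using that nz by blast
        show "poly_fun (\<lambda>t. \<gamma> t s $ i)" "poly_fun (\<lambda>t. \<gamma> s t $ i)" for s i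
          unfolding \<gamma>_def using exhaust_4[of i] by (auto intro: poly_fun_intros)
        show "\<exists>m. m \<noteq> 0 \<and> \<gamma> (k * t) (k * s) = m *s \<gamma> t s" if "k \<noteq> 0" for k t s
          by (rule exI[of _ k]) (use that in \<open>auto simp: \<gamma>_def vec_eq_iff forall_4\<close>)
      qed
      then show ?thesis unfolding M_eq by blast
    qed
    have "point (\<gamma> t 1) \<in> A \<union> B" for t
    proof -
      have "\<gamma> t 1 \<noteq> 0" by (simp add: nz)
      then have "point (\<gamma> t 1) \<in> M" by (subst M_iff) (simp_all add: \<gamma>_def)
      then show ?thesis by (simp only: AB(3))
    qed
    then have "{t. point (\<gamma> t 1) \<in> A} \<union> {t. point (\<gamma> t 1) \<in> B} = UNIV" by auto
    then have "infinite {t. point (\<gamma> t 1) \<in> A} \<or> infinite {t. point (\<gamma> t 1) \<in> B}"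
      by (metis finite_UnI infinite_UNIV_char_0)
    then have "M \<subseteq> A \<or> M \<subseteq> B" using full[OF AB(1)] full[OF AB(2)] by (elim disjE) simp_all
    moreover have "A \<subseteq> M" "B \<subseteq> M" unfolding AB(3) by simp_all
    ultimately show "M = A \<or> M = B" by (metis subset_antisym)
  qed
  have "P \<subset> M"
  proof -
    have nz1: "\<gamma> 1 1 \<noteq> 0" by (simp add: nz)
    have "point (\<gamma> 1 1) \<in> M" using nz1 by (subst M_iff) (simp_all add: \<gamma>_def)
    moreover have "point (\<gamma> 1 1) \<notin> P" using nz1 by (subst P_iff) (simp_all add: \<gamma>_def)
    moreover have "P \<subseteq> M" unfolding P_def M_def by (rule subsetI) simp
    ultimately show ?thesis by (auto simp only: psubset_eq)
  qed
  moreover have "M \<subset> quadric"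
  proof
    show "M \<subseteq> quadric" unfolding M_def quadric_def by (rule subsetI) simp
    have nz: "vector [1, 1, 1, 1] \<noteq> (0 :: complex ^ 4)" by (simp add: vector_4_zero_iff)
    have "point (vector [1, 1, 1, 1]) \<in> quadric"
      using point_in_proj_space[OF nz] unfolding quadric_def by (auto simp: mem_point)
    moreover have "point (vector [1, 1, 1, 1]) \<notin> M" by (simp add: M_iff[OF nz])
    ultimately show "M \<noteq> quadric" by blast
  qed
  ultimately have "irreducible_chain quadric 2 (\<lambda>i. if i = 0 then P else if i = 1 then M else quadric)"
    unfolding irreducible_chain_def using irr irrP irrM by (auto simp: numeral_2_eq_2 less_Suc_eq)
  then show False using nochain by blast
qed

section \<open>Charts of the quadric\<close>

text \<open>
  A basis of \<open>complex ^ 4\<close> and its dual basis, in which the quadric has the equation of a Segre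
  surface.  Working with an arbitrary such basis gives simultaneously the charts in all coordinates on
  the two factors, and the same charts with the two factors exchanged.
\<close>

locale quadric_chart =
  fixes e1 e2 e3 e4 :: "complex ^ 4" and l1 l2 l3 l4 :: "complex ^ 4 \<Rightarrow> complex"
  assumes hom_l: "homogeneous_poly 1 l1" "homogeneous_poly 1 l2"
      "homogeneous_poly 1 l3" "homogeneous_poly 1 l4"
    and l_basis: "l1 (\<alpha> *s e1 + \<beta> *s e2 + \<gamma> *s e3 + \<delta> *s e4) = \<alpha>"
      "l2 (\<alpha> *s e1 + \<beta> *s e2 + \<gamma> *s e3 + \<delta> *s e4) = \<beta>"
      "l3 (\<alpha> *s e1 + \<beta> *s e2 + \<gamma> *s e3 + \<delta> *s e4) = \<gamma>"
      "l4 (\<alpha> *s e1 + \<beta> *s e2 + \<gamma> *s e3 + \<delta> *s e4) = \<delta>"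
    and basis_l: "l1 v *s e1 + l2 v *s e2 + l3 v *s e3 + l4 v *s e4 = v"
    and quadric_eq: "v $ 1 * v $ 2 - v $ 3 * v $ 4 = 0 \<longleftrightarrow> l1 v * l4 v = l2 v * l3 v"
begin

text \<open>
  The Segre parametrization of the quadric in the coordinates of the chart; the affine chart is
  \<open>seg x 1 y 1\<close>.
\<close>

definition seg :: "complex \<Rightarrow> complex \<Rightarrow> complex \<Rightarrow> complex \<Rightarrow> complex ^ 4" where
  "seg x x' y y' = (x * y) *s e1 + (x * y') *s e2 + (x' * y) *s e3 + (x' * y') *s e4"

lemma l_seg [simp]:
  "l1 (seg x x' y y') = x * y" "l2 (seg x x' y y') = x * y'"
  "l3 (seg x x' y y') = x' * y" "l4 (seg x x' y y') = x' * y'"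
  unfolding seg_def by (simp_all add: l_basis)

lemma l_eqI:
  assumes "l1 u = l1 v" "l2 u = l2 v" "l3 u = l3 v" "l4 u = l4 v"
  shows "u = v"
  by (subst basis_l[of u, symmetric], subst basis_l[of v, symmetric]) (simp only: assms)

lemma l_add [simp]: "l1 (u + v) = l1 u + l1 v" "l2 (u + v) = l2 u + l2 v"
  "l3 (u + v) = l3 u + l3 v" "l4 (u + v) = l4 u + l4 v"
proof -
  have "u + v = (l1 u + l1 v) *s e1 + (l2 u + l2 v) *s e2 + (l3 u + l3 v) *s e3 + (l4 u + l4 v) *s e4"
    by (subst basis_l[of u, symmetric], subst basis_l[of v, symmetric])
       (simp add: vec.scale_left_distrib del: vec.scale_left_distrib[symmetric])
  then show "l1 (u + v) = l1 u + l1 v" "l2 (u + v) = l2 u + l2 v"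
    "l3 (u + v) = l3 u + l3 v" "l4 (u + v) = l4 u + l4 v"
    by (metis l_basis)+
qed

lemma l_scale [simp]: "l1 (k *s v) = k * l1 v" "l2 (k *s v) = k * l2 v"
  "l3 (k *s v) = k * l3 v" "l4 (k *s v) = k * l4 v"
  using hom_scaling[OF hom_l(1)] hom_scaling[OF hom_l(2)]
    hom_scaling[OF hom_l(3)] hom_scaling[OF hom_l(4)] by simp_all

lemma l_zero [simp]: "l1 0 = 0" "l2 0 = 0" "l3 0 = 0" "l4 0 = 0"
  using l_scale[of 0 0] by simp_all

lemma seg_eq_0_iff: "seg x x' y y' = 0 \<longleftrightarrow> (x = 0 \<and> x' = 0) \<or> (y = 0 \<and> y' = 0)"
proof
  assume "seg x x' y y' = 0"
  then have "x * y = 0" "x * y' = 0" "x' * y = 0" "x' * y' = 0" using l_seg l_zero by metis+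
  then show "(x = 0 \<and> x' = 0) \<or> (y = 0 \<and> y' = 0)" by auto
qed (auto simp: seg_def)

lemma seg_surj:
  assumes "v \<noteq> 0" "l1 v * l4 v = l2 v * l3 v"
  obtains x x' y y' where "(x, x') \<noteq> (0, 0)" "(y, y') \<noteq> (0, 0)" "v = seg x x' y y'"
proof -
  consider "l1 v \<noteq> 0" | "l1 v = 0" "l2 v \<noteq> 0" | "l1 v = 0" "l2 v = 0" by blast
  then have "\<exists>x x' y y'. v = seg x x' y y'"
  proof cases
    case 1
    then have "v = seg 1 (l3 v / l1 v) (l1 v) (l2 v)"
      using assms(2) by (intro l_eqI) (simp_all add: field_simps)
    then show ?thesis by metis
  next
    case 2
    then have "v = seg 1 (l4 v / l2 v) (l1 v) (l2 v)"
      using assms(2) by (intro l_eqI) simp_all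
    then show ?thesis by metis
  next
    case 3
    then have "v = seg 0 1 (l3 v) (l4 v)" by (intro l_eqI) simp_all
    then show ?thesis by metis
  qed
  then obtain x x' y y' where "v = seg x x' y y'" by (elim exE)
  moreover from this have "(x, x') \<noteq> (0, 0)" "(y, y') \<noteq> (0, 0)"
    using assms(1) by (auto simp: seg_eq_0_iff)
  ultimately show thesis using that by simp
qed

lemma quadric_cases:
  assumes "L \<in> quadric"
  obtains x x' y y' where "(x, x') \<noteq> (0, 0)" "(y, y') \<noteq> (0, 0)" "L = point (seg x x' y y')"
proof -
  have "L \<in> proj_space" using assms unfolding quadric_def by simp
  then obtain v where v: "v \<noteq> 0" "L = point v" by (rule proj_space_cases)
  have "v \<in> L" unfolding v(2) by (rule self_mem_point)
  then have "l1 v * l4 v = l2 v * l3 v" using assms unfolding quadric_def quadric_eq by simp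
  with v(1) obtain x x' y y' where "(x, x') \<noteq> (0, 0)" "(y, y') \<noteq> (0, 0)" "v = seg x x' y y'"
    by (rule seg_surj)
  then show thesis using that v(2) by simp
qed

lemma seg_coord_poly_fun2: "poly_fun2 (\<lambda>x y. seg x 1 y 1 $ i)"
  unfolding seg_def by (auto intro!: poly_fun2_intros)

lemma seg_scale_fst: "seg (k * x) (k * x') y y' = k *s seg x x' y y'"
  by (intro l_eqI) simp_all

lemma seg_scale_snd: "seg x x' (k * y) (k * y') = k *s seg x x' y y'"
  by (intro l_eqI) simp_all

text \<open>
  The exponent of \<open>l4\<close> exceeds the one required for homogeneity by 1.  Therefore the homogenization
  vanishes outside of the chart, and vanishing on the part of a curve inside the chart is enough for
  vanishing on the whole curve.
\<close>

lemma homogenize: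
  assumes "poly_fun2 h"
  obtains d F where "homogeneous_poly d F" "\<And>x y. F (seg x 1 y 1) = h x y"
    "\<And>v. l4 v = 0 \<Longrightarrow> F v = 0"
proof -
  obtain g where g: "\<And>x y. h x y = eval2 g x y" using assms unfolding poly_fun2_def by blast
  define n where "n = degree g"
  define m where "m = (\<Sum>j\<le>n. degree (coeff g j))"
  have deg: "degree (coeff g j) \<le> m" if "j \<le> n" for j
    unfolding m_def by (rule member_le_sum) (use that in auto)
  have "poly (coeff g j) x = (\<Sum>i\<le>m. coeff (coeff g j) i * x ^ i)" if "j \<le> n" for j x
    unfolding poly_altdef by (rule sum.mono_neutral_left) (use deg[OF that] in \<open>auto simp: coeff_eq_0\<close>)
  then have h: "h x y = (\<Sum>j\<le>n. \<Sum>i\<le>m. coeff (coeff g j) i * x ^ i * y ^ j)" for x y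
    unfolding g eval2_altdef n_def[symmetric] by (simp add: sum_distrib_right)
  define F where "F = (\<lambda>v. \<Sum>j\<le>n. \<Sum>i\<le>m.
      coeff (coeff g j) i * (l2 v ^ i * (l3 v ^ j * l4 v ^ (1 + (m - i) + (n - j)))))"
  have "homogeneous_poly (m + n + 1) F"
    unfolding F_def
  proof (intro hom_sum hom_scale)
    fix i j assume "j \<in> {..n}" "i \<in> {..m}"
    then have "m + n + 1 = i * 1 + (j * 1 + (1 + (m - i) + (n - j)) * 1)" by simp
    moreover have "homogeneous_poly (i * 1 + (j * 1 + (1 + (m - i) + (n - j)) * 1))
        (\<lambda>v. l2 v ^ i * (l3 v ^ j * l4 v ^ (1 + (m - i) + (n - j))))"
      by (rule hom_mult[OF hom_power[OF hom_l(2)] hom_mult[OF hom_power[OF hom_l(3)] hom_power[OF hom_l(4)]]])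
    ultimately show "homogeneous_poly (m + n + 1)
        (\<lambda>v. l2 v ^ i * (l3 v ^ j * l4 v ^ (1 + (m - i) + (n - j))))" by (simp only:)
  qed
  moreover have "F (seg x 1 y 1) = h x y" for x y unfolding F_def h by (simp add: mult.assoc)
  moreover have "F v = 0" if "l4 v = 0" for v unfolding F_def by (simp add: that)
  ultimately show thesis by (rule that)
qed

end

section \<open>A curve on the quadric in a chart\<close>

locale curve_in_chart = quadric_chart +
  fixes C :: "(complex ^ 4) set set"
  assumes curve: "algebraic_curve C" and in_quadric: "C \<subseteq> quadric"
begin

definition on_curve :: "complex \<Rightarrow> complex \<Rightarrow> bool" where
  "on_curve x y \<longleftrightarrow> point (seg x 1 y 1) \<in> C"

definition vanishing :: "(complex \<Rightarrow> complex \<Rightarrow> complex) \<Rightarrow> bool" where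
  "vanishing h \<longleftrightarrow> (\<forall>x y. on_curve x y \<longrightarrow> h x y = 0)"

lemma curve_irreducible: "irreducible_set C"
  using curve by (simp add: algebraic_curve_def)

lemma curve_algebraic: "algebraic_set C"
  by (rule irreducible_set_algebraic[OF curve_irreducible])

lemma seg_affine_nz: "seg x 1 y 1 \<noteq> 0"
  by (simp add: seg_eq_0_iff)

lemma chart_cases:
  assumes "v \<noteq> 0" "point v \<in> C" "l4 v \<noteq> 0"
  shows "v = l4 v *s seg (l2 v / l4 v) 1 (l3 v / l4 v) 1" "on_curve (l2 v / l4 v) (l3 v / l4 v)"
proof -
  have "point v \<in> quadric" using assms(2) in_quadric by (rule subsetD[rotated])
  then have "v $ 1 * v $ 2 - v $ 3 * v $ 4 = 0" using self_mem_point[of v] unfolding quadric_def by simp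
  then have "l1 v * l4 v = l2 v * l3 v" unfolding quadric_eq .
  then show eq: "v = l4 v *s seg (l2 v / l4 v) 1 (l3 v / l4 v) 1"
    using assms(3) by (intro l_eqI) (simp_all add: field_simps)
  have "point v = point (seg (l2 v / l4 v) 1 (l3 v / l4 v) 1)"
    by (subst eq) (rule point_scale[OF assms(3)])
  then show "on_curve (l2 v / l4 v) (l3 v / l4 v)" using assms(2) unfolding on_curve_def by simp
qed

lemma vanishes_on_C_iff:
  assumes "homogeneous_poly d F"
  shows "vanishes_on F C \<longleftrightarrow> (\<forall>v. v \<noteq> 0 \<longrightarrow> point v \<in> C \<longrightarrow> F v = 0)"
  by (rule vanishes_on_iff[OF algebraic_set_subset[OF curve_algebraic] assms])

lemma vanishes_on_C_D: "\<lbrakk>vanishes_on F C; point v \<in> C\<rbrakk> \<Longrightarrow> F v = 0"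
  using self_mem_point[of v] by (simp add: vanishes_on_def)

lemma vanishes_on_imp_vanishing:
  assumes "homogeneous_poly d F" "vanishes_on F C"
  shows "vanishing (\<lambda>x y. F (seg x 1 y 1))"
  using assms(2) seg_affine_nz unfolding vanishes_on_C_iff[OF assms(1)] vanishing_def on_curve_def by simp

lemma vanishing_imp_vanishes_on:
  assumes "homogeneous_poly d F" "vanishing (\<lambda>x y. F (seg x 1 y 1))" "\<And>v. l4 v = 0 \<Longrightarrow> F v = 0"
  shows "vanishes_on F C"
  unfolding vanishes_on_C_iff[OF assms(1)]
proof (intro allI impI)
  fix v assume v: "v \<noteq> 0" "point v \<in> C"
  show "F v = 0"
  proof (cases "l4 v = 0")
    case False
    have "F v = l4 v ^ d * F (seg (l2 v / l4 v) 1 (l3 v / l4 v) 1)"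
      by (subst chart_cases(1)[OF v False]) (rule hom_scaling[OF assms(1)])
    then show ?thesis using assms(2) chart_cases(2)[OF v False] unfolding vanishing_def by simp
  qed (rule assms(3))
qed

text \<open>
  Homogenization transfers primality from the homogeneous ideal of the curve to the ideal of
  polynomials in the chart.
\<close>

lemma vanishing_prime:
  assumes "poly_fun2 h" "poly_fun2 k" "vanishing (\<lambda>x y. h x y * k x y)"
  shows "vanishing h \<or> vanishing k"
proof -
  obtain d F where F: "homogeneous_poly d F" "\<And>x y. F (seg x 1 y 1) = h x y" "\<And>v. l4 v = 0 \<Longrightarrow> F v = 0"
    using homogenize[OF assms(1)] by metis
  obtain d' G where G: "homogeneous_poly d' G" "\<And>x y. G (seg x 1 y 1) = k x y" "\<And>v. l4 v = 0 \<Longrightarrow> G v = 0"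
    using homogenize[OF assms(2)] by metis
  have "vanishes_on (\<lambda>v. F v * G v) C"
    by (rule vanishing_imp_vanishes_on[OF hom_mult[OF F(1) G(1)]]) (simp_all add: F G assms(3))
  then have "vanishes_on F C \<or> vanishes_on G C"
    by (rule irreducible_set_prime[OF curve_irreducible F(1) G(1)])
  then show ?thesis
    using vanishes_on_imp_vanishing[OF F(1)] vanishes_on_imp_vanishing[OF G(1)] unfolding F(2) G(2)
    by (elim disjE) simp_all
qed

text \<open>
  The product with \<open>l4\<close> vanishes on \<open>C\<close>, whereas \<open>l4\<close> is nonzero at the given point in the chart;
  primality removes the factor.
\<close>

lemma vanishing_extends:
  assumes "on_curve x0 y0" "homogeneous_poly d F" "vanishing (\<lambda>x y. F (seg x 1 y 1))"
  shows "vanishes_on F C"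
proof -
  have "vanishes_on (\<lambda>v. F v * l4 v) C"
    by (rule vanishing_imp_vanishes_on[OF hom_mult[OF assms(2) hom_l(4)]]) (simp_all add: assms(3))
  then have "vanishes_on F C \<or> vanishes_on l4 C"
    by (rule irreducible_set_prime[OF curve_irreducible assms(2) hom_l(4)])
  moreover have "\<not> vanishes_on l4 C"
  proof
    assume "vanishes_on l4 C"
    from vanishes_on_imp_vanishing[OF hom_l(4) this] show False
      using assms(1) unfolding vanishing_def by simp
  qed
  ultimately show ?thesis by simp
qed

text \<open>
  An equation of \<open>C\<close> that does not vanish on the quadric cannot vanish identically in the chart,
  because the chart is dense: a polynomial in \<open>y'\<close> vanishing for \<open>y' \<noteq> 0\<close> is zero, and then the same
  for \<open>x'\<close>.
\<close>

lemma exists_vanishing: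
  obtains g where "g \<noteq> 0" "vanishing (eval2 g)"
proof -
  have "C \<noteq> quadric"
  proof
    assume "C = quadric"
    then show False using curve quadric_not_curve by simp
  qed
  then have "\<not> quadric \<subseteq> C" using in_quadric by (metis subset_antisym)
  then have "\<exists>L. L \<in> quadric \<and> L \<notin> C" by (simp only: subset_iff) simp
  then obtain L where L: "L \<in> quadric" "L \<notin> C" by (elim exE conjE)
  obtain S where S: "\<And>F. F \<in> S \<Longrightarrow> \<exists>d. homogeneous_poly d F"
    "\<And>v. v \<noteq> 0 \<Longrightarrow> point v \<in> C \<longleftrightarrow> (\<forall>F\<in>S. F v = 0)" "\<And>F. F \<in> S \<Longrightarrow> vanishes_on F C"
    using algebraic_set_equations[OF curve_algebraic] by metis
  obtain X X' Y Y' where XY: "(X, X') \<noteq> (0, 0)" "(Y, Y') \<noteq> (0, 0)" "L = point (seg X X' Y Y')"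
    using quadric_cases[OF L(1)] by metis
  then have "seg X X' Y Y' \<noteq> 0" by (auto simp: seg_eq_0_iff)
  then obtain F where F: "F \<in> S" "F (seg X X' Y Y') \<noteq> 0" using S(2) L(2) XY(3) by metis
  obtain d where d: "homogeneous_poly d F" using S(1)[OF F(1)] by (elim exE)
  obtain g where g: "\<And>x y. F (seg x 1 y 1) = eval2 g x y"
    using hom_poly_fun2[OF d, of "\<lambda>x y. seg x 1 y 1"] seg_coord_poly_fun2 unfolding poly_fun2_def by metis
  show thesis
  proof (rule that)
    show "vanishing (eval2 g)" using vanishes_on_imp_vanishing[OF d S(3)[OF F(1)]] unfolding g .
    show "g \<noteq> 0"
    proof
      assume "g = 0"
      then have 0: "F (seg x 1 y 1) = 0" for x y by (simp add: g)
      have 1: "F (seg x 1 y y') = 0" if "y' \<noteq> 0" for x y y'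
        using seg_scale_snd[of x 1 y' "y / y'" 1] that 0 hom_scaling[OF d] by simp
      have nz: "infinite (UNIV - {0 :: complex})" by (simp add: infinite_UNIV_char_0)
      have 2: "F (seg x 1 y y') = 0" for x y y'
      proof (rule poly_fun_zero_if_infinite[where h = "\<lambda>t. F (seg x 1 y t)"])
        show "poly_fun (\<lambda>t. F (seg x 1 y t))"
          by (rule hom_poly_fun[OF d]) (auto simp: seg_def intro!: poly_fun_intros)
        have "UNIV - {0} \<subseteq> {t. F (seg x 1 y t) = 0}" using 1 by auto
        then show "infinite {t. F (seg x 1 y t) = 0}" using nz finite_subset by metis
      qed
      have 3: "F (seg x x' y y') = 0" if "x' \<noteq> 0" for x x' y y'
        using seg_scale_fst[of x' "x / x'" 1 y y'] that 2 hom_scaling[OF d] by simp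
      have "F (seg x x' y y') = 0" for x x' y y'
      proof (rule poly_fun_zero_if_infinite[where h = "\<lambda>t. F (seg x t y y')"])
        show "poly_fun (\<lambda>t. F (seg x t y y'))"
          by (rule hom_poly_fun[OF d]) (auto simp: seg_def intro!: poly_fun_intros)
        have "UNIV - {0} \<subseteq> {t. F (seg x t y y') = 0}" using 3 by auto
        then show "infinite {t. F (seg x t y y') = 0}" using nz finite_subset by metis
      qed
      then show False using F(2) by simp
    qed
  qed
qed

text \<open>
  The parametrization \<open>seg x 1 y 1\<close> is affine in each of \<open>x\<close> and \<open>y\<close>, with directions
  \<open>seg 1 0 y 1\<close> and \<open>seg x 1 1 0\<close>.  So the derivatives of \<open>F\<close> in these directions are partial
  derivatives of its restriction to the chart; in the radial direction the derivative vanishes by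
  homogeneity.
\<close>

lemma directional_derivative:
  fixes x y :: complex
  defines "v \<equiv> seg x 1 y 1"
  assumes "homogeneous_poly d F" "F v = 0" and h: "\<And>x y. F (seg x 1 y 1) = eval2 h x y"
  shows "((\<lambda>t. F (v + t *s (\<alpha> *s v + \<beta> *s seg 1 0 y 1 + \<gamma> *s seg x 1 1 0))) has_field_derivative
      (\<beta> * eval2 (map_poly pderiv h) x y + \<gamma> * eval2 (pderiv h) x y)) (at 0)"
proof -
  obtain G where G: "\<And>u. ((\<lambda>t. F (v + t *s u)) has_field_derivative (\<Sum>i\<in>UNIV. G i * u $ i)) (at 0)"
    using hom_gradient[OF assms(2)] by metis
  define D where "D = (\<lambda>u :: complex ^ 4. \<Sum>i\<in>UNIV. G i * u $ i)"
  have G: "((\<lambda>t. F (v + t *s u)) has_field_derivative D u) (at 0)" for u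
    unfolding D_def by (rule G)
  have lin: "D (\<alpha> *s a + \<beta> *s b + \<gamma> *s c) = \<alpha> * D a + \<beta> * D b + \<gamma> * D c" for a b c
    unfolding D_def by (simp add: sum.distrib sum_distrib_left algebra_simps)
  have "v + t *s v = (1 + t) *s v" for t by (simp add: vec.scale_left_distrib)
  then have "(\<lambda>t. F (v + t *s v)) = (\<lambda>t. 0)"
    by (simp only: hom_scaling[OF assms(2)] assms(3) mult_zero_right)
  then have Dv: "D v = 0" using G[of v] DERIV_unique[OF _ DERIV_const] by metis
  have "v + t *s seg 1 0 y 1 = seg (x + t) 1 y 1" for t
    unfolding v_def by (intro l_eqI) (simp_all add: algebra_simps)
  then have "((\<lambda>t. eval2 h (x + t) y) has_field_derivative D (seg 1 0 y 1)) (at 0)"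
    using G[of "seg 1 0 y 1"] by (simp add: h)
  moreover have "((\<lambda>t. eval2 h (x + t) y) has_field_derivative eval2 (map_poly pderiv h) x y) (at 0)"
    using eval2_deriv_fst[of h y x] DERIV_shift[of "\<lambda>x. eval2 h x y" _ 0 x] by (simp add: add.commute)
  ultimately have Dx: "D (seg 1 0 y 1) = eval2 (map_poly pderiv h) x y" by (rule DERIV_unique)
  have "v + t *s seg x 1 1 0 = seg x 1 (y + t) 1" for t
    unfolding v_def by (intro l_eqI) (simp_all add: algebra_simps)
  then have "((\<lambda>t. eval2 h x (y + t)) has_field_derivative D (seg x 1 1 0)) (at 0)"
    using G[of "seg x 1 1 0"] by (simp add: h)
  moreover have "((\<lambda>t. eval2 h x (y + t)) has_field_derivative eval2 (pderiv h) x y) (at 0)"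
    using eval2_deriv_snd[of h x y] DERIV_shift[of "\<lambda>y. eval2 h x y" _ 0 y] by (simp add: add.commute)
  ultimately have Dy: "D (seg x 1 1 0) = eval2 (pderiv h) x y" by (rule DERIV_unique)
  show ?thesis using G[of "\<alpha> *s v + \<beta> *s seg 1 0 y 1 + \<gamma> *s seg x 1 1 0"]
    by (simp only: lin Dv Dx Dy mult_zero_right add_0)
qed

text \<open>
  If the differential of \<open>g\<close> is zero there is nothing to prove.  Otherwise \<open>g\<close> is a local equation of
  the curve at the point: the Zariski tangent space of the cone is cut out by the equations of the
  quadric and of \<open>g\<close>, so that it is spanned by \<open>v\<close> and \<open>- gy \<partial>/\<partial>x + gx \<partial>/\<partial>y\<close>.  Hence the point is
  smooth and the contact form vanishes on the second vector.  In both cases the conclusion holds, so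
  singular points need no separate treatment.
\<close>

lemma legendrian_at_point:
  fixes g :: "complex poly poly" and x y :: complex
  defines "v \<equiv> seg x 1 y 1" and "gx \<equiv> eval2 (map_poly pderiv g) x y" and "gy \<equiv> eval2 (pderiv g) x y"
  assumes leg: "legendrian \<theta> C" and on: "on_curve x y" and g: "vanishing (eval2 g)"
    and principal: "\<And>h. vanishing (eval2 h) \<Longrightarrow>
      \<exists>m. eval2 (map_poly pderiv h) x y = m * gx \<and> eval2 (pderiv h) x y = m * gy"
    and linear: "\<And>a b. \<theta> v (a *s seg 1 0 y 1 + b *s seg x 1 1 0) =
      a * \<theta> v (seg 1 0 y 1) + b * \<theta> v (seg x 1 1 0)"
  shows "\<theta> v (seg x 1 1 0) * gx = \<theta> v (seg 1 0 y 1) * gy"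
proof (cases "gx = 0 \<and> gy = 0")
  case False
  define u0 where "u0 = (- gy) *s seg 1 0 y 1 + gx *s seg x 1 1 0"
  have v_nz: "v \<noteq> 0" and v_on: "point v \<in> C"
    using on seg_affine_nz unfolding v_def on_curve_def by auto
  have l_v [simp]: "l1 v = x * y" "l2 v = x" "l3 v = y" "l4 v = 1" unfolding v_def by simp_all
  have l_u0 [simp]: "l2 u0 = - gy" "l3 u0 = gx" "l4 u0 = 0"
    unfolding u0_def l_add l_scale l_seg by simp_all
  have in_tangent: "\<alpha> *s v + \<tau> *s u0 \<in> cone_tangent C v" for \<alpha> \<tau>
    unfolding cone_tangent_def
  proof (intro CollectI allI impI)
    fix d F assume F: "homogeneous_poly d F" "vanishes_on F C"
    obtain h where h: "\<And>x y. F (seg x 1 y 1) = eval2 h x y"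
      using hom_poly_fun2[OF F(1), of "\<lambda>x y. seg x 1 y 1"] seg_coord_poly_fun2
      unfolding poly_fun2_def by metis
    have "vanishing (eval2 h)" using vanishes_on_imp_vanishing[OF F] by (simp add: h)
    from principal[OF this] obtain m
      where m: "eval2 (map_poly pderiv h) x y = m * gx" "eval2 (pderiv h) x y = m * gy"
      by (elim exE conjE)
    have "F v = 0" by (rule vanishes_on_C_D[OF F(2) v_on])
    have eq: "\<alpha> *s v + \<tau> *s u0 =
        \<alpha> *s v + (\<tau> * (- gy)) *s seg 1 0 y 1 + (\<tau> * gx) *s seg x 1 1 0"
      unfolding u0_def by (simp add: vec_eq_iff algebra_simps)
    show "((\<lambda>t. F (v + t *s (\<alpha> *s v + \<tau> *s u0))) has_field_derivative 0) (at 0)"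
      unfolding eq unfolding v_def
      by (rule DERIV_cong[OF directional_derivative[OF F(1) \<open>F v = 0\<close>[unfolded v_def] h]]) (simp add: m)
  qed
  have tangent_cases: "\<exists>\<alpha> \<tau>. u = \<alpha> *s v + \<tau> *s u0" if u: "u \<in> cone_tangent C v" for u
  proof -
    have tangent: "((\<lambda>t. F (v + t *s u)) has_field_derivative 0) (at 0)"
      if "homogeneous_poly d F" "vanishes_on F C" for d F
      using u that unfolding cone_tangent_def by simp
    define \<beta> where "\<beta> = l2 u - x * l4 u"
    define \<gamma> where "\<gamma> = l3 u - y * l4 u"
    \<comment> \<open>the equation of the quadric reduces \<open>u\<close> to three coordinates, the one of \<open>g\<close> to two\<close>
    have q: "homogeneous_poly (1 + 1) (\<lambda>v. l1 v * l4 v + (-1) * (l2 v * l3 v))"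
      by (intro hom_add hom_mult hom_scale hom_l)
    have "vanishes_on (\<lambda>v. l1 v * l4 v + (-1) * (l2 v * l3 v)) C"
      by (rule vanishing_extends[OF on q]) (simp add: vanishing_def)
    from tangent[OF q this]
    have "((\<lambda>t. (x * y + t * l1 u) * (1 + t * l4 u) - (x + t * l2 u) * (y + t * l3 u))
        has_field_derivative 0) (at 0)" by simp
    moreover have "((\<lambda>t. (x * y + t * l1 u) * (1 + t * l4 u) - (x + t * l2 u) * (y + t * l3 u))
        has_field_derivative (l1 u + x * y * l4 u - (l2 u * y + x * l3 u))) (at 0)"
      by (auto intro!: derivative_eq_intros)
    ultimately have "l1 u + x * y * l4 u - (l2 u * y + x * l3 u) = 0"
      by (rule DERIV_unique[symmetric])
    then have u_eq: "u = l4 u *s v + \<beta> *s seg 1 0 y 1 + \<gamma> *s seg x 1 1 0"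
      by (intro l_eqI; unfold l_add l_scale l_seg l_v \<beta>_def \<gamma>_def; simp add: algebra_simps)
    obtain d F where F: "homogeneous_poly d F" "\<And>x y. F (seg x 1 y 1) = eval2 g x y"
        "\<And>v. l4 v = 0 \<Longrightarrow> F v = 0"
      using homogenize[OF poly_fun2_eval2] by metis
    have van: "vanishes_on F C"
      by (rule vanishing_imp_vanishes_on[OF F(1) _ F(3)]) (simp_all add: F(2) g)
    then have "F v = 0" by (rule vanishes_on_C_D[OF _ v_on])
    from directional_derivative[OF F(1) this[unfolded v_def] F(2), of "l4 u" \<beta> \<gamma>]
    have "((\<lambda>t. F (v + t *s u)) has_field_derivative (\<beta> * gx + \<gamma> * gy)) (at 0)"
      unfolding gx_def gy_def by (subst u_eq) (simp only: v_def)
    from DERIV_unique[OF this tangent[OF F(1) van]] have eq: "\<beta> * gx + \<gamma> * gy = 0" .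
    have "\<exists>\<tau>. \<beta> = \<tau> * (- gy) \<and> \<gamma> = \<tau> * gx"
    proof (cases "gx = 0")
      case True
      then show ?thesis using False eq by (intro exI[of _ "- \<beta> / gy"]) auto
    next
      case nz: False
      have "\<beta> = - (\<gamma> * gy) / gx" using eq nz by (simp add: field_simps eq_neg_iff_add_eq_0)
      then show ?thesis using nz by (intro exI[of _ "\<gamma> / gx"]) simp
    qed
    then obtain \<tau> where "\<beta> = \<tau> * (- gy)" "\<gamma> = \<tau> * gx" by (elim exE conjE)
    then have "u = l4 u *s v + \<tau> *s u0"
      unfolding u0_def by (subst u_eq) (simp add: vec_eq_iff algebra_simps)
    then show ?thesis by (intro exI)
  qed
  have tangent_eq: "cone_tangent C v = vec.span {v, u0}"
  proof (intro subset_antisym subsetI)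
    fix u assume "u \<in> cone_tangent C v"
    then obtain \<alpha> \<tau> where "u = \<alpha> *s v + \<tau> *s u0" using tangent_cases by metis
    then show "u \<in> vec.span {v, u0}" by (auto intro: vec.span_add vec.span_scale vec.span_base)
  next
    fix u assume "u \<in> vec.span {v, u0}"
    then obtain \<alpha> where "u - \<alpha> *s v \<in> vec.span {u0}"
      by (rule vec.span_breakdown_eq[THEN iffD1, THEN exE])
    then obtain \<tau> where "u - \<alpha> *s v = \<tau> *s u0" unfolding vec.span_singleton by (elim rangeE)
    then have "u = \<alpha> *s v + \<tau> *s u0" by (simp add: diff_eq_eq add.commute)
    then show "u \<in> cone_tangent C v" using in_tangent by simp
  qed
  have u0_nz: "u0 \<noteq> 0" using False l_u0 l_zero by (metis neg_equal_0_iff_equal)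
  have "v \<notin> vec.span {u0}"
  proof
    assume "v \<in> vec.span {u0}"
    then obtain k where "v = k *s u0" unfolding vec.span_singleton by (elim rangeE)
    then have "l4 v = k * l4 u0" by simp
    then show False by simp
  qed
  then have "vec.independent {v, u0}" "v \<noteq> u0"
    using u0_nz by (auto simp: vec.independent_insert vec.span_base)
  then have "vec.dim (vec.span {v, u0}) = 2"
    by (simp add: vec.dim_span vec.dim_eq_card_independent)
  then have "smooth_curve_at C v" unfolding smooth_curve_at_def tangent_eq .
  moreover have "u0 \<in> cone_tangent C v" using in_tangent[of 0 1] by simp
  ultimately have "\<theta> v u0 = 0"
    using leg v_nz v_on self_mem_point[of v] unfolding legendrian_def by metis
  then show ?thesis unfolding u0_def linear by (simp add: algebra_simps)
qed simp

end

section \<open>Recognizing a rational curve\<close>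

text \<open>
  A curve is infinite, so it meets the image of \<open>\<gamma>\<close> in infinitely many points with \<open>s = 1\<close>; the only
  parameter left out, up to scaling, is \<open>(1, 0)\<close>.
\<close>

lemma algebraic_curve_eq_rational_curve:
  fixes \<gamma> :: "complex \<Rightarrow> complex \<Rightarrow> complex ^ 'n"
  assumes C: "algebraic_curve C"
    and nz: "\<And>t s. (t, s) \<noteq> (0, 0) \<Longrightarrow> \<gamma> t s \<noteq> 0"
    and poly1: "\<And>s i. poly_fun (\<lambda>t. \<gamma> t s $ i)" and poly2: "\<And>t i. poly_fun (\<lambda>s. \<gamma> t s $ i)"
    and hom: "\<And>k t s. k \<noteq> 0 \<Longrightarrow> \<exists>m. m \<noteq> 0 \<and> \<gamma> (k * t) (k * s) = m *s \<gamma> t s"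
    and sub: "\<And>L. L \<in> C \<Longrightarrow> \<exists>t s. (t, s) \<noteq> (0, 0) \<and> L = point (\<gamma> t s)"
    and ts: "(t, s) \<noteq> (0, 0)"
  shows "point (\<gamma> t s) \<in> C"
proof -
  have alg: "algebraic_set C"
    using C by (intro irreducible_set_algebraic) (simp add: algebraic_curve_def)
  have "C \<subseteq> insert (point (\<gamma> 1 0)) ((\<lambda>t. point (\<gamma> t 1)) ` {t. point (\<gamma> t 1) \<in> C})"
  proof
    fix L assume L: "L \<in> C"
    then obtain t s where ts: "(t, s) \<noteq> (0, 0)" "L = point (\<gamma> t s)" using sub by metis
    show "L \<in> insert (point (\<gamma> 1 0)) ((\<lambda>t. point (\<gamma> t 1)) ` {t. point (\<gamma> t 1) \<in> C})"
    proof (cases "s = 0")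
      case True
      then have "t \<noteq> 0" using ts(1) by simp
      from hom[OF this, of 1 0] obtain m where "m \<noteq> 0" "\<gamma> t 0 = m *s \<gamma> 1 0" by auto
      then have "L = point (\<gamma> 1 0)" using ts(2) True by (simp add: point_scale)
      then show ?thesis by simp
    next
      case False
      from hom[OF this, of "t / s" 1] False obtain m where "m \<noteq> 0" "\<gamma> t s = m *s \<gamma> (t / s) 1" by auto
      then have eq: "L = point (\<gamma> (t / s) 1)" using ts(2) by (simp add: point_scale)
      then show ?thesis using L by (intro insertI2 image_eqI[of _ _ "t / s"]) simp_all
    qed
  qed
  then have "infinite {t. point (\<gamma> t 1) \<in> C}"
    using algebraic_curve_infinite[OF C] by (metis finite_imageI finite_insert finite_subset)
  then show ?thesis
    by (intro algebraic_set_contains_rational_curve[where \<gamma> = \<gamma> and Z = C] alg poly1 poly2 ts)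
       (simp_all add: nz hom)
qed

text \<open>
  With \<open>a A + b B = 1\<close>, the element \<open>u^b v^a\<close> has the required powers.
\<close>

lemma common_root_of_coprime_powers:
  fixes u v :: complex
  assumes "coprime A B" "u ^ A = v ^ B" "u \<noteq> 0" "v \<noteq> 0"
  obtains t where "t ^ B = u" "t ^ A = v"
proof -
  obtain a b :: int where ab: "a * int A + b * int B = 1"
    using bezout_int[of "int A" "int B"] assms(1) by auto
  have uv: "u powi int A = v powi int B" using assms(2) by simp
  define t where "t = u powi b * v powi a"
  have "t ^ B = u powi (b * int B) * (v powi int B) powi a"
    unfolding t_def by (simp only: power_int_of_nat[symmetric] power_int_mult_distrib power_int_mult[symmetric] mult.commute)
  also have "\<dots> = u powi (b * int B) * u powi (a * int A)"
    unfolding uv[symmetric] by (simp add: power_int_mult mult.commute[of a])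
  also have "\<dots> = u powi (a * int A + b * int B)"
    using assms(3) by (simp add: power_int_add)
  finally have 1: "t ^ B = u" unfolding ab by simp
  have "t ^ A = (u powi int A) powi b * v powi (a * int A)"
    unfolding t_def by (simp only: power_int_of_nat[symmetric] power_int_mult_distrib power_int_mult[symmetric] mult.commute)
  also have "\<dots> = v powi (b * int B) * v powi (a * int A)"
    unfolding uv by (simp add: power_int_mult mult.commute[of b])
  also have "\<dots> = v powi (a * int A + b * int B)"
    using assms(4) by (simp add: power_int_add)
  finally have 2: "t ^ A = v" unfolding ab by simp
  from 1 2 show thesis by (rule that)
qed

context curve_in_chart
begin

lemma curve_eq_fibre_fst:
  assumes "(X, X') \<noteq> (0, 0)"
    and "\<And>x x' y y'. point (seg x x' y y') \<in> C \<Longrightarrow> (x, x') \<noteq> (0, 0) \<Longrightarrow> (y, y') \<noteq> (0, 0) \<Longrightarrow>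
      \<exists>k. k \<noteq> 0 \<and> x = k * X \<and> x' = k * X'"
  shows "C = {point (seg X X' y y') | y y'. (y, y') \<noteq> (0, 0)}"
proof -
  have sub: "\<exists>t s. (t, s) \<noteq> (0, 0) \<and> L = point (seg X X' t s)" if L: "L \<in> C" for L
  proof -
    have "L \<in> quadric" using L in_quadric by (rule subsetD[rotated])
    then obtain x x' y y' where xy: "(x, x') \<noteq> (0, 0)" "(y, y') \<noteq> (0, 0)" "L = point (seg x x' y y')"
      by (rule quadric_cases)
    then obtain k where "k \<noteq> 0" "x = k * X" "x' = k * X'" using assms(2) L by metis
    then have "L = point (seg X X' y y')" using xy(3) by (simp add: seg_scale_fst point_scale)
    then show ?thesis using xy(2) by (intro exI conjI)
  qed
  have "point (seg X X' t s) \<in> C" if "(t, s) \<noteq> (0, 0)" for t s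
  proof (rule algebraic_curve_eq_rational_curve[where \<gamma> = "seg X X'", OF curve _ _ _ _ sub that])
    show "seg X X' t s \<noteq> 0" if "(t, s) \<noteq> (0, 0)" for t s
      using that assms(1) by (auto simp: seg_eq_0_iff)
    show "poly_fun (\<lambda>t. seg X X' t s $ i)" "poly_fun (\<lambda>s. seg X X' t s $ i)" for t s i
      unfolding seg_def by (auto intro!: poly_fun_intros)
    show "\<exists>m. m \<noteq> 0 \<and> seg X X' (k * t) (k * s) = m *s seg X X' t s" if "k \<noteq> 0" for k t s
      using that seg_scale_snd by (intro exI[of _ k] conjI)
  qed
  then have "L \<in> C" if "L \<in> {point (seg X X' y y') | y y'. (y, y') \<noteq> (0, 0)}" for L
    using that by auto
  moreover have "L \<in> {point (seg X X' y y') | y y'. (y, y') \<noteq> (0, 0)}" if "L \<in> C" for L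
    using sub[OF that] by (elim exE conjE) (intro CollectI exI conjI)
  ultimately show ?thesis by (intro subset_antisym subsetI)
qed

lemma curve_eq_fibre_snd:
  assumes "(Y, Y') \<noteq> (0, 0)"
    and "\<And>x x' y y'. point (seg x x' y y') \<in> C \<Longrightarrow> (x, x') \<noteq> (0, 0) \<Longrightarrow> (y, y') \<noteq> (0, 0) \<Longrightarrow>
      \<exists>k. k \<noteq> 0 \<and> y = k * Y \<and> y' = k * Y'"
  shows "C = {point (seg x x' Y Y') | x x'. (x, x') \<noteq> (0, 0)}"
proof -
  have sub: "\<exists>t s. (t, s) \<noteq> (0, 0) \<and> L = point (seg t s Y Y')" if L: "L \<in> C" for L
  proof -
    have "L \<in> quadric" using L in_quadric by (rule subsetD[rotated])
    then obtain x x' y y' where xy: "(x, x') \<noteq> (0, 0)" "(y, y') \<noteq> (0, 0)" "L = point (seg x x' y y')"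
      by (rule quadric_cases)
    then obtain k where "k \<noteq> 0" "y = k * Y" "y' = k * Y'" using assms(2) L by metis
    then have "L = point (seg x x' Y Y')" using xy(3) by (simp add: seg_scale_snd point_scale)
    then show ?thesis using xy(1) by (intro exI conjI)
  qed
  have "point (seg t s Y Y') \<in> C" if "(t, s) \<noteq> (0, 0)" for t s
  proof (rule algebraic_curve_eq_rational_curve[where \<gamma> = "\<lambda>t s. seg t s Y Y'", OF curve _ _ _ _ sub that])
    show "seg t s Y Y' \<noteq> 0" if "(t, s) \<noteq> (0, 0)" for t s
      using that assms(1) by (auto simp: seg_eq_0_iff)
    show "poly_fun (\<lambda>t. seg t s Y Y' $ i)" "poly_fun (\<lambda>s. seg t s Y Y' $ i)" for t s i
      unfolding seg_def by (auto intro!: poly_fun_intros)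
    show "\<exists>m. m \<noteq> 0 \<and> seg (k * t) (k * s) Y Y' = m *s seg t s Y Y'" if "k \<noteq> 0" for k t s
      using that seg_scale_fst by (intro exI[of _ k] conjI)
  qed
  then have "L \<in> C" if "L \<in> {point (seg x x' Y Y') | x x'. (x, x') \<noteq> (0, 0)}" for L
    using that by auto
  moreover have "L \<in> {point (seg x x' Y Y') | x x'. (x, x') \<noteq> (0, 0)}" if "L \<in> C" for L
    using sub[OF that] by (elim exE conjE) (intro CollectI exI conjI)
  ultimately show ?thesis by (intro subset_antisym subsetI)
qed

definition fibre :: bool where
  "fibre \<longleftrightarrow>
    (\<exists>X X'. (X, X') \<noteq> (0, 0) \<and> C = {point (seg X X' y y') | y y'. (y, y') \<noteq> (0, 0)}) \<or>
    (\<exists>Y Y'. (Y, Y') \<noteq> (0, 0) \<and> C = {point (seg x x' Y Y') | x x'. (x, x') \<noteq> (0, 0)})"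

lemma l_on_curve:
  assumes "point v \<in> C"
  shows "l1 v * l4 v = l2 v * l3 v"
proof -
  have "point v \<in> quadric" using assms in_quadric by (rule subsetD[rotated])
  then show ?thesis using self_mem_point[of v] unfolding quadric_def quadric_eq by simp
qed

text \<open>
  Outside of the chart \<open>l4 = 0\<close>, so the equation of the quadric becomes \<open>l2 l3 = 0\<close> and splits into
  the two lines at infinity.
\<close>

lemma fibre_at_infinity:
  assumes "\<And>x y. \<not> on_curve x y"
  shows fibre
proof -
  have "vanishes_on l4 C"
    by (rule vanishing_imp_vanishes_on[OF hom_l(4)]) (simp_all add: vanishing_def assms)
  then have l4: "l4 v = 0" if "point v \<in> C" for v using that by (rule vanishes_on_C_D)
  have "vanishes_on (\<lambda>v. l2 v * l3 v) C"
    unfolding vanishes_on_C_iff[OF hom_mult[OF hom_l(2) hom_l(3)]]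
    using l4 l_on_curve by simp
  then have "vanishes_on l2 C \<or> vanishes_on l3 C"
    by (rule irreducible_set_prime[OF curve_irreducible hom_l(2) hom_l(3)])
  then show ?thesis
  proof
    assume "vanishes_on l2 C"
    then have l2: "l2 v = 0" if "point v \<in> C" for v using that by (rule vanishes_on_C_D)
    have "C = {point (seg x x' 1 0) | x x'. (x, x') \<noteq> (0, 0)}"
    proof (rule curve_eq_fibre_snd)
      fix x x' y y' :: complex
      assume *: "point (seg x x' y y') \<in> C" "(x, x') \<noteq> (0, 0)" "(y, y') \<noteq> (0, 0)"
      then have "x * y' = 0" "x' * y' = 0" using l2[OF *(1)] l4[OF *(1)] by simp_all
      then show "\<exists>k. k \<noteq> 0 \<and> y = k * 1 \<and> y' = k * 0" using *(2,3) by (intro exI[of _ y]) auto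
    qed simp
    then show ?thesis unfolding fibre_def by (intro disjI2 exI[of _ 1] exI[of _ 0] conjI) auto
  next
    assume "vanishes_on l3 C"
    then have l3: "l3 v = 0" if "point v \<in> C" for v using that by (rule vanishes_on_C_D)
    have "C = {point (seg 1 0 y y') | y y'. (y, y') \<noteq> (0, 0)}"
    proof (rule curve_eq_fibre_fst)
      fix x x' y y' :: complex
      assume *: "point (seg x x' y y') \<in> C" "(x, x') \<noteq> (0, 0)" "(y, y') \<noteq> (0, 0)"
      then have "x' * y = 0" "x' * y' = 0" using l3[OF *(1)] l4[OF *(1)] by simp_all
      then show "\<exists>k. k \<noteq> 0 \<and> x = k * 1 \<and> x' = k * 0" using *(2,3) by (intro exI[of _ x]) auto
    qed simp
    then show ?thesis unfolding fibre_def by (intro disjI1 exI[of _ 1] exI[of _ 0] conjI) auto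
  qed
qed

text \<open>
  The polynomial \<open>P\<close> is a product of linear factors; by primality one of them already vanishes.
\<close>

lemma vanishing_root:
  assumes "on_curve x0 y0" "poly_fun2 h" "P \<noteq> 0" "vanishing (\<lambda>x y. poly P (h x y))"
  obtains c where "vanishing (\<lambda>x y. h x y - c)"
  using assms(3,4)
proof (induction "degree P" arbitrary: P thesis)
  case 0
  then obtain c where c: "P = [:c:]" by (metis degree_eq_zeroE)
  then have "c = 0" using 0 assms(1) unfolding vanishing_def by simp
  then show ?case using 0 c by simp
next
  case (Suc n)
  then have "\<not> constant (poly P)" by (simp add: constant_degree)
  then obtain z where "poly P z = 0" using fundamental_theorem_of_algebra by metis
  then obtain Q where Q: "P = [:- z, 1:] * Q" unfolding poly_eq_0_iff_dvd by (elim dvdE)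
  then have Q0: "Q \<noteq> 0" using Suc.prems by auto
  then have deg: "n = degree Q" using Suc.hyps(2) unfolding Q by (subst (asm) degree_mult_eq) auto
  have hz: "poly_fun2 (\<lambda>x y. h x y - z)"
    using poly_fun2_add[OF assms(2) poly_fun2_const[of "- z"]] by simp
  have "vanishing (\<lambda>x y. (h x y - z) * poly Q (h x y))"
    using Suc.prems(3) unfolding Q vanishing_def by (simp add: algebra_simps)
  from vanishing_prime[OF hz poly_fun2_poly[OF assms(2)] this]
  show ?case
  proof
    assume "vanishing (\<lambda>x y. h x y - z)"
    then show ?case by (rule Suc.prems(1))
  next
    assume "vanishing (\<lambda>x y. poly Q (h x y))"
    with Q0 show ?case by (intro Suc.hyps(1)[OF deg Suc.prems(1)])
  qed
qed

text \<open>
  Once \<open>x = c\<close> holds in the chart, both \<open>l2 - c l4\<close> and \<open>l1 - c l3\<close> vanish on the whole curve.  The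
  first alone would leave the line at infinity \<open>y' = 0\<close>.
\<close>

lemma fibre_of_fst:
  assumes "on_curve x0 y0" "P \<noteq> 0" "vanishing (\<lambda>x y. poly P x)"
  shows fibre
proof -
  obtain c where c: "vanishing (\<lambda>x y. x - c)"
    using vanishing_root[OF assms(1) poly_fun2_fst assms(2,3)] .
  have h1: "homogeneous_poly 1 (\<lambda>v. l2 v + (- c) * l4 v)"
    and h2: "homogeneous_poly 1 (\<lambda>v. l1 v + (- c) * l3 v)"
    by (intro hom_add hom_scale hom_l)+
  have "vanishes_on (\<lambda>v. l2 v + (- c) * l4 v) C"
    by (rule vanishing_extends[OF assms(1) h1]) (use c in \<open>auto simp: vanishing_def\<close>)
  from vanishes_on_C_D[OF this] have 1: "l2 v + (- c) * l4 v = 0" if "point v \<in> C" for v using that .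
  have "vanishes_on (\<lambda>v. l1 v + (- c) * l3 v) C"
    by (rule vanishing_extends[OF assms(1) h2]) (use c in \<open>auto simp: vanishing_def\<close>)
  from vanishes_on_C_D[OF this] have 2: "l1 v + (- c) * l3 v = 0" if "point v \<in> C" for v using that .
  have "C = {point (seg c 1 y y') | y y'. (y, y') \<noteq> (0, 0)}"
  proof (rule curve_eq_fibre_fst)
    fix x x' y y' :: complex
    assume *: "point (seg x x' y y') \<in> C" "(x, x') \<noteq> (0, 0)" "(y, y') \<noteq> (0, 0)"
    have "(x - c * x') * y' = 0" "(x - c * x') * y = 0"
      using 1[OF *(1)] 2[OF *(1)] by (simp_all add: algebra_simps)
    then have "x = c * x'" using *(3) by auto
    then show "\<exists>k. k \<noteq> 0 \<and> x = k * c \<and> x' = k * 1" using *(2) by (intro exI[of _ x']) auto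
  qed simp
  then show ?thesis unfolding fibre_def by (intro disjI1 exI[of _ c] exI[of _ 1] conjI) auto
qed

lemma fibre_of_snd:
  assumes "on_curve x0 y0" "P \<noteq> 0" "vanishing (\<lambda>x y. poly P y)"
  shows fibre
proof -
  obtain c where c: "vanishing (\<lambda>x y. y - c)"
    using vanishing_root[OF assms(1) poly_fun2_snd assms(2,3)] .
  have h1: "homogeneous_poly 1 (\<lambda>v. l3 v + (- c) * l4 v)"
    and h2: "homogeneous_poly 1 (\<lambda>v. l1 v + (- c) * l2 v)"
    by (intro hom_add hom_scale hom_l)+
  have "vanishes_on (\<lambda>v. l3 v + (- c) * l4 v) C"
    by (rule vanishing_extends[OF assms(1) h1]) (use c in \<open>auto simp: vanishing_def\<close>)
  from vanishes_on_C_D[OF this] have 1: "l3 v + (- c) * l4 v = 0" if "point v \<in> C" for v using that .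
  have "vanishes_on (\<lambda>v. l1 v + (- c) * l2 v) C"
    by (rule vanishing_extends[OF assms(1) h2]) (use c in \<open>auto simp: vanishing_def\<close>)
  from vanishes_on_C_D[OF this] have 2: "l1 v + (- c) * l2 v = 0" if "point v \<in> C" for v using that .
  have "C = {point (seg x x' c 1) | x x'. (x, x') \<noteq> (0, 0)}"
  proof (rule curve_eq_fibre_snd)
    fix x x' y y' :: complex
    assume *: "point (seg x x' y y') \<in> C" "(x, x') \<noteq> (0, 0)" "(y, y') \<noteq> (0, 0)"
    have "x' * (y - c * y') = 0" "x * (y - c * y') = 0"
      using 1[OF *(1)] 2[OF *(1)] by (simp_all add: algebra_simps)
    then have "y = c * y'" using *(2) by auto
    then show "\<exists>k. k \<noteq> 0 \<and> y = k * c \<and> y' = k * 1" using *(3) by (intro exI[of _ y']) auto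
  qed simp
  then show ?thesis unfolding fibre_def by (intro disjI2 exI[of _ c] exI[of _ 1] conjI) auto
qed

text \<open>
  The bihomogeneous equation has bidegree \<open>(A, B)\<close>, which is not the restriction of a form on
  \<open>complex ^ 4\<close> unless \<open>A = B\<close>.  With \<open>D\<close> the difference of the exponents, its products with the powers
  \<open>D\<close> of the two homogeneous coordinates of the factor of smaller degree are such restrictions, and
  these coordinates do not vanish simultaneously.  Coprimality of \<open>A\<close> and \<open>B\<close> makes the locus a single
  rational curve \<open>x = g t^B\<close>, \<open>y = t^(- A)\<close> with \<open>g^A = c\<close>.
\<close>

lemma curve_eq_monomial:
  assumes on: "on_curve x0 y0" and AB: "A > 0" "B > 0" "coprime A B" and c: "c \<noteq> 0"
    and van: "vanishing (\<lambda>x y. x ^ A * y ^ B - c)"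
  shows "C = {point (seg x x' y y') | x x' y y'. (x, x') \<noteq> (0, 0) \<and> (y, y') \<noteq> (0, 0) \<and>
    x ^ A * y ^ B = c * (x' ^ A * y' ^ B)}" (is "C = ?R")
proof -
  have equation: "x ^ A * y ^ B = c * (x' ^ A * y' ^ B)"
    if *: "point (seg x x' y y') \<in> C" "(x, x') \<noteq> (0, 0)" "(y, y') \<noteq> (0, 0)" for x x' y y'
  proof (cases "B \<le> A")
    case True
    then obtain D where D: "A = B + D" by (metis le_iff_add)
    have h1: "homogeneous_poly A (\<lambda>v. l1 v ^ B * l2 v ^ D + (- c) * l4 v ^ A)"
      using hom_add[OF hom_mult[OF hom_linear_power[OF hom_l(1), of B] hom_linear_power[OF hom_l(2), of D]]
        hom_scale[OF hom_linear_power[OF hom_l(4), of "B + D"], of "- c"]] D by simp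
    have h2: "homogeneous_poly A (\<lambda>v. l1 v ^ A + (- c) * (l4 v ^ B * l3 v ^ D))"
      using hom_add[OF hom_linear_power[OF hom_l(1), of "B + D"]
        hom_scale[OF hom_mult[OF hom_linear_power[OF hom_l(4), of B] hom_linear_power[OF hom_l(3), of D]], of "- c"]] D by simp
    have "vanishes_on (\<lambda>v. l1 v ^ B * l2 v ^ D + (- c) * l4 v ^ A) C"
      by (rule vanishing_extends[OF on h1])
         (use van in \<open>simp add: vanishing_def D power_add power_mult_distrib algebra_simps\<close>)
    from vanishes_on_C_D[OF this *(1)]
    have 1: "y' ^ D * (x ^ A * y ^ B - c * (x' ^ A * y' ^ B)) = 0"
      by (simp add: D power_add power_mult_distrib algebra_simps)
    have "(x * y) ^ A - c * y ^ D = y ^ D * (x ^ A * y ^ B - c)" for x y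
      by (simp add: D power_add power_mult_distrib algebra_simps)
    then have "vanishes_on (\<lambda>v. l1 v ^ A + (- c) * (l4 v ^ B * l3 v ^ D)) C"
      by (intro vanishing_extends[OF on h2]) (use van in \<open>simp add: vanishing_def\<close>)
    from vanishes_on_C_D[OF this *(1)]
    have 2: "y ^ D * (x ^ A * y ^ B - c * (x' ^ A * y' ^ B)) = 0"
      by (simp add: D power_add power_mult_distrib algebra_simps)
    from 1 2 *(3) show ?thesis by auto
  next
    case False
    then obtain D where D: "B = A + D" by (metis le_iff_add nat_le_linear)
    have h1: "homogeneous_poly B (\<lambda>v. l1 v ^ A * l3 v ^ D + (- c) * l4 v ^ B)"
      using hom_add[OF hom_mult[OF hom_linear_power[OF hom_l(1), of A] hom_linear_power[OF hom_l(3), of D]]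
        hom_scale[OF hom_linear_power[OF hom_l(4), of "A + D"], of "- c"]] D by simp
    have h2: "homogeneous_poly B (\<lambda>v. l1 v ^ B + (- c) * (l4 v ^ A * l2 v ^ D))"
      using hom_add[OF hom_linear_power[OF hom_l(1), of "A + D"]
        hom_scale[OF hom_mult[OF hom_linear_power[OF hom_l(4), of A] hom_linear_power[OF hom_l(2), of D]], of "- c"]] D by simp
    have "vanishes_on (\<lambda>v. l1 v ^ A * l3 v ^ D + (- c) * l4 v ^ B) C"
      by (rule vanishing_extends[OF on h1])
         (use van in \<open>simp add: vanishing_def D power_add power_mult_distrib algebra_simps\<close>)
    from vanishes_on_C_D[OF this *(1)]
    have 1: "x' ^ D * (x ^ A * y ^ B - c * (x' ^ A * y' ^ B)) = 0"
      by (simp add: D power_add power_mult_distrib algebra_simps)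
    have "(x * y) ^ B - c * x ^ D = x ^ D * (x ^ A * y ^ B - c)" for x y
      by (simp add: D power_add power_mult_distrib algebra_simps)
    then have "vanishes_on (\<lambda>v. l1 v ^ B + (- c) * (l4 v ^ A * l2 v ^ D)) C"
      by (intro vanishing_extends[OF on h2]) (use van in \<open>simp add: vanishing_def\<close>)
    from vanishes_on_C_D[OF this *(1)]
    have 2: "x ^ D * (x ^ A * y ^ B - c * (x' ^ A * y' ^ B)) = 0"
      by (simp add: D power_add power_mult_distrib algebra_simps)
    from 1 2 *(2) show ?thesis by auto
  qed
  define g where "g = exp (Ln c / of_nat A)"
  have g: "g ^ A = c" unfolding g_def using AB(1) c by (simp flip: exp_of_nat_mult)
  then have g0: "g \<noteq> 0" using c AB(1) by auto
  have z: "0 ^ A = (0 :: complex)" "0 ^ B = (0 :: complex)" using AB by (simp_all add: zero_power)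
  define \<gamma> where "\<gamma> = (\<lambda>t s. seg (g * t ^ B) (s ^ B) (s ^ A) (t ^ A))"
  have param: "\<exists>t s. (t, s) \<noteq> (0, 0) \<and> point (seg x x' y y') = point (\<gamma> t s)"
    if *: "(x, x') \<noteq> (0, 0)" "(y, y') \<noteq> (0, 0)" "x ^ A * y ^ B = c * (x' ^ A * y' ^ B)" for x x' y y'
  proof -
    consider "x' = 0" | "y' = 0" | "x' \<noteq> 0" "y' \<noteq> 0" by blast
    then show ?thesis
    proof cases
      case 1
      then have "x \<noteq> 0" "y = 0" "y' \<noteq> 0" using * by (auto simp: z)
      have "seg x 0 0 y' = (x * y' / g) *s \<gamma> 1 0"
        unfolding \<gamma>_def using g0 by (intro l_eqI) (simp_all add: z)
      then have "point (seg x x' y y') = point (\<gamma> 1 0)"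
        using 1 \<open>x \<noteq> 0\<close> \<open>y = 0\<close> \<open>y' \<noteq> 0\<close> g0 by (simp add: point_scale)
      then show ?thesis by (intro exI[of _ 1] exI[of _ 0]) simp
    next
      case 2
      then have "y \<noteq> 0" "x = 0" "x' \<noteq> 0" using * by (auto simp: z)
      have "seg 0 x' y 0 = (x' * y) *s \<gamma> 0 1"
        unfolding \<gamma>_def using g0 by (intro l_eqI) (simp_all add: z)
      then have "point (seg x x' y y') = point (\<gamma> 0 1)"
        using 2 \<open>y \<noteq> 0\<close> \<open>x = 0\<close> \<open>x' \<noteq> 0\<close> by (simp add: point_scale)
      then show ?thesis by (intro exI[of _ 0] exI[of _ 1]) simp
    next
      case 3
      have nz: "x \<noteq> 0" "y \<noteq> 0" using *(3) 3 c by (auto simp: z)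
      have "(x / (x' * g)) ^ A = (y' / y) ^ B"
        using *(3) nz 3 g0 c by (simp add: field_simps power_mult_distrib power_divide g)
      moreover have "x / (x' * g) \<noteq> 0" "y' / y \<noteq> 0" using nz 3 g0 by simp_all
      ultimately obtain t where t: "t ^ B = x / (x' * g)" "t ^ A = y' / y"
        by (rule common_root_of_coprime_powers[OF AB(3)])
      have "seg x x' y y' = (x' * y) *s \<gamma> t 1"
        unfolding \<gamma>_def t using nz 3 g0 by (intro l_eqI) (simp_all add: field_simps)
      then have "point (seg x x' y y') = point (\<gamma> t 1)" using 3 nz by (simp add: point_scale)
      then show ?thesis by (intro exI[of _ t] exI[of _ 1]) simp
    qed
  qed
  have sub: "L \<in> ?R" if L: "L \<in> C" for L
  proof -
    have "L \<in> quadric" using L in_quadric by (rule subsetD[rotated])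
    then obtain x x' y y' where xy: "(x, x') \<noteq> (0, 0)" "(y, y') \<noteq> (0, 0)" "L = point (seg x x' y y')"
      by (rule quadric_cases)
    then show ?thesis using equation L by blast
  qed
  have "point (\<gamma> t s) \<in> C" if "(t, s) \<noteq> (0, 0)" for t s
  proof (rule algebraic_curve_eq_rational_curve[where \<gamma> = \<gamma>, OF curve _ _ _ _ _ that])
    show "\<gamma> t s \<noteq> 0" if "(t, s) \<noteq> (0, 0)" for t s
      using that g0 AB unfolding \<gamma>_def by (auto simp: seg_eq_0_iff)
    show "poly_fun (\<lambda>t. \<gamma> t s $ i)" "poly_fun (\<lambda>s. \<gamma> t s $ i)" for t s i
      unfolding \<gamma>_def seg_def by (auto intro!: poly_fun_intros)
    show "\<exists>m. m \<noteq> 0 \<and> \<gamma> (k * t) (k * s) = m *s \<gamma> t s" if "k \<noteq> 0" for k t s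
      unfolding \<gamma>_def using that
      by (intro exI[of _ "k ^ (A + B)"] conjI l_eqI) (simp_all add: power_add power_mult_distrib algebra_simps)
    show "\<exists>t s. (t, s) \<noteq> (0, 0) \<and> L = point (\<gamma> t s)" if "L \<in> C" for L
      using sub[OF that] param by auto
  qed
  then have "L \<in> C" if R: "L \<in> ?R" for L
  proof -
    obtain x x' y y' where xy: "L = point (seg x x' y y')" "(x, x') \<noteq> (0, 0)" "(y, y') \<noteq> (0, 0)"
        "x ^ A * y ^ B = c * (x' ^ A * y' ^ B)"
      using R unfolding mem_Collect_eq by (elim exE conjE)
    obtain t s where "(t, s) \<noteq> (0, 0)" "L = point (\<gamma> t s)"
      using param[OF xy(2-4)] unfolding xy(1) by (elim exE conjE)
    then show ?thesis using \<open>\<And>t s. (t, s) \<noteq> (0, 0) \<Longrightarrow> point (\<gamma> t s) \<in> C\<close> by simp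
  qed
  then show ?thesis using sub by (intro subset_antisym subsetI)
qed

end

section \<open>Legendrian curves in an adapted chart\<close>

text \<open>
  In the chart the form reads \<open>(\<kappa> y + \<epsilon>) dx + \<rho> x dy\<close>.  The function \<open>x^A y^B\<close> is constant along the
  curves tangent to its kernel when \<open>\<epsilon> = 0\<close> and \<open>A \<rho> = B \<kappa>\<close>.  The last assumption excludes negative
  rational values of the ratio of \<open>\<kappa>\<close> and \<open>\<rho>\<close>, for which first integrals have the form \<open>x^A / y^B\<close>;
  exchanging \<open>0\<close> and \<open>\<infinity>\<close> in one coordinate reduces them to the other sign.
\<close>

locale legendrian_chart = curve_in_chart +
  fixes \<theta> :: "complex ^ 4 \<Rightarrow> complex ^ 4 \<Rightarrow> complex" and \<rho> \<kappa> \<epsilon> :: complex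
  assumes leg: "legendrian \<theta> C"
    and linear: "\<theta> v (\<alpha> *s u + \<beta> *s w) = \<alpha> * \<theta> v u + \<beta> * \<theta> v w"
    and form_fst: "\<theta> (seg x 1 y 1) (seg 1 0 y 1) = \<kappa> * y + \<epsilon>"
    and form_snd: "\<theta> (seg x 1 y 1) (seg x 1 1 0) = \<rho> * x"
    and \<rho>_nz: "\<rho> \<noteq> 0" and \<kappa>_or_\<epsilon>: "\<kappa> = 0 \<or> \<epsilon> = 0"
    and ratio: "\<And>A B :: nat. A > 0 \<Longrightarrow> B > 0 \<Longrightarrow> of_nat A * \<rho> + of_nat B * \<kappa> \<noteq> 0"
begin

text \<open>
  The derivative along \<open>\<rho> x \<partial>/\<partial>x - (\<kappa> y + \<epsilon>) \<partial>/\<partial>y\<close>, the vector field in the kernel of the form.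
\<close>

definition derivation :: "complex poly poly \<Rightarrow> complex poly poly" where
  "derivation g = smult [:0, \<rho>:] (map_poly pderiv g) - [:[:\<epsilon>:], [:\<kappa>:]:] * pderiv g"

lemma eval2_derivation:
  "eval2 (derivation g) x y = \<rho> * x * eval2 (map_poly pderiv g) x y - (\<kappa> * y + \<epsilon>) * eval2 (pderiv g) x y"
  unfolding derivation_def by (simp add: eval2_pCons algebra_simps)

lemma coeff_derivation:
  "coeff (coeff (derivation g) j) i = (\<rho> * of_nat i - \<kappa> * of_nat j) * coeff (coeff g j) i
    - \<epsilon> * of_nat (Suc j) * coeff (coeff g (Suc j)) i"
proof -
  have 1: "coeff ([:0, \<rho>:] * pderiv p) i = \<rho> * of_nat i * coeff p i" for p
    by (cases i) (simp_all add: coeff_pderiv algebra_simps)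
  have of_nat_coeff: "coeff (of_nat n * p) i = of_nat n * coeff p i" for n and p :: "complex poly"
    by (simp add: of_nat_poly)
  have "coeff ([:[:\<epsilon>:], [:\<kappa>:]:] * pderiv g) j =
      smult \<epsilon> (of_nat (Suc j) * coeff g (Suc j)) + smult \<kappa> (of_nat j * coeff g j)"
    by (cases j) (simp_all add: coeff_pderiv smult_add_right algebra_simps)
  then have 2: "coeff (coeff ([:[:\<epsilon>:], [:\<kappa>:]:] * pderiv g) j) i =
      \<epsilon> * of_nat (Suc j) * coeff (coeff g (Suc j)) i + \<kappa> * of_nat j * coeff (coeff g j) i"
    by (simp only: coeff_add coeff_smult of_nat_coeff mult.assoc)
  have "coeff (coeff (derivation g) j) i = coeff ([:0, \<rho>:] * pderiv (coeff g j)) i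
      - coeff (coeff ([:[:\<epsilon>:], [:\<kappa>:]:] * pderiv g) j) i"
    unfolding derivation_def by (simp only: coeff_diff coeff_smult coeff_map_poly pderiv_0)
  then show ?thesis unfolding 1 2 by (simp only: algebra_simps)
qed

lemma degree_derivation: "degree (derivation g) \<le> degree g"
proof (rule degree_le, intro allI impI)
  fix j assume "j > degree g"
  then have "coeff g j = 0" "coeff g (Suc j) = 0" by (auto simp: coeff_eq_0)
  then show "coeff (derivation g) j = 0" by (intro poly_eqI) (simp add: coeff_derivation)
qed

definition no_fibre_poly :: bool where
  "no_fibre_poly \<longleftrightarrow> (\<forall>p. p \<noteq> 0 \<longrightarrow> \<not> vanishing (\<lambda>x y. poly p x) \<and> \<not> vanishing (\<lambda>x y. poly p y))"

definition min_degree :: nat where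
  "min_degree = (LEAST n. \<exists>g. g \<noteq> 0 \<and> vanishing (eval2 g) \<and> degree g = n)"

definition minimal :: "complex poly poly \<Rightarrow> bool" where
  "minimal g \<longleftrightarrow> g \<noteq> 0 \<and> vanishing (eval2 g) \<and> degree g = min_degree"

lemma exists_minimal: "\<exists>g. minimal g"
proof -
  obtain g where "g \<noteq> 0" "vanishing (eval2 g)" using exists_vanishing .
  then have "\<exists>n g. g \<noteq> 0 \<and> vanishing (eval2 g) \<and> degree g = n" by auto
  from LeastI_ex[OF this] show ?thesis unfolding minimal_def min_degree_def .
qed

lemma min_degree_le: "g \<noteq> 0 \<Longrightarrow> vanishing (eval2 g) \<Longrightarrow> min_degree \<le> degree g"
  unfolding min_degree_def by (rule Least_le) auto

text \<open>
  The remainder of a pseudo-division by \<open>g\<close> vanishes on the curve and has smaller degree.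
\<close>

lemma minimal_divides:
  assumes "minimal g" "vanishing (eval2 h)"
  obtains k q where "smult (lead_coeff g ^ k) h = g * q"
proof -
  obtain q r where qr: "pseudo_divmod h g = (q, r)" by (cases "pseudo_divmod h g")
  define k where "k = Suc (degree h) - degree g"
  have g: "g \<noteq> 0" "vanishing (eval2 g)" "degree g = min_degree" using assms(1) unfolding minimal_def by auto
  have div: "smult (lead_coeff g ^ k) h = g * q + r" "r = 0 \<or> degree r < degree g"
    using pseudo_divmod[OF g(1) qr] unfolding k_def by auto
  have "eval2 r x y = poly (lead_coeff g ^ k) x * eval2 h x y - eval2 g x y * eval2 q x y" for x y
    using arg_cong[OF div(1), of "\<lambda>p. eval2 p x y"] by simp
  then have "vanishing (eval2 r)" using assms(2) g(2) unfolding vanishing_def by simp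
  then have "r = 0" using div(2) min_degree_le[of r] g(3) by linarith
  then show thesis using div(1) that by simp
qed

text \<open>
  Where the leading coefficient of \<open>g\<close> does not vanish, pseudo-division makes the differential of every
  vanishing \<open>h\<close> a multiple of the one of \<open>g\<close>, and \<open>legendrian_at_point\<close> applies.  Multiplying by the
  leading coefficient covers the other points, and primality removes this factor, as it is a
  nonzero polynomial in \<open>x\<close> alone.
\<close>

lemma minimal_derivation_vanishing:
  assumes np: no_fibre_poly and g: "minimal g"
  shows "vanishing (eval2 (derivation g))"
proof -
  have g0: "g \<noteq> 0" and van: "vanishing (eval2 g)" using g unfolding minimal_def by auto
  have lc: "poly_fun2 (\<lambda>x y. poly (lead_coeff g) x)" by (intro poly_fun2_intros)
  have "vanishing (\<lambda>x y. poly (lead_coeff g) x * eval2 (derivation g) x y)"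
    unfolding vanishing_def
  proof (intro allI impI)
    fix x y assume on: "on_curve x y"
    show "poly (lead_coeff g) x * eval2 (derivation g) x y = 0"
    proof (cases "poly (lead_coeff g) x = 0")
      case False
      have "\<theta> (seg x 1 y 1) (seg x 1 1 0) * eval2 (map_poly pderiv g) x y =
          \<theta> (seg x 1 y 1) (seg 1 0 y 1) * eval2 (pderiv g) x y"
      proof (rule legendrian_at_point[OF leg on van])
        fix h assume h: "vanishing (eval2 h)"
        obtain k q where kq: "smult (lead_coeff g ^ k) h = g * q" by (rule minimal_divides[OF g h])
        define c where "c = lead_coeff g ^ k"
        have c0: "poly c x \<noteq> 0" using False unfolding c_def by simp
        have eq: "poly c x * eval2 h x y = eval2 g x y * eval2 q x y" for x y
          using arg_cong[OF kq, of "\<lambda>p. eval2 p x y"] unfolding c_def by simp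
        have at: "eval2 g x y = 0" "eval2 h x y = 0" using van h on unfolding vanishing_def by simp_all
        have "((\<lambda>x. poly c x * eval2 h x y) has_field_derivative
            poly c x * eval2 (map_poly pderiv h) x y) (at x)"
          by (rule DERIV_cong[OF DERIV_mult[OF poly_DERIV eval2_deriv_fst]]) (simp add: at)
        moreover have "((\<lambda>x. poly c x * eval2 h x y) has_field_derivative
            eval2 q x y * eval2 (map_poly pderiv g) x y) (at x)"
          unfolding eq by (rule DERIV_cong[OF DERIV_mult[OF eval2_deriv_fst eval2_deriv_fst]]) (simp add: at)
        ultimately have 1: "poly c x * eval2 (map_poly pderiv h) x y = eval2 q x y * eval2 (map_poly pderiv g) x y"
          by (rule DERIV_unique)
        have "((\<lambda>y. poly c x * eval2 h x y) has_field_derivative poly c x * eval2 (pderiv h) x y) (at y)"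
          by (rule DERIV_cmult[OF eval2_deriv_snd])
        moreover have "((\<lambda>y. poly c x * eval2 h x y) has_field_derivative eval2 q x y * eval2 (pderiv g) x y) (at y)"
          unfolding eq by (rule DERIV_cong[OF DERIV_mult[OF eval2_deriv_snd eval2_deriv_snd]]) (simp add: at)
        ultimately have 2: "poly c x * eval2 (pderiv h) x y = eval2 q x y * eval2 (pderiv g) x y"
          by (rule DERIV_unique)
        show "\<exists>m. eval2 (map_poly pderiv h) x y = m * eval2 (map_poly pderiv g) x y \<and>
            eval2 (pderiv h) x y = m * eval2 (pderiv g) x y"
          using 1 2 c0 by (intro exI[of _ "eval2 q x y / poly c x"]) (simp add: field_simps)
      qed (rule linear)
      then show ?thesis by (simp add: eval2_derivation form_fst form_snd)
    qed simp
  qed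
  from vanishing_prime[OF lc poly_fun2_eval2 this] show ?thesis
    using np g0 unfolding no_fibre_poly_def by auto
qed

text \<open>
  Choose \<open>g\<close> minimal with as few monomials as possible in its leading coefficient.  The derivation acts
  on that coefficient diagonally, and \<open>w\<close> is its eigenvalue on one of the monomials.  So the
  difference of the derivative and \<open>w g\<close> has fewer monomials there and must be zero.
\<close>

lemma exists_eigenvector:
  assumes np: no_fibre_poly
  obtains g w where "minimal g" "derivation g = smult [:w:] g"
proof -
  define supp where "supp g = {i. coeff (lead_coeff g) i \<noteq> 0}" for g :: "complex poly poly"
  have fin: "finite (supp g)" for g
    by (rule finite_subset[of _ "{..degree (lead_coeff g)}"]) (auto simp: supp_def le_degree)
  obtain g where g: "minimal g" and least: "\<And>h. minimal h \<Longrightarrow> card (supp g) \<le> card (supp h)"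
    using ex_has_least_nat[of minimal _ "\<lambda>g. card (supp g)"] exists_minimal by metis
  have g0: "g \<noteq> 0" and van: "vanishing (eval2 g)" and deg: "degree g = min_degree"
    using g unfolding minimal_def by auto
  have "lead_coeff g \<noteq> 0" using g0 by simp
  then obtain i0 where i0: "coeff (lead_coeff g) i0 \<noteq> 0" by (metis poly_eqI coeff_0)
  define w where "w = \<rho> * of_nat i0 - \<kappa> * of_nat (degree g)"
  define h where "h = derivation g - smult [:w:] g"
  have "h = 0"
  proof (rule ccontr)
    assume h0: "h \<noteq> 0"
    have hv: "vanishing (eval2 h)"
      using minimal_derivation_vanishing[OF np g] van unfolding vanishing_def h_def by simp
    have "degree h \<le> degree g"
      unfolding h_def by (intro degree_diff_le degree_derivation order.trans[OF degree_smult_le]) simp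
    then have degh: "degree h = degree g" using min_degree_le[OF h0 hv] deg by simp
    then have "minimal h" unfolding minimal_def using h0 hv deg by simp
    have "coeff (lead_coeff h) i = \<rho> * (of_nat i - of_nat i0) * coeff (lead_coeff g) i" for i
      unfolding degh unfolding h_def w_def by (simp add: coeff_derivation coeff_eq_0 algebra_simps)
    then have "supp h \<subset> supp g" using i0 unfolding supp_def by auto
    then have "card (supp h) < card (supp g)" by (rule psubset_card_mono[OF fin])
    then show False using least[OF \<open>minimal h\<close>] by simp
  qed
  then have "derivation g = smult [:w:] g" unfolding h_def by simp
  with g show thesis by (rule that)
qed

text \<open>
  Comparing coefficients of the eigenvector equation at the two highest powers of \<open>y\<close> rules out
  \<open>\<epsilon> \<noteq> 0\<close>.  Then all exponents \<open>(i, j)\<close> of \<open>g\<close> satisfy \<open>\<rho> i - \<kappa> j = w\<close>.  They are not all on a vertical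
  line \<open>i = i0\<close>, for otherwise \<open>g\<close> would be \<open>x^i0\<close> times a polynomial in \<open>y\<close>.  So the line has a
  rational slope, positive by the assumption on the ratio of \<open>\<rho>\<close> and \<open>\<kappa>\<close>, and \<open>g\<close> is \<open>x^i0 y^j0\<close> times a
  polynomial in \<open>x^A y^B\<close>.
\<close>

lemma monomial_equation:
  assumes np: no_fibre_poly and on: "on_curve x0 y0"
  obtains A B :: nat and c where "A > 0" "B > 0" "coprime A B" "c \<noteq> 0"
    "vanishing (\<lambda>x y. x ^ A * y ^ B - c)"
proof -
  obtain g w where g: "minimal g" and eig: "derivation g = smult [:w:] g"
    using exists_eigenvector[OF np] .
  have g0: "g \<noteq> 0" and van: "vanishing (eval2 g)" using g unfolding minimal_def by auto
  define a where "a i j = coeff (coeff g j) i" for i j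
  have not_fst: "\<not> vanishing (\<lambda>x y. x ^ n)" for n
  proof -
    have "\<not> vanishing (\<lambda>x y. poly (monom 1 n) x)"
      using np[unfolded no_fibre_poly_def, THEN spec[of _ "monom 1 n"]] by (simp add: monom_eq_0_iff)
    then show ?thesis by (simp add: poly_monom)
  qed
  have not_snd: "\<not> vanishing (\<lambda>x y. y ^ n)" for n
  proof -
    have "\<not> vanishing (\<lambda>x y. poly (monom 1 n) y)"
      using np[unfolded no_fibre_poly_def, THEN spec[of _ "monom 1 n"]] by (simp add: monom_eq_0_iff)
    then show ?thesis by (simp add: poly_monom)
  qed
  have rec: "(\<rho> * of_nat i - \<kappa> * of_nat j - w) * a i j = \<epsilon> * of_nat (Suc j) * a i (Suc j)" for i j
  proof -
    have "coeff (coeff (derivation g) j) i = w * a i j" unfolding eig a_def by simp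
    then show ?thesis unfolding coeff_derivation a_def by (simp add: algebra_simps)
  qed
  have deg: "degree g > 0"
  proof (rule ccontr)
    assume "\<not> degree g > 0"
    then obtain p where p: "g = [:p:]" by (metis degree_eq_zeroE gr0I)
    then show False using np g0 van unfolding no_fibre_poly_def vanishing_def by auto
  qed
  have \<epsilon>: "\<epsilon> = 0"
  proof (rule ccontr)
    assume "\<epsilon> \<noteq> 0"
    then have \<kappa>: "\<kappa> = 0" using \<kappa>_or_\<epsilon> by simp
    obtain n where n: "degree g = Suc n" using deg by (metis gr0_implies_Suc)
    have "lead_coeff g \<noteq> 0" using g0 by simp
    then obtain i where i: "a i (Suc n) \<noteq> 0" unfolding a_def n by (metis poly_eqI coeff_0)
    have "a i (Suc (Suc n)) = 0" unfolding a_def by (simp add: coeff_eq_0 n)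
    then have "\<rho> * of_nat i - w = 0" using rec[of i "Suc n"] i \<kappa> by simp
    then have "\<epsilon> * of_nat (Suc n) * a i (Suc n) = 0" using rec[of i n] \<kappa> by simp
    then show False using \<open>\<epsilon> \<noteq> 0\<close> i by (simp del: of_nat_Suc)
  qed
  have supp: "\<rho> * of_nat i - \<kappa> * of_nat j = w" if "a i j \<noteq> 0" for i j
    using rec[of i j] that \<epsilon> by simp
  define S where "S = {(i, j). a i j \<noteq> 0}"
  define m where "m = (\<Sum>j\<le>degree g. degree (coeff g j))"
  have S_sub: "S \<subseteq> {..m} \<times> {..degree g}"
  proof
    fix z assume "z \<in> S"
    then obtain i j where z: "z = (i, j)" "a i j \<noteq> 0" unfolding S_def by auto
    have j: "j \<le> degree g" using z(2) unfolding a_def by (metis coeff_0 coeff_eq_0 not_le)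
    have "degree (coeff g j) \<le> m" unfolding m_def by (rule member_le_sum) (use j in auto)
    moreover have "i \<le> degree (coeff g j)" using z(2) unfolding a_def by (rule le_degree)
    ultimately show "z \<in> {..m} \<times> {..degree g}" using z j by simp
  qed
  have eval: "eval2 g x y = (\<Sum>(i, j)\<in>S. a i j * x ^ i * y ^ j)" for x y
  proof -
    have "poly (coeff g j) x = (\<Sum>i\<le>m. a i j * x ^ i)" if "j \<le> degree g" for j
    proof -
      have "degree (coeff g j) \<le> m" unfolding m_def by (rule member_le_sum) (use that in auto)
      then show ?thesis unfolding poly_altdef a_def
        by (intro sum.mono_neutral_left) (auto simp: coeff_eq_0)
    qed
    then have "eval2 g x y = (\<Sum>j\<le>degree g. \<Sum>i\<le>m. a i j * x ^ i * y ^ j)"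
      unfolding eval2_altdef by (simp add: sum_distrib_right)
    also have "\<dots> = (\<Sum>(i, j)\<in>{..m} \<times> {..degree g}. a i j * x ^ i * y ^ j)"
      by (subst sum.swap) (rule sum.cartesian_product)
    also have "\<dots> = (\<Sum>(i, j)\<in>S. a i j * x ^ i * y ^ j)"
      by (rule sum.mono_neutral_right) (use S_sub in \<open>auto simp: S_def\<close>)
    finally show ?thesis .
  qed
  have finS: "finite S" by (rule finite_subset[OF S_sub]) simp
  have "\<exists>j. coeff g j \<noteq> 0" using g0 by (metis poly_eqI coeff_0)
  then have ex: "\<exists>j. \<exists>i. a i j \<noteq> 0" unfolding a_def by (metis poly_eqI coeff_0)
  define j0 where "j0 = (LEAST j. \<exists>i. a i j \<noteq> 0)"
  obtain i0 where i0: "a i0 j0 \<noteq> 0" using LeastI_ex[OF ex] unfolding j0_def by (elim exE)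
  have j0: "j0 \<le> j" if "a i j \<noteq> 0" for i j unfolding j0_def by (rule Least_le) (use that in auto)
  have line: "\<rho> * (of_nat i - of_nat i0) = \<kappa> * (of_nat j - of_nat j0)" if "a i j \<noteq> 0" for i j
    using supp[OF that] supp[OF i0] by (simp add: algebra_simps)
  \<comment> \<open>the line has no negative slope, so the lowest exponent of \<open>y\<close> goes with the lowest one of \<open>x\<close>\<close>
  have i0_le: "i0 \<le> i" if ij: "a i j \<noteq> 0" for i j
  proof (rule ccontr)
    assume "\<not> i0 \<le> i"
    then have lt: "i < i0" by simp
    have "j \<noteq> j0" using line[OF ij] lt \<rho>_nz by auto
    then have lt': "j0 < j" using j0[OF ij] by simp
    have "of_nat (i0 - i) * \<rho> + of_nat (j - j0) * \<kappa> = 0"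
      using line[OF ij] lt lt' by (simp add: of_nat_diff algebra_simps)
    then show False using ratio[of "i0 - i" "j - j0"] lt lt' by simp
  qed
  have "\<exists>i j. a i j \<noteq> 0 \<and> i \<noteq> i0 \<and> j \<noteq> j0"
  proof (rule ccontr)
    assume no: "\<not> ?thesis"
    have all_i0: "i = i0" if "a i j \<noteq> 0" for i j
    proof (rule ccontr)
      assume "i \<noteq> i0"
      then have "j = j0" using no that by metis
      then show False using line[OF that] \<open>i \<noteq> i0\<close> \<rho>_nz by simp
    qed
    define q where "q = map_poly (\<lambda>p. coeff p i0) g"
    have cq: "coeff q j = a i0 j" for j unfolding q_def a_def by (simp add: coeff_map_poly)
    have "q \<noteq> 0" using i0 cq by (metis coeff_0)
    have S_eq: "S = (\<lambda>j. (i0, j)) ` {j. a i0 j \<noteq> 0}"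
    proof (intro subset_antisym subsetI)
      fix z assume "z \<in> S"
      then obtain i j where z: "z = (i, j)" "a i j \<noteq> 0" unfolding S_def by auto
      with all_i0[OF z(2)] show "z \<in> (\<lambda>j. (i0, j)) ` {j. a i0 j \<noteq> 0}" by simp
    next
      fix z assume "z \<in> (\<lambda>j. (i0, j)) ` {j. a i0 j \<noteq> 0}"
      then show "z \<in> S" unfolding S_def by (elim imageE) simp
    qed
    have "eval2 g x y = x ^ i0 * poly q y" for x y
    proof -
      have "eval2 g x y = (\<Sum>j | a i0 j \<noteq> 0. a i0 j * x ^ i0 * y ^ j)"
        unfolding eval S_eq by (simp add: sum.reindex inj_on_def)
      also have "\<dots> = x ^ i0 * (\<Sum>j | a i0 j \<noteq> 0. coeff q j * y ^ j)"
        by (simp add: cq sum_distrib_left algebra_simps)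
      also have "(\<Sum>j | a i0 j \<noteq> 0. coeff q j * y ^ j) = poly q y"
        unfolding poly_altdef by (rule sum.mono_neutral_left) (auto simp: cq[symmetric] le_degree)
      finally show ?thesis .
    qed
    then have "vanishing (\<lambda>x y. x ^ i0 * poly q y)" using van by (simp add: vanishing_def)
    then have "vanishing (\<lambda>x y. x ^ i0) \<or> vanishing (\<lambda>x y. poly q y)"
      by (intro vanishing_prime poly_fun2_intros)
    then show False using not_fst np \<open>q \<noteq> 0\<close> unfolding no_fibre_poly_def by auto
  qed
  then obtain i1 j1 where ij1: "a i1 j1 \<noteq> 0" "i1 \<noteq> i0" "j1 \<noteq> j0" by (elim exE conjE)
  define p where "p = i1 - i0"
  define s where "s = j1 - j0"
  have p0: "p > 0" and s0: "s > 0"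
    using i0_le[OF ij1(1)] j0[OF ij1(1)] ij1(2,3) unfolding p_def s_def by auto
  have ps: "\<rho> * of_nat p = \<kappa> * of_nat s"
    using line[OF ij1(1)] i0_le[OF ij1(1)] j0[OF ij1(1)] unfolding p_def s_def by (simp add: of_nat_diff)
  define d where "d = gcd p s"
  obtain A B where AB: "p = A * d" "s = B * d" "coprime A B"
    unfolding d_def using gcd_coprime_exists[of p s] p0 by auto
  have A0: "A > 0" and B0: "B > 0" and d0: "d > 0" using AB p0 s0 by (auto intro: Nat.gr0I)
  have slope: "\<rho> * of_nat A = \<kappa> * of_nat B" using ps d0 unfolding AB by simp
  have on_ray: "\<exists>k. i = i0 + A * k \<and> j = j0 + B * k" if ij: "a i j \<noteq> 0" for i j
  proof -
    obtain u where u: "i = i0 + u" using i0_le[OF ij] by (metis le_iff_add)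
    obtain v where v: "j = j0 + v" using j0[OF ij] by (metis le_iff_add)
    have "\<rho> * of_nat u = \<kappa> * of_nat v" using line[OF ij] unfolding u v by simp
    then have "\<rho> * of_nat u * of_nat B = (\<rho> * of_nat A) * of_nat v" unfolding slope by (simp add: algebra_simps)
    then have "of_nat (u * B) = (of_nat (A * v) :: complex)" using \<rho>_nz by simp
    then have uv: "u * B = A * v" by (simp only: of_nat_eq_iff)
    then have "A dvd u * B" by simp
    then obtain k where k: "u = A * k" using AB(3) by (auto simp: coprime_dvd_mult_left_iff)
    then have "v = B * k" using uv A0 by (simp add: mult.commute)
    then show ?thesis using u v k by blast
  qed
  define T where "T = {k. a (i0 + A * k) (j0 + B * k) \<noteq> 0}"
  define P where "P = (\<Sum>k\<in>T. monom (a (i0 + A * k) (j0 + B * k)) k)"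
  have S_eq: "S = (\<lambda>k. (i0 + A * k, j0 + B * k)) ` T"
  proof (intro subset_antisym subsetI)
    fix z assume "z \<in> S"
    then obtain i j where z: "z = (i, j)" "a i j \<noteq> 0" unfolding S_def by auto
    then obtain k where "i = i0 + A * k" "j = j0 + B * k" using on_ray by metis
    with z show "z \<in> (\<lambda>k. (i0 + A * k, j0 + B * k)) ` T"
      unfolding T_def by (intro image_eqI[of _ _ k]) simp_all
  next
    fix z assume "z \<in> (\<lambda>k. (i0 + A * k, j0 + B * k)) ` T"
    then show "z \<in> S" unfolding S_def T_def by (elim imageE) simp
  qed
  have inj: "inj_on (\<lambda>k. (i0 + A * k, j0 + B * k)) T" using A0 by (auto simp: inj_on_def)
  then have finT: "finite T" using finS unfolding S_eq by (rule finite_imageD[rotated])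
  have "coeff P 0 = a i0 j0"
    unfolding P_def coeff_sum using finT i0 by (simp add: T_def sum.delta')
  then have P0: "P \<noteq> 0" using i0 by auto
  have "eval2 g x y = (x ^ i0 * y ^ j0) * poly P (x ^ A * y ^ B)" for x y
    unfolding eval S_eq P_def sum.reindex[OF inj]
    by (simp add: o_def poly_sum poly_monom sum_distrib_left power_add power_mult power_mult_distrib)
       (simp add: mult_ac)
  then have "vanishing (\<lambda>x y. (x ^ i0 * y ^ j0) * poly P (x ^ A * y ^ B))"
    using van by (simp add: vanishing_def)
  then have "vanishing (\<lambda>x y. x ^ i0 * y ^ j0) \<or> vanishing (\<lambda>x y. poly P (x ^ A * y ^ B))"
    by (intro vanishing_prime poly_fun2_intros)
  moreover have not_mon: "\<not> vanishing (\<lambda>x y. x ^ n * y ^ k)" for n k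
    using vanishing_prime[OF poly_fun2_power[OF poly_fun2_fst] poly_fun2_power[OF poly_fun2_snd], of n k]
      not_fst[of n] not_snd[of k] by metis
  ultimately have van_P: "vanishing (\<lambda>x y. poly P (x ^ A * y ^ B))" by metis
  have pf: "poly_fun2 (\<lambda>x y. x ^ A * y ^ B)" by (intro poly_fun2_intros)
  obtain c where c: "vanishing (\<lambda>x y. x ^ A * y ^ B - c)"
    by (rule vanishing_root[OF on pf P0 van_P])
  moreover have "c \<noteq> 0" using c not_mon[of A B] by auto
  ultimately show thesis using that A0 B0 AB(3) by metis
qed

theorem curve_classification:
  "fibre \<or> (\<exists>A B c. A > 0 \<and> B > 0 \<and> c \<noteq> 0 \<and>
    C = {point (seg x x' y y') | x x' y y'. (x, x') \<noteq> (0, 0) \<and> (y, y') \<noteq> (0, 0) \<and>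
      x ^ A * y ^ B = c * (x' ^ A * y' ^ B)})"
proof (cases "\<exists>x y. on_curve x y")
  case False
  then show ?thesis using fibre_at_infinity by simp
next
  case True
  then obtain x0 y0 where on: "on_curve x0 y0" by (elim exE)
  show ?thesis
  proof (cases no_fibre_poly)
    case True
    obtain A B c where "A > 0" "B > 0" "coprime A B" "c \<noteq> 0" "vanishing (\<lambda>x y. x ^ A * y ^ B - c)"
      by (rule monomial_equation[OF True on])
    then show ?thesis using curve_eq_monomial[OF on] by (intro disjI2 exI conjI)
  next
    case False
    then obtain p where "p \<noteq> 0" "vanishing (\<lambda>x y. poly p x) \<or> vanishing (\<lambda>x y. poly p y)"
      unfolding no_fibre_poly_def by auto
    then show ?thesis using fibre_of_fst[OF on] fibre_of_snd[OF on] by auto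
  qed
qed

end

section \<open>Charts of the quadric given by two pairs of points\<close>

definition segre :: "complex \<Rightarrow> complex \<Rightarrow> complex \<Rightarrow> complex \<Rightarrow> complex ^ 4" where
  "segre \<mu> \<mu>' \<nu> \<nu>' = vector [\<mu> * \<nu>', \<mu>' * \<nu>, \<mu> * \<nu>, \<mu>' * \<nu>']"

text \<open>
  The linear form on \<open>complex ^ 4\<close> that restricts to the product of \<open>u \<mu> + u' \<mu>'\<close> and
  \<open>w \<nu> + w' \<nu>'\<close> on the quadric.
\<close>

definition bilinear :: "complex \<Rightarrow> complex \<Rightarrow> complex \<Rightarrow> complex \<Rightarrow> complex ^ 4 \<Rightarrow> complex" where
  "bilinear u u' w w' v = (u * w) * v $ 3 + (u * w') * v $ 1 + (u' * w) * v $ 2 + (u' * w') * v $ 4"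

lemma quadric_param_segre: "quadric_param \<mu> \<mu>' \<nu> \<nu>' = point (segre \<mu> \<mu>' \<nu> \<nu>')"
  unfolding quadric_param_def segre_def by simp

lemma hom_bilinear: "homogeneous_poly 1 (bilinear u u' w w')"
  unfolding bilinear_def[abs_def] by (intro hom_add hom_scale hom_coord)

lemma segre_nth [simp]: "segre \<mu> \<mu>' \<nu> \<nu>' $ 1 = \<mu> * \<nu>'" "segre \<mu> \<mu>' \<nu> \<nu>' $ 2 = \<mu>' * \<nu>"
  "segre \<mu> \<mu>' \<nu> \<nu>' $ 3 = \<mu> * \<nu>" "segre \<mu> \<mu>' \<nu> \<nu>' $ 4 = \<mu>' * \<nu>'"
  unfolding segre_def by simp_all

lemma bilinear_segre: "bilinear u u' w w' (segre \<mu> \<mu>' \<nu> \<nu>') = (u * \<mu> + u' * \<mu>') * (w * \<nu> + w' * \<nu>')"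
  by (simp add: bilinear_def algebra_simps)

lemma bilinear_linear:
  "bilinear u u' w w' (a *s v1 + b *s v2 + c *s v3 + d *s v4) =
    a * bilinear u u' w w' v1 + b * bilinear u u' w w' v2 + c * bilinear u u' w w' v3 + d * bilinear u u' w w' v4"
  by (simp add: bilinear_def algebra_simps)

text \<open>
  Bases \<open>(\<alpha>, \<alpha>'), (\<beta>, \<beta>')\<close> and \<open>(\<gamma>, \<gamma>'), (\<delta>, \<delta>')\<close> of the planes of \<open>(\<mu>, \<mu>')\<close> and
  \<open>(\<nu>, \<nu>')\<close>.  Determinant 1 makes the inverse changes of coordinates polynomial.  The first vector of
  each basis is the point \<open>\<infinity>\<close> of the new coordinate, the second one the point \<open>0\<close>.
\<close>

locale segre_chart =
  fixes \<alpha> \<alpha>' \<beta> \<beta>' \<gamma> \<gamma>' \<delta> \<delta>' :: complex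
  assumes det_fst: "\<alpha> * \<beta>' - \<alpha>' * \<beta> = 1" and det_snd: "\<gamma> * \<delta>' - \<gamma>' * \<delta> = 1"
begin

lemma coordinate_fst: "\<beta>' * (x * \<alpha> + x' * \<beta>) - \<beta> * (x * \<alpha>' + x' * \<beta>') = x"
    "\<alpha> * (x * \<alpha>' + x' * \<beta>') - \<alpha>' * (x * \<alpha> + x' * \<beta>) = x'"
    "(\<beta>' * \<mu> - \<beta> * \<mu>') * \<alpha> + (\<alpha> * \<mu>' - \<alpha>' * \<mu>) * \<beta> = \<mu>"
    "(\<beta>' * \<mu> - \<beta> * \<mu>') * \<alpha>' + (\<alpha> * \<mu>' - \<alpha>' * \<mu>) * \<beta>' = \<mu>'"
  using det_fst by algebra+

lemma coordinate_snd: "\<delta>' * (y * \<gamma> + y' * \<delta>) - \<delta> * (y * \<gamma>' + y' * \<delta>') = y"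
    "\<gamma> * (y * \<gamma>' + y' * \<delta>') - \<gamma>' * (y * \<gamma> + y' * \<delta>) = y'"
    "(\<delta>' * \<nu> - \<delta> * \<nu>') * \<gamma> + (\<gamma> * \<nu>' - \<gamma>' * \<nu>) * \<delta> = \<nu>"
    "(\<delta>' * \<nu> - \<delta> * \<nu>') * \<gamma>' + (\<gamma> * \<nu>' - \<gamma>' * \<nu>) * \<delta>' = \<nu>'"
  using det_snd by algebra+

sublocale quadric_chart "segre \<alpha> \<alpha>' \<gamma> \<gamma>'" "segre \<alpha> \<alpha>' \<delta> \<delta>'" "segre \<beta> \<beta>' \<gamma> \<gamma>'" "segre \<beta> \<beta>' \<delta> \<delta>'"
  "bilinear \<beta>' (- \<beta>) \<delta>' (- \<delta>)" "bilinear \<beta>' (- \<beta>) (- \<gamma>') \<gamma>"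
  "bilinear (- \<alpha>') \<alpha> \<delta>' (- \<delta>)" "bilinear (- \<alpha>') \<alpha> (- \<gamma>') \<gamma>"
proof
  have "\<beta>' * \<alpha> + - \<beta> * \<alpha>' = 1" "- \<alpha>' * \<beta> + \<alpha> * \<beta>' = 1" "\<delta>' * \<gamma> + - \<delta> * \<gamma>' = 1" "- \<gamma>' * \<delta> + \<gamma> * \<delta>' = 1"
    "\<beta>' * \<beta> + - \<beta> * \<beta>' = 0" "- \<alpha>' * \<alpha> + \<alpha> * \<alpha>' = 0" "\<delta>' * \<delta> + - \<delta> * \<delta>' = 0" "- \<gamma>' * \<gamma> + \<gamma> * \<gamma>' = 0"
    using det_fst det_snd by (simp_all add: algebra_simps)
  note dual = this
  fix a b c d :: complex
  let ?v = "a *s segre \<alpha> \<alpha>' \<gamma> \<gamma>' + b *s segre \<alpha> \<alpha>' \<delta> \<delta>' + c *s segre \<beta> \<beta>' \<gamma> \<gamma>' + d *s segre \<beta> \<beta>' \<delta> \<delta>'"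
  show "bilinear \<beta>' (- \<beta>) \<delta>' (- \<delta>) ?v = a" "bilinear \<beta>' (- \<beta>) (- \<gamma>') \<gamma> ?v = b"
    "bilinear (- \<alpha>') \<alpha> \<delta>' (- \<delta>) ?v = c" "bilinear (- \<alpha>') \<alpha> (- \<gamma>') \<gamma> ?v = d"
    unfolding bilinear_linear bilinear_segre dual by simp_all
next
  fix v :: "complex ^ 4"
  let ?l1 = "bilinear \<beta>' (- \<beta>) \<delta>' (- \<delta>) v" and ?l2 = "bilinear \<beta>' (- \<beta>) (- \<gamma>') \<gamma> v"
    and ?l3 = "bilinear (- \<alpha>') \<alpha> \<delta>' (- \<delta>) v" and ?l4 = "bilinear (- \<alpha>') \<alpha> (- \<gamma>') \<gamma> v"
  have "?l1 * (\<alpha> * \<gamma>') + ?l2 * (\<alpha> * \<delta>') + ?l3 * (\<beta> * \<gamma>') + ?l4 * (\<beta> * \<delta>') = v $ 1"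
    "?l1 * (\<alpha>' * \<gamma>) + ?l2 * (\<alpha>' * \<delta>) + ?l3 * (\<beta>' * \<gamma>) + ?l4 * (\<beta>' * \<delta>) = v $ 2"
    "?l1 * (\<alpha> * \<gamma>) + ?l2 * (\<alpha> * \<delta>) + ?l3 * (\<beta> * \<gamma>) + ?l4 * (\<beta> * \<delta>) = v $ 3"
    "?l1 * (\<alpha>' * \<gamma>') + ?l2 * (\<alpha>' * \<delta>') + ?l3 * (\<beta>' * \<gamma>') + ?l4 * (\<beta>' * \<delta>') = v $ 4"
    unfolding bilinear_def using det_fst det_snd by algebra+
  then show "?l1 *s segre \<alpha> \<alpha>' \<gamma> \<gamma>' + ?l2 *s segre \<alpha> \<alpha>' \<delta> \<delta>' + ?l3 *s segre \<beta> \<beta>' \<gamma> \<gamma>' + ?l4 *s segre \<beta> \<beta>' \<delta> \<delta>' = v"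
    by (simp add: vec_eq_iff forall_4)
  have "?l1 * ?l4 - ?l2 * ?l3 = v $ 3 * v $ 4 - v $ 1 * v $ 2"
    unfolding bilinear_def using det_fst det_snd by algebra
  then show "v $ 1 * v $ 2 - v $ 3 * v $ 4 = 0 \<longleftrightarrow> ?l1 * ?l4 = ?l2 * ?l3"
    by (metis right_minus_eq minus_diff_eq neg_equal_0_iff_equal)
qed (rule hom_bilinear)+

lemma seg_segre: "seg x x' y y' = segre (x * \<alpha> + x' * \<beta>) (x * \<alpha>' + x' * \<beta>') (y * \<gamma> + y' * \<delta>) (y * \<gamma>' + y' * \<delta>')"
  unfolding seg_def by (simp add: vec_eq_iff forall_4 algebra_simps)

lemma change_coordinates:
  "{point (seg x x' y y') | x x' y y'. (x, x') \<noteq> (0, 0) \<and> (y, y') \<noteq> (0, 0) \<and> R x x' y y'} =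
   {quadric_param \<mu> \<mu>' \<nu> \<nu>' | \<mu> \<mu>' \<nu> \<nu>'. (\<mu>, \<mu>') \<noteq> (0, 0) \<and> (\<nu>, \<nu>') \<noteq> (0, 0) \<and>
      R (\<beta>' * \<mu> - \<beta> * \<mu>') (\<alpha> * \<mu>' - \<alpha>' * \<mu>) (\<delta>' * \<nu> - \<delta> * \<nu>') (\<gamma> * \<nu>' - \<gamma>' * \<nu>)}" (is "?L = ?M")
proof (intro subset_antisym subsetI)
  fix L assume "L \<in> ?L"
  then obtain x x' y y' where xy: "L = point (seg x x' y y')" "(x, x') \<noteq> (0, 0)" "(y, y') \<noteq> (0, 0)" "R x x' y y'"
    unfolding mem_Collect_eq by (elim exE conjE)
  define \<mu> \<mu>' \<nu> \<nu>' where m: "\<mu> = x * \<alpha> + x' * \<beta>" "\<mu>' = x * \<alpha>' + x' * \<beta>'" "\<nu> = y * \<gamma> + y' * \<delta>" "\<nu>' = y * \<gamma>' + y' * \<delta>'"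
  have c: "\<beta>' * \<mu> - \<beta> * \<mu>' = x" "\<alpha> * \<mu>' - \<alpha>' * \<mu> = x'" "\<delta>' * \<nu> - \<delta> * \<nu>' = y" "\<gamma> * \<nu>' - \<gamma>' * \<nu> = y'"
    unfolding m by (rule coordinate_fst coordinate_snd)+
  have "(\<mu>, \<mu>') \<noteq> (0, 0)" "(\<nu>, \<nu>') \<noteq> (0, 0)" using xy(2,3) c by auto
  moreover have "L = quadric_param \<mu> \<mu>' \<nu> \<nu>'" unfolding xy(1) quadric_param_segre seg_segre m ..
  ultimately show "L \<in> ?M" using xy(4) c by (intro CollectI exI[of _ \<mu>] exI[of _ \<mu>'] exI[of _ \<nu>] exI[of _ \<nu>'] conjI) simp_all
next
  fix L assume "L \<in> ?M"
  then obtain \<mu> \<mu>' \<nu> \<nu>' where m: "L = quadric_param \<mu> \<mu>' \<nu> \<nu>'" "(\<mu>, \<mu>') \<noteq> (0, 0)" "(\<nu>, \<nu>') \<noteq> (0, 0)"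
      "R (\<beta>' * \<mu> - \<beta> * \<mu>') (\<alpha> * \<mu>' - \<alpha>' * \<mu>) (\<delta>' * \<nu> - \<delta> * \<nu>') (\<gamma> * \<nu>' - \<gamma>' * \<nu>)"
    unfolding mem_Collect_eq by (elim exE conjE)
  define x x' y y' where xy: "x = \<beta>' * \<mu> - \<beta> * \<mu>'" "x' = \<alpha> * \<mu>' - \<alpha>' * \<mu>" "y = \<delta>' * \<nu> - \<delta> * \<nu>'" "y' = \<gamma> * \<nu>' - \<gamma>' * \<nu>"
  have c: "x * \<alpha> + x' * \<beta> = \<mu>" "x * \<alpha>' + x' * \<beta>' = \<mu>'" "y * \<gamma> + y' * \<delta> = \<nu>" "y * \<gamma>' + y' * \<delta>' = \<nu>'"
    unfolding xy by (rule coordinate_fst coordinate_snd)+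
  have "(x, x') \<noteq> (0, 0)" "(y, y') \<noteq> (0, 0)" using m(2,3) c by auto
  moreover have "L = point (seg x x' y y')" unfolding m(1) quadric_param_segre seg_segre c ..
  ultimately show "L \<in> ?L" using m(4)[folded xy]
    by (intro CollectI exI[of _ x] exI[of _ x'] exI[of _ y] exI[of _ y'] conjI)
qed

end

text \<open>
  Exchanging the two factors of the quadric exchanges the roles of \<open>P\<close> and \<open>Q\<close>.
\<close>

lemma quadric_chart_swap:
  assumes "quadric_chart e1 e2 e3 e4 l1 l2 l3 l4"
  shows "quadric_chart e1 e3 e2 e4 l1 l3 l2 l4"
proof -
  interpret quadric_chart e1 e2 e3 e4 l1 l2 l3 l4 by fact
  show ?thesis
  proof
    fix a b c d
    have eq: "a *s e1 + b *s e3 + c *s e2 + d *s e4 = a *s e1 + c *s e2 + b *s e3 + d *s e4"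
      by (simp add: algebra_simps)
    show "l1 (a *s e1 + b *s e3 + c *s e2 + d *s e4) = a" "l3 (a *s e1 + b *s e3 + c *s e2 + d *s e4) = b"
      "l2 (a *s e1 + b *s e3 + c *s e2 + d *s e4) = c" "l4 (a *s e1 + b *s e3 + c *s e2 + d *s e4) = d"
      unfolding eq by (rule l_basis)+
  next
    fix v
    show "l1 v *s e1 + l3 v *s e3 + l2 v *s e2 + l4 v *s e4 = v"
      using basis_l[of v] by (simp add: algebra_simps)
    show "v $ 1 * v $ 2 - v $ 3 * v $ 4 = 0 \<longleftrightarrow> l1 v * l4 v = l3 v * l2 v"
      using quadric_eq[of v] by (simp only: mult.commute)
  qed (rule hom_l)+
qed

section \<open>Binary quadratic forms\<close>

definition qform :: "complex \<Rightarrow> complex \<Rightarrow> complex \<Rightarrow> complex \<Rightarrow> complex \<Rightarrow> complex" where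
  "qform A B D u u' = A * u\<^sup>2 + B * u * u' + D * u'\<^sup>2"

definition polar :: "complex \<Rightarrow> complex \<Rightarrow> complex \<Rightarrow> complex \<Rightarrow> complex \<Rightarrow> complex \<Rightarrow> complex \<Rightarrow> complex" where
  "polar A B D u u' w w' = 2 * A * u * w + B * (u * w' + u' * w) + 2 * D * u' * w'"

text \<open>
  The restriction of the form to an affine line, with the polar form as linear coefficient: \<open>u\<close> is the
  point at infinity of the line and \<open>w\<close> its origin.
\<close>

lemma qform_line: "qform A B D (x * u + w) (x * u' + w') =
    qform A B D u u' * x\<^sup>2 + polar A B D u u' w w' * x + qform A B D w w'"
  unfolding qform_def polar_def by (simp add: power2_eq_square algebra_simps)

text \<open>
  In a basis of determinant 1 whose first vector is a root, the square of the polar form is the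
  discriminant.
\<close>

lemma polar_square: "(polar A B D u u' w w')\<^sup>2 =
    (B\<^sup>2 - 4 * A * D) * (u * w' - u' * w)\<^sup>2 + 4 * qform A B D u u' * qform A B D w w'"
  unfolding qform_def polar_def by (simp add: power2_eq_square algebra_simps)

text \<open>
  The roots are \<open>(- B \<plusminus> s, 2 A)\<close> with \<open>s\<close> a square root of the discriminant, or \<open>(1, 0)\<close> and
  \<open>(- D, B)\<close> if \<open>A = 0\<close>; the first one is rescaled to obtain determinant 1.
\<close>

lemma qform_basis_distinct_roots:
  assumes "B\<^sup>2 - 4 * A * D \<noteq> 0"
  obtains u u' w w' where "u * w' - u' * w = 1" "qform A B D u u' = 0" "qform A B D w w' = 0"
    "polar A B D u u' w w' \<noteq> 0"
proof -
  have "\<exists>u u' w w'. u * w' - u' * w = 1 \<and> qform A B D u u' = 0 \<and> qform A B D w w' = 0"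
  proof (cases "A = 0")
    case True
    then have "B \<noteq> 0" using assms by simp
    then show ?thesis using True
      by (intro exI[of _ "1 / B"] exI[of _ 0] exI[of _ "- D"] exI[of _ B])
         (simp add: qform_def power2_eq_square algebra_simps)
  next
    case False
    define s where "s = csqrt (B\<^sup>2 - 4 * A * D)"
    have s2: "s * s = B * B - 4 * A * D" unfolding s_def using power2_csqrt[of "B\<^sup>2 - 4 * A * D"] by (simp add: power2_eq_square)
    have s0: "s \<noteq> 0" using assms unfolding s_def by simp
    define k where "k = 1 / (4 * A * s)"
    have k: "k * (4 * A * s) = 1" unfolding k_def using False s0 by simp
    have "k * (- B + s) * (2 * A) - k * (2 * A) * (- B - s) = 1" using k by algebra
    moreover have "qform A B D (k * (- B + s)) (k * (2 * A)) = 0"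
      unfolding qform_def power2_eq_square using s2 by algebra
    moreover have "qform A B D (- B - s) (2 * A) = 0"
      unfolding qform_def power2_eq_square using s2 by algebra
    ultimately show ?thesis by (intro exI conjI)
  qed
  then obtain u u' w w' where uw: "u * w' - u' * w = 1" "qform A B D u u' = 0" "qform A B D w w' = 0"
    by (elim exE conjE)
  moreover have "polar A B D u u' w w' \<noteq> 0"
    using polar_square[of A B D u u' w w'] assms unfolding uw by auto
  ultimately show thesis by (rule that)
qed

lemma qform_basis_double_root:
  assumes "B\<^sup>2 - 4 * A * D = 0"
  obtains u u' w w' where "u * w' - u' * w = 1" "qform A B D u u' = 0" "polar A B D u u' w w' = 0"
proof -
  have "\<exists>u u' w w'. u * w' - u' * w = 1 \<and> qform A B D u u' = 0"
  proof (cases "A = 0")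
    case True
    then show ?thesis
      by (intro exI[of _ 1] exI[of _ 0] exI[of _ 0] exI[of _ 1]) (simp add: qform_def)
  next
    case False
    have "qform A B D (- B) (2 * A) = 0"
      unfolding qform_def power2_eq_square using assms[unfolded power2_eq_square] by algebra
    then show ?thesis using False
      by (intro exI[of _ "- B"] exI[of _ "2 * A"] exI[of _ "- 1 / (2 * A)"] exI[of _ 0]) simp
  qed
  then obtain u u' w w' where uw: "u * w' - u' * w = 1" "qform A B D u u' = 0" by (elim exE conjE)
  moreover have "polar A B D u u' w w' = 0"
    using polar_square[of A B D u u' w w'] unfolding uw assms by simp
  ultimately show thesis by (rule that)
qed

text \<open>
  For the form with distinct roots both basis vectors are roots, and exchanging them changes the sign of
  its polar value.  One of the two orders satisfies the last condition: a positive linear relation for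
  both signs would make the polar value zero.
\<close>

lemma adapted_bases:
  assumes "B\<^sup>2 - 4 * A * D \<noteq> 0"
  obtains \<alpha> \<alpha>' \<beta> \<beta>' \<gamma> \<gamma>' \<delta> \<delta>' where
    "\<alpha> * \<beta>' - \<alpha>' * \<beta> = 1" "\<gamma> * \<delta>' - \<gamma>' * \<delta> = 1"
    "qform A B D \<alpha> \<alpha>' = 0" "qform A B D \<beta> \<beta>' = 0" "polar A B D \<alpha> \<alpha>' \<beta> \<beta>' \<noteq> 0"
    "qform A' B' D' \<gamma> \<gamma>' = 0" "polar A' B' D' \<gamma> \<gamma>' \<delta> \<delta>' = 0 \<or> qform A' B' D' \<delta> \<delta>' = 0"
    "\<forall>m n :: nat. m > 0 \<longrightarrow> n > 0 \<longrightarrow>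
      of_nat m * polar A B D \<alpha> \<alpha>' \<beta> \<beta>' + of_nat n * polar A' B' D' \<gamma> \<gamma>' \<delta> \<delta>' \<noteq> 0"
proof -
  obtain \<gamma> \<gamma>' \<delta> \<delta>' where c: "\<gamma> * \<delta>' - \<gamma>' * \<delta> = 1" "qform A' B' D' \<gamma> \<gamma>' = 0"
    "polar A' B' D' \<gamma> \<gamma>' \<delta> \<delta>' = 0 \<or> qform A' B' D' \<delta> \<delta>' = 0"
  proof (cases "B'\<^sup>2 - 4 * A' * D' = 0")
    case True
    obtain u u' w w' where "u * w' - u' * w = 1" "qform A' B' D' u u' = 0" "polar A' B' D' u u' w w' = 0"
      using qform_basis_double_root[OF True] .
    then show ?thesis using that by simp
  next
    case False
    obtain u u' w w' where "u * w' - u' * w = 1" "qform A' B' D' u u' = 0" "qform A' B' D' w w' = 0"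
      using qform_basis_distinct_roots[OF False] .
    then show ?thesis using that by simp
  qed
  obtain u u' w w' where uw: "u * w' - u' * w = 1" "qform A B D u u' = 0" "qform A B D w w' = 0"
    "polar A B D u u' w w' \<noteq> 0"
    using qform_basis_distinct_roots[OF assms] .
  define \<rho> where "\<rho> = polar A B D u u' w w'"
  define \<kappa> where "\<kappa> = polar A' B' D' \<gamma> \<gamma>' \<delta> \<delta>'"
  show thesis
  proof (cases "\<exists>m n :: nat. m > 0 \<and> n > 0 \<and> of_nat m * \<rho> + of_nat n * \<kappa> = 0")
    case False
    then have "\<forall>m n :: nat. m > 0 \<longrightarrow> n > 0 \<longrightarrow> of_nat m * \<rho> + of_nat n * \<kappa> \<noteq> 0"
      by blast
    then show ?thesis unfolding \<rho>_def \<kappa>_def by (rule that[OF uw(1) c(1) uw(2-4) c(2,3)])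
  next
    case True
    then obtain m n :: nat where mn: "m > 0" "n > 0" "of_nat m * \<rho> + of_nat n * \<kappa> = 0" by auto
    have 1: "w * (- u') - w' * (- u) = 1" using uw(1) by (simp add: algebra_simps)
    have 2: "qform A B D (- u) (- u') = 0" using uw(2) by (simp add: qform_def)
    have 3: "polar A B D w w' (- u) (- u') = - \<rho>" unfolding polar_def \<rho>_def by (simp add: algebra_simps)
    have 4: "of_nat i * (- \<rho>) + of_nat j * \<kappa> \<noteq> 0" if "i > 0" "j > 0" for i j :: nat
    proof
      assume "of_nat i * (- \<rho>) + of_nat j * \<kappa> = 0"
      then have "of_nat (m * j + n * i) * \<rho> = 0" using mn(3) unfolding of_nat_add of_nat_mult by algebra
      then have "\<rho> = 0" using mn(1) that(2) by (simp del: of_nat_add of_nat_mult)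
      then show False using uw(4) unfolding \<rho>_def by simp
    qed
    show ?thesis
      by (rule that[OF 1 c(1) uw(3) 2 _ c(2,3)]) (use 4 uw(4) in \<open>auto simp: 3 \<rho>_def[symmetric] \<kappa>_def[symmetric]\<close>)
  qed
qed

section \<open>The contact form on the quadric\<close>

lemma contact_form_linear:
  "contact_form a b c p q r v (s *s u + t *s w) = s * contact_form a b c p q r v u + t * contact_form a b c p q r v w"
  unfolding contact_form_def Let_def by (simp add: algebra_simps)

lemma contact_form_fst:
  "contact_form a b c p q r (segre m m' n n') (segre k k' n n') = (k * m' - k' * m) * qform (- r) (p + c) a n n'"
  unfolding contact_form_def Let_def qform_def by (simp add: power2_eq_square algebra_simps)

lemma contact_form_snd:
  "contact_form a b c p q r (segre m m' n n') (segre m m' k k') = (k * n' - k' * n) * qform q (c - p) b m m'"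
  unfolding contact_form_def Let_def qform_def by (simp add: power2_eq_square algebra_simps)

definition fibre_curve :: "(complex ^ 4) set set \<Rightarrow> bool" where
  "fibre_curve C \<longleftrightarrow>
    (\<exists>X X'. (X, X') \<noteq> (0, 0) \<and> C = {quadric_param X X' \<nu> \<nu>' | \<nu> \<nu>'. (\<nu>, \<nu>') \<noteq> (0, 0)}) \<or>
    (\<exists>Y Y'. (Y, Y') \<noteq> (0, 0) \<and> C = {quadric_param \<mu> \<mu>' Y Y' | \<mu> \<mu>'. (\<mu>, \<mu>') \<noteq> (0, 0)})"

definition monomial_curve :: "(complex ^ 4) set set \<Rightarrow> bool" where
  "monomial_curve C \<longleftrightarrow> (\<exists>\<alpha> \<alpha>' \<beta> \<beta>' \<gamma> \<gamma>' \<delta> \<delta>' A B c.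
     \<alpha> * \<beta>' - \<alpha>' * \<beta> = 1 \<and> \<gamma> * \<delta>' - \<gamma>' * \<delta> = 1 \<and> A > 0 \<and> B > 0 \<and> c \<noteq> 0 \<and>
     C = {quadric_param \<mu> \<mu>' \<nu> \<nu>' | \<mu> \<mu>' \<nu> \<nu>'. (\<mu>, \<mu>') \<noteq> (0, 0) \<and> (\<nu>, \<nu>') \<noteq> (0, 0) \<and>
       (\<beta>' * \<mu> - \<beta> * \<mu>') ^ A * (\<delta>' * \<nu> - \<delta> * \<nu>') ^ B =
       c * ((\<alpha> * \<mu>' - \<alpha>' * \<mu>) ^ A * (\<gamma> * \<nu>' - \<gamma>' * \<nu>) ^ B)})"

lemma fibre_curve_sndI:
  assumes "(Y, Y') \<noteq> (0, 0)" "C = {quadric_param \<mu> \<mu>' Y Y' | \<mu> \<mu>'. (\<mu>, \<mu>') \<noteq> (0, 0)}"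
  shows "fibre_curve C"
  unfolding fibre_curve_def using assms by (intro disjI2 exI conjI)

lemma fibre_curve_fstI:
  assumes "(X, X') \<noteq> (0, 0)" "C = {quadric_param X X' \<nu> \<nu>' | \<nu> \<nu>'. (\<nu>, \<nu>') \<noteq> (0, 0)}"
  shows "fibre_curve C"
  unfolding fibre_curve_def using assms by (intro disjI1 exI conjI)

lemma monomial_curveI:
  assumes "\<alpha> * \<beta>' - \<alpha>' * \<beta> = 1" "\<gamma> * \<delta>' - \<gamma>' * \<delta> = 1" "A > 0" "B > 0" "c \<noteq> 0"
     "C = {quadric_param \<mu> \<mu>' \<nu> \<nu>' | \<mu> \<mu>' \<nu> \<nu>'. (\<mu>, \<mu>') \<noteq> (0, 0) \<and> (\<nu>, \<nu>') \<noteq> (0, 0) \<and>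
       (\<beta>' * \<mu> - \<beta> * \<mu>') ^ A * (\<delta>' * \<nu> - \<delta> * \<nu>') ^ B =
       c * ((\<alpha> * \<mu>' - \<alpha>' * \<mu>) ^ A * (\<gamma> * \<nu>' - \<gamma>' * \<nu>) ^ B)}"
  shows "monomial_curve C"
  unfolding monomial_curve_def using assms by (intro exI conjI)

context segre_chart
begin

lemma fibre_fst_eq:
  "{point (seg X X' y y') | y y'. (y, y') \<noteq> (0, 0)} =
    {quadric_param (X * \<alpha> + X' * \<beta>) (X * \<alpha>' + X' * \<beta>') \<nu> \<nu>' | \<nu> \<nu>'. (\<nu>, \<nu>') \<noteq> (0, 0)}" (is "?L = ?M")
proof (intro subset_antisym subsetI)
  fix L assume "L \<in> ?L"
  then obtain y y' where y: "L = point (seg X X' y y')" "(y, y') \<noteq> (0, 0)"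
    unfolding mem_Collect_eq by (elim exE conjE)
  have "(y * \<gamma> + y' * \<delta>, y * \<gamma>' + y' * \<delta>') \<noteq> (0, 0)"
    using y(2) coordinate_snd(1,2)[of y y'] by auto
  moreover have "L = quadric_param (X * \<alpha> + X' * \<beta>) (X * \<alpha>' + X' * \<beta>') (y * \<gamma> + y' * \<delta>) (y * \<gamma>' + y' * \<delta>')"
    unfolding y(1) seg_segre quadric_param_segre ..
  ultimately show "L \<in> ?M" by (intro CollectI exI conjI)
next
  fix L assume "L \<in> ?M"
  then obtain \<nu> \<nu>' where n: "L = quadric_param (X * \<alpha> + X' * \<beta>) (X * \<alpha>' + X' * \<beta>') \<nu> \<nu>'" "(\<nu>, \<nu>') \<noteq> (0, 0)"
    unfolding mem_Collect_eq by (elim exE conjE)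
  have "(\<delta>' * \<nu> - \<delta> * \<nu>', \<gamma> * \<nu>' - \<gamma>' * \<nu>) \<noteq> (0, 0)"
    using n(2) coordinate_snd(3,4)[of \<nu> \<nu>'] by auto
  moreover have "L = point (seg X X' (\<delta>' * \<nu> - \<delta> * \<nu>') (\<gamma> * \<nu>' - \<gamma>' * \<nu>))"
    unfolding n(1) seg_segre quadric_param_segre coordinate_snd ..
  ultimately show "L \<in> ?L" by (intro CollectI exI conjI)
qed

lemma fibre_snd_eq:
  "{point (seg x x' Y Y') | x x'. (x, x') \<noteq> (0, 0)} =
    {quadric_param \<mu> \<mu>' (Y * \<gamma> + Y' * \<delta>) (Y * \<gamma>' + Y' * \<delta>') | \<mu> \<mu>'. (\<mu>, \<mu>') \<noteq> (0, 0)}" (is "?L = ?M")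
proof (intro subset_antisym subsetI)
  fix L assume "L \<in> ?L"
  then obtain x x' where x: "L = point (seg x x' Y Y')" "(x, x') \<noteq> (0, 0)"
    unfolding mem_Collect_eq by (elim exE conjE)
  have "(x * \<alpha> + x' * \<beta>, x * \<alpha>' + x' * \<beta>') \<noteq> (0, 0)"
    using x(2) coordinate_fst(1,2)[of x x'] by auto
  moreover have "L = quadric_param (x * \<alpha> + x' * \<beta>) (x * \<alpha>' + x' * \<beta>') (Y * \<gamma> + Y' * \<delta>) (Y * \<gamma>' + Y' * \<delta>')"
    unfolding x(1) seg_segre quadric_param_segre ..
  ultimately show "L \<in> ?M" by (intro CollectI exI conjI)
next
  fix L assume "L \<in> ?M"
  then obtain \<mu> \<mu>' where n: "L = quadric_param \<mu> \<mu>' (Y * \<gamma> + Y' * \<delta>) (Y * \<gamma>' + Y' * \<delta>')" "(\<mu>, \<mu>') \<noteq> (0, 0)"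
    unfolding mem_Collect_eq by (elim exE conjE)
  have "(\<beta>' * \<mu> - \<beta> * \<mu>', \<alpha> * \<mu>' - \<alpha>' * \<mu>) \<noteq> (0, 0)"
    using n(2) coordinate_fst(3,4)[of \<mu> \<mu>'] by auto
  moreover have "L = point (seg (\<beta>' * \<mu> - \<beta> * \<mu>') (\<alpha> * \<mu>' - \<alpha>' * \<mu>) Y Y')"
    unfolding n(1) seg_segre quadric_param_segre coordinate_fst ..
  ultimately show "L \<in> ?L" by (intro CollectI exI conjI)
qed

lemma fibre_curve_of_fst:
  assumes "(X, X') \<noteq> (0, 0)" "C = {point (seg X X' y y') | y y'. (y, y') \<noteq> (0, 0)}"
  shows "fibre_curve C"
  by (rule fibre_curve_fstI[OF _ assms(2)[unfolded fibre_fst_eq]])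
     (use assms(1) coordinate_fst(1,2)[of X X'] in auto)

lemma fibre_curve_of_snd:
  assumes "(Y, Y') \<noteq> (0, 0)" "C = {point (seg x x' Y Y') | x x'. (x, x') \<noteq> (0, 0)}"
  shows "fibre_curve C"
  by (rule fibre_curve_sndI[OF _ assms(2)[unfolded fibre_snd_eq]])
     (use assms(1) coordinate_snd(1,2)[of Y Y'] in auto)

end

text \<open>
  The discriminant of one of the two forms is nonzero; this form takes the part of \<open>P\<close>, after an
  exchange of the factors if necessary.
\<close>

theorem legendrian_curve_on_quadric:
  assumes contact: "p * c + q * b + r * a \<noteq> 0"
    and curve: "algebraic_curve C" "C \<subseteq> quadric" and leg: "legendrian (contact_form a b c p q r) C"
  shows "fibre_curve C \<or> monomial_curve C"
proof (cases "(c - p)\<^sup>2 - 4 * q * b = 0")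
  case False
  obtain \<alpha> \<alpha>' \<beta> \<beta>' \<gamma> \<gamma>' \<delta> \<delta>' where basis: "\<alpha> * \<beta>' - \<alpha>' * \<beta> = 1" "\<gamma> * \<delta>' - \<gamma>' * \<delta> = 1"
    and roots: "qform q (c - p) b \<alpha> \<alpha>' = 0" "qform q (c - p) b \<beta> \<beta>' = 0" "polar q (c - p) b \<alpha> \<alpha>' \<beta> \<beta>' \<noteq> 0"
    "qform (- r) (p + c) a \<gamma> \<gamma>' = 0"
    "polar (- r) (p + c) a \<gamma> \<gamma>' \<delta> \<delta>' = 0 \<or> qform (- r) (p + c) a \<delta> \<delta>' = 0"
    and ratio: "\<forall>m n :: nat. m > 0 \<longrightarrow> n > 0 \<longrightarrow>
      of_nat m * polar q (c - p) b \<alpha> \<alpha>' \<beta> \<beta>' + of_nat n * polar (- r) (p + c) a \<gamma> \<gamma>' \<delta> \<delta>' \<noteq> 0"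
    by (rule adapted_bases[OF False, where A' = "- r" and B' = "p + c" and D' = a]) (rule that)
  interpret segre_chart \<alpha> \<alpha>' \<beta> \<beta>' \<gamma> \<gamma>' \<delta> \<delta>' by standard (fact basis)+
  interpret leg: legendrian_chart "segre \<alpha> \<alpha>' \<gamma> \<gamma>'" "segre \<alpha> \<alpha>' \<delta> \<delta>'" "segre \<beta> \<beta>' \<gamma> \<gamma>'" "segre \<beta> \<beta>' \<delta> \<delta>'"
    "bilinear \<beta>' (- \<beta>) \<delta>' (- \<delta>)" "bilinear \<beta>' (- \<beta>) (- \<gamma>') \<gamma>"
    "bilinear (- \<alpha>') \<alpha> \<delta>' (- \<delta>)" "bilinear (- \<alpha>') \<alpha> (- \<gamma>') \<gamma>"
    C "contact_form a b c p q r" "polar q (c - p) b \<alpha> \<alpha>' \<beta> \<beta>'" "polar (- r) (p + c) a \<gamma> \<gamma>' \<delta> \<delta>'"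
    "qform (- r) (p + c) a \<delta> \<delta>'"
  proof
    fix x y
    have 1: "\<alpha> * (x * \<alpha>' + \<beta>') - \<alpha>' * (x * \<alpha> + \<beta>) = 1" "\<gamma> * (y * \<gamma>' + \<delta>') - \<gamma>' * (y * \<gamma> + \<delta>) = 1"
      using basis by (simp_all add: algebra_simps)
    show "contact_form a b c p q r (seg x 1 y 1) (seg 1 0 y 1) =
        polar (- r) (p + c) a \<gamma> \<gamma>' \<delta> \<delta>' * y + qform (- r) (p + c) a \<delta> \<delta>'"
      unfolding seg_segre by (simp add: contact_form_fst qform_line 1 roots)
    show "contact_form a b c p q r (seg x 1 y 1) (seg x 1 1 0) = polar q (c - p) b \<alpha> \<alpha>' \<beta> \<beta>' * x"
      unfolding seg_segre by (simp add: contact_form_snd qform_line 1 roots)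
  qed (fact curve leg roots ratio[rule_format] contact_form_linear)+
  from leg.curve_classification show ?thesis
  proof (elim disjE exE conjE)
    assume leg.fibre
    then show ?thesis unfolding leg.fibre_def using fibre_curve_of_fst fibre_curve_of_snd
      by (elim disjE exE conjE) (intro disjI1; simp)+
  next
    fix A B :: nat and k
    assume *: "A > 0" "B > 0" "k \<noteq> 0"
      "C = {point (seg x x' y y') | x x' y y'. (x, x') \<noteq> (0, 0) \<and> (y, y') \<noteq> (0, 0) \<and>
        x ^ A * y ^ B = k * (x' ^ A * y' ^ B)}"
    show ?thesis
      by (rule disjI2[OF monomial_curveI[OF basis *(1-3) *(4)[unfolded change_coordinates]]])
  qed
next
  case True
  have "(p + c)\<^sup>2 - 4 * (- r) * a = ((c - p)\<^sup>2 - 4 * q * b) + 4 * (p * c + q * b + r * a)"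
    by (simp add: power2_eq_square algebra_simps)
  then have disc: "(p + c)\<^sup>2 - 4 * (- r) * a \<noteq> 0"
    using contact unfolding True by (simp del: distrib_left_numeral mult_minus_left mult_minus_right)
  obtain \<gamma> \<gamma>' \<delta> \<delta>' \<alpha> \<alpha>' \<beta> \<beta>' where basis: "\<gamma> * \<delta>' - \<gamma>' * \<delta> = 1" "\<alpha> * \<beta>' - \<alpha>' * \<beta> = 1"
    and roots: "qform (- r) (p + c) a \<gamma> \<gamma>' = 0" "qform (- r) (p + c) a \<delta> \<delta>' = 0"
    "polar (- r) (p + c) a \<gamma> \<gamma>' \<delta> \<delta>' \<noteq> 0" "qform q (c - p) b \<alpha> \<alpha>' = 0"
    "polar q (c - p) b \<alpha> \<alpha>' \<beta> \<beta>' = 0 \<or> qform q (c - p) b \<beta> \<beta>' = 0"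
    and ratio: "\<forall>m n :: nat. m > 0 \<longrightarrow> n > 0 \<longrightarrow>
      of_nat m * polar (- r) (p + c) a \<gamma> \<gamma>' \<delta> \<delta>' + of_nat n * polar q (c - p) b \<alpha> \<alpha>' \<beta> \<beta>' \<noteq> 0"
    by (rule adapted_bases[OF disc, where A' = q and B' = "c - p" and D' = b]) (rule that)
  interpret segre_chart \<alpha> \<alpha>' \<beta> \<beta>' \<gamma> \<gamma>' \<delta> \<delta>' by standard (fact basis)+
  interpret swap: quadric_chart "segre \<alpha> \<alpha>' \<gamma> \<gamma>'" "segre \<beta> \<beta>' \<gamma> \<gamma>'" "segre \<alpha> \<alpha>' \<delta> \<delta>'" "segre \<beta> \<beta>' \<delta> \<delta>'"
    "bilinear \<beta>' (- \<beta>) \<delta>' (- \<delta>)" "bilinear (- \<alpha>') \<alpha> \<delta>' (- \<delta>)"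
    "bilinear \<beta>' (- \<beta>) (- \<gamma>') \<gamma>" "bilinear (- \<alpha>') \<alpha> (- \<gamma>') \<gamma>"
    by (rule quadric_chart_swap) unfold_locales
  have swap_seg: "swap.seg y y' x x' = seg x x' y y'" for x x' y y'
    unfolding swap.seg_def seg_def by (simp add: algebra_simps)
  interpret leg: legendrian_chart "segre \<alpha> \<alpha>' \<gamma> \<gamma>'" "segre \<beta> \<beta>' \<gamma> \<gamma>'" "segre \<alpha> \<alpha>' \<delta> \<delta>'" "segre \<beta> \<beta>' \<delta> \<delta>'"
    "bilinear \<beta>' (- \<beta>) \<delta>' (- \<delta>)" "bilinear (- \<alpha>') \<alpha> \<delta>' (- \<delta>)"
    "bilinear \<beta>' (- \<beta>) (- \<gamma>') \<gamma>" "bilinear (- \<alpha>') \<alpha> (- \<gamma>') \<gamma>"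
    C "contact_form a b c p q r" "polar (- r) (p + c) a \<gamma> \<gamma>' \<delta> \<delta>'" "polar q (c - p) b \<alpha> \<alpha>' \<beta> \<beta>'"
    "qform q (c - p) b \<beta> \<beta>'"
  proof
    fix x y
    have 1: "\<alpha> * (x * \<alpha>' + \<beta>') - \<alpha>' * (x * \<alpha> + \<beta>) = 1" "\<gamma> * (y * \<gamma>' + \<delta>') - \<gamma>' * (y * \<gamma> + \<delta>) = 1" for x y
      using basis by (simp_all add: algebra_simps)
    show "contact_form a b c p q r (swap.seg x 1 y 1) (swap.seg 1 0 y 1) =
        polar q (c - p) b \<alpha> \<alpha>' \<beta> \<beta>' * y + qform q (c - p) b \<beta> \<beta>'"
      unfolding swap_seg seg_segre by (simp add: contact_form_snd qform_line 1 roots)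
    show "contact_form a b c p q r (swap.seg x 1 y 1) (swap.seg x 1 1 0) = polar (- r) (p + c) a \<gamma> \<gamma>' \<delta> \<delta>' * x"
      unfolding swap_seg seg_segre by (simp add: contact_form_fst qform_line 1 roots)
  qed (fact curve leg roots ratio[rule_format] contact_form_linear)+
  from leg.curve_classification[unfolded swap_seg leg.fibre_def] show ?thesis
  proof (elim disjE exE conjE)
    fix Y Y' assume "(Y, Y') \<noteq> (0, 0)" "C = {point (seg x x' Y Y') | x x'. (x, x') \<noteq> (0, 0)}"
    then show ?thesis by (intro disjI1 fibre_curve_of_snd)
  next
    fix X X' assume "(X, X') \<noteq> (0, 0)" "C = {point (seg X X' y y') | y y'. (y, y') \<noteq> (0, 0)}"
    then show ?thesis by (intro disjI1 fibre_curve_of_fst)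
  next
    fix A B :: nat and k
    assume *: "A > 0" "B > 0" "k \<noteq> 0"
      "C = {point (seg x x' y y') | y y' x x'. (y, y') \<noteq> (0, 0) \<and> (x, x') \<noteq> (0, 0) \<and>
        y ^ A * x ^ B = k * (y' ^ A * x' ^ B)}"
    have "C = {point (seg x x' y y') | x x' y y'. (x, x') \<noteq> (0, 0) \<and> (y, y') \<noteq> (0, 0) \<and>
        x ^ B * y ^ A = k * (x' ^ B * y' ^ A)}"
    proof -
      have "(y, y') \<noteq> (0, 0) \<and> (x, x') \<noteq> (0, 0) \<and> y ^ A * x ^ B = k * (y' ^ A * x' ^ B) \<longleftrightarrow>
          (x, x') \<noteq> (0, 0) \<and> (y, y') \<noteq> (0, 0) \<and> x ^ B * y ^ A = k * (x' ^ B * y' ^ A)" for x x' y y'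
        by (simp only: mult.commute conj_left_commute)
      moreover have "{point (seg x x' y y') | y y' x x'. Q x x' y y'} =
          {point (seg x x' y y') | x x' y y'. Q x x' y y'}" for Q
        by (rule Collect_cong) iprover
      ultimately show ?thesis using *(4) by (simp only:)
    qed
    from this[unfolded change_coordinates] show ?thesis
      by (intro disjI2 monomial_curveI[OF basis(2,1) *(2,1,3)])
  qed
qed

section \<open>Normal forms\<close>

definition standard_curve :: "(complex ^ 4) set set \<Rightarrow> bool" where
  "standard_curve C \<longleftrightarrow> (\<exists>s0 s1 t0 t1 :: complex. s1 \<noteq> 0 \<and> t1 \<noteq> 0 \<and>
    ((\<exists>c0 c1 d1 d2. C = curve_given_by s0 s1 t0 t1 (\<lambda>\<mu> \<mu>' \<nu> \<nu>'.
        c0 * (\<nu> - \<nu>') ^ d1 * (\<mu> + \<mu>') ^ d2 = c1 * (\<mu> - \<mu>') ^ d2 * (\<nu> + \<nu>') ^ d1)) \<or>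
     (\<exists>c0 c1 d1 d2. C = curve_given_by s0 s1 t0 t1 (\<lambda>\<mu> \<mu>' \<nu> \<nu>'.
        c0 * \<nu> ^ d1 * \<mu>' ^ d2 = c1 * \<mu> ^ d2 * \<nu>' ^ d1)) \<or>
     (\<exists>c0 c1 d1 d2. c0 \<noteq> 0 \<and> c1 \<noteq> 0 \<and> d1 > 0 \<and> d2 > 0 \<and>
        C = curve_given_by s0 s1 t0 t1 (\<lambda>\<mu> \<mu>' \<nu> \<nu>'.
        c0 * \<nu> ^ d1 * \<mu> ^ d2 = c1 * \<mu>' ^ d2 * \<nu>' ^ d1)) \<or>
     (\<exists>c0 c1 d1 d2. C = curve_given_by s0 s1 t0 t1 (\<lambda>\<mu> \<mu>' \<nu> \<nu>'.
        c0 * (\<nu> - \<nu>') ^ d1 * \<mu>' ^ d2 = c1 * \<mu> ^ d2 * (\<nu> + \<nu>') ^ d1)) \<or>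
     (\<exists>c0 c1 d1 d2. C = curve_given_by s0 s1 t0 t1 (\<lambda>\<mu> \<mu>' \<nu> \<nu>'.
        c0 * (\<mu> - \<mu>') ^ d1 * \<nu>' ^ d2 = c1 * \<nu> ^ d2 * (\<mu> + \<mu>') ^ d1)) \<or>
     (\<exists>c0 c1 c2. C = curve_given_by s0 s1 t0 t1 (\<lambda>\<mu> \<mu>' \<nu> \<nu>'.
        c0 * \<mu> * \<nu> + c1 * \<mu> * \<nu>' + c2 * \<mu>' * \<nu> = 0)) \<or>
     (\<exists>c0 c1 c2. C = curve_given_by s0 s1 t0 t1 (\<lambda>\<mu> \<mu>' \<nu> \<nu>'.
        c0 * \<mu> * \<nu>' + c1 * \<mu>' * \<nu> + c2 * \<mu>' * \<nu>' = 0)) \<or>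
     (\<exists>c0 c1 c2. C = curve_given_by s0 s1 t0 t1 (\<lambda>\<mu> \<mu>' \<nu> \<nu>'.
        c0 * \<mu> * \<nu> + c1 * \<mu> * \<nu>' + c2 * \<mu>' * \<nu>' = 0)) \<or>
     (\<exists>c0 c1 c2. C = curve_given_by s0 s1 t0 t1 (\<lambda>\<mu> \<mu>' \<nu> \<nu>'.
        c0 * \<mu> * \<nu> + c1 * \<mu>' * \<nu> + c2 * \<mu>' * \<nu>' = 0)) \<or>
     (\<exists>c0. C = curve_given_by s0 s1 t0 t1 (\<lambda>\<mu> \<mu>' \<nu> \<nu>'. \<mu> = c0 * \<mu>')) \<or>
     (\<exists>c0. C = curve_given_by s0 s1 t0 t1 (\<lambda>\<mu> \<mu>' \<nu> \<nu>'. \<nu> = c0 * \<nu>'))))"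

lemma standard_curve_distinct_distinct:
  assumes "s1 \<noteq> 0" "t1 \<noteq> 0" "C = curve_given_by s0 s1 t0 t1 (\<lambda>\<mu> \<mu>' \<nu> \<nu>'.
    c0 * (\<nu> - \<nu>') ^ d1 * (\<mu> + \<mu>') ^ d2 = c1 * (\<mu> - \<mu>') ^ d2 * (\<nu> + \<nu>') ^ d1)"
  shows "standard_curve C"
  unfolding standard_curve_def
  by (rule exI[of _ s0], rule exI[of _ s1], rule exI[of _ t0], rule exI[of _ t1],
       rule conjI[OF assms(1)], rule conjI[OF assms(2)])
     (rule disjI1, rule exI, rule exI, rule exI, rule exI, rule assms(3))

lemma standard_curve_power:
  assumes "s1 \<noteq> 0" "t1 \<noteq> 0" "C = curve_given_by s0 s1 t0 t1 (\<lambda>\<mu> \<mu>' \<nu> \<nu>'.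
    c0 * \<nu> ^ d1 * \<mu>' ^ d2 = c1 * \<mu> ^ d2 * \<nu>' ^ d1)"
  shows "standard_curve C"
  unfolding standard_curve_def
  by (rule exI[of _ s0], rule exI[of _ s1], rule exI[of _ t0], rule exI[of _ t1],
       rule conjI[OF assms(1)], rule conjI[OF assms(2)])
     (rule disjI2, rule disjI1, rule exI, rule exI, rule exI, rule exI, rule assms(3))

lemma standard_curve_negative_power:
  assumes "s1 \<noteq> 0" "t1 \<noteq> 0" "c0 \<noteq> 0" "c1 \<noteq> 0" "d1 > 0" "d2 > 0"
    "C = curve_given_by s0 s1 t0 t1 (\<lambda>\<mu> \<mu>' \<nu> \<nu>'. c0 * \<nu> ^ d1 * \<mu> ^ d2 = c1 * \<mu>' ^ d2 * \<nu>' ^ d1)"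
  shows "standard_curve C"
  unfolding standard_curve_def
  by (rule exI[of _ s0], rule exI[of _ s1], rule exI[of _ t0], rule exI[of _ t1],
       rule conjI[OF assms(1)], rule conjI[OF assms(2)])
     (rule disjI2, rule disjI2, rule disjI1, rule exI[of _ c0], rule exI[of _ c1],
       rule exI[of _ d1], rule exI[of _ d2], intro conjI assms)

lemma standard_curve_distinct_snd:
  assumes "s1 \<noteq> 0" "t1 \<noteq> 0" "C = curve_given_by s0 s1 t0 t1 (\<lambda>\<mu> \<mu>' \<nu> \<nu>'.
    c0 * (\<nu> - \<nu>') ^ d1 * \<mu>' ^ d2 = c1 * \<mu> ^ d2 * (\<nu> + \<nu>') ^ d1)"
  shows "standard_curve C"
  unfolding standard_curve_def
  by (rule exI[of _ s0], rule exI[of _ s1], rule exI[of _ t0], rule exI[of _ t1],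
       rule conjI[OF assms(1)], rule conjI[OF assms(2)])
     (rule disjI2, rule disjI2, rule disjI2, rule disjI1, rule exI, rule exI, rule exI, rule exI, rule assms(3))

lemma standard_curve_distinct_fst:
  assumes "s1 \<noteq> 0" "t1 \<noteq> 0" "C = curve_given_by s0 s1 t0 t1 (\<lambda>\<mu> \<mu>' \<nu> \<nu>'.
    c0 * (\<mu> - \<mu>') ^ d1 * \<nu>' ^ d2 = c1 * \<nu> ^ d2 * (\<mu> + \<mu>') ^ d1)"
  shows "standard_curve C"
  unfolding standard_curve_def
  by (rule exI[of _ s0], rule exI[of _ s1], rule exI[of _ t0], rule exI[of _ t1],
       rule conjI[OF assms(1)], rule conjI[OF assms(2)])
     (rule disjI2, rule disjI2, rule disjI2, rule disjI2, rule disjI1,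
       rule exI, rule exI, rule exI, rule exI, rule assms(3))

lemma standard_curve_fst_const:
  assumes "s1 \<noteq> 0" "t1 \<noteq> 0" "C = curve_given_by s0 s1 t0 t1 (\<lambda>\<mu> \<mu>' \<nu> \<nu>'. \<mu> = c0 * \<mu>')"
  shows "standard_curve C"
  unfolding standard_curve_def
  by (rule exI[of _ s0], rule exI[of _ s1], rule exI[of _ t0], rule exI[of _ t1],
       rule conjI[OF assms(1)], rule conjI[OF assms(2)])
     (rule disjI2, rule disjI2, rule disjI2, rule disjI2, rule disjI2, rule disjI2, rule disjI2,
       rule disjI2, rule disjI2, rule disjI1, rule exI, rule assms(3))

lemma standard_curve_snd_const:
  assumes "s1 \<noteq> 0" "t1 \<noteq> 0" "C = curve_given_by s0 s1 t0 t1 (\<lambda>\<mu> \<mu>' \<nu> \<nu>'. \<nu> = c0 * \<nu>')"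
  shows "standard_curve C"
  unfolding standard_curve_def
  by (rule exI[of _ s0], rule exI[of _ s1], rule exI[of _ t0], rule exI[of _ t1],
       rule conjI[OF assms(1)], rule conjI[OF assms(2)])
     (rule disjI2, rule disjI2, rule disjI2, rule disjI2, rule disjI2, rule disjI2, rule disjI2,
       rule disjI2, rule disjI2, rule disjI2, rule exI, rule assms(3))

lemma curve_given_byI:
  assumes "C = {quadric_param \<mu> \<mu>' \<nu> \<nu>' | \<mu> \<mu>' \<nu> \<nu>'. (\<mu>, \<mu>') \<noteq> (0, 0) \<and> (\<nu>, \<nu>') \<noteq> (0, 0) \<and> R \<mu> \<mu>' \<nu> \<nu>'}"
    and "\<And>\<mu> \<mu>' \<nu> \<nu>'. R \<mu> \<mu>' \<nu> \<nu>' \<longleftrightarrow> E (s0 * \<mu>' + s1 * \<mu>) \<mu>' (t0 * \<nu>' + t1 * \<nu>) \<nu>'"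
  shows "C = curve_given_by s0 s1 t0 t1 E"
  unfolding curve_given_by_def assms(1) assms(2) ..

lemma quadric_param_scale:
  assumes "k \<noteq> 0"
  shows "quadric_param (k * \<mu>) (k * \<mu>') \<nu> \<nu>' = quadric_param \<mu> \<mu>' \<nu> \<nu>'"
    "quadric_param \<mu> \<mu>' (k * \<nu>) (k * \<nu>') = quadric_param \<mu> \<mu>' \<nu> \<nu>'"
proof -
  have "segre (k * \<mu>) (k * \<mu>') \<nu> \<nu>' = k *s segre \<mu> \<mu>' \<nu> \<nu>'" "segre \<mu> \<mu>' (k * \<nu>) (k * \<nu>') = k *s segre \<mu> \<mu>' \<nu> \<nu>'"
    by (simp_all add: vec_eq_iff forall_4)
  then show "quadric_param (k * \<mu>) (k * \<mu>') \<nu> \<nu>' = quadric_param \<mu> \<mu>' \<nu> \<nu>'"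
    "quadric_param \<mu> \<mu>' (k * \<nu>) (k * \<nu>') = quadric_param \<mu> \<mu>' \<nu> \<nu>'"
    unfolding quadric_param_segre using assms by (simp_all add: point_scale)
qed

lemma proportional:
  assumes "(X, X') \<noteq> (0, 0)" "(x, x') \<noteq> (0, 0)" "x * X' = X * (x' :: complex)"
  obtains k where "k \<noteq> 0" "x = k * X" "x' = k * X'"
proof (cases "X = 0")
  case True
  then have "X' \<noteq> 0" using assms(1) by simp
  then show ?thesis using True assms that[of "x' / X'"] by auto
next
  case False
  then have "x' = x / X * X'" using assms(3) by (simp add: field_simps)
  moreover from this have "x \<noteq> 0" using assms(2) by auto
  ultimately show ?thesis using False assms that[of "x / X"] by auto
qed

lemma fibre_curve_standard:
  assumes "fibre_curve C"
  shows "standard_curve C"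
  using assms[unfolded fibre_curve_def]
proof (elim disjE exE conjE)
  fix X X' assume X: "(X, X') \<noteq> (0, 0)" and C: "C = {quadric_param X X' \<nu> \<nu>' | \<nu> \<nu>'. (\<nu>, \<nu>') \<noteq> (0, 0)}"
  have eq: "C = {quadric_param \<mu> \<mu>' \<nu> \<nu>' | \<mu> \<mu>' \<nu> \<nu>'. (\<mu>, \<mu>') \<noteq> (0, 0) \<and> (\<nu>, \<nu>') \<noteq> (0, 0) \<and> \<mu> * X' = X * \<mu>'}" (is "C = ?M")
  proof (intro subset_antisym subsetI)
    fix L assume "L \<in> C"
    then obtain \<nu> \<nu>' where "L = quadric_param X X' \<nu> \<nu>'" "(\<nu>, \<nu>') \<noteq> (0, 0)" unfolding C mem_Collect_eq by (elim exE conjE)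
    with X show "L \<in> ?M"
      by (intro CollectI exI[of _ X] exI[of _ X'] exI[of _ \<nu>] exI[of _ \<nu>'] conjI) simp_all
  next
    fix L assume "L \<in> ?M"
    then obtain \<mu> \<mu>' \<nu> \<nu>' where m: "L = quadric_param \<mu> \<mu>' \<nu> \<nu>'" "(\<mu>, \<mu>') \<noteq> (0, 0)" "(\<nu>, \<nu>') \<noteq> (0, 0)" "\<mu> * X' = X * \<mu>'"
      unfolding mem_Collect_eq by (elim exE conjE)
    obtain k where "k \<noteq> 0" "\<mu> = k * X" "\<mu>' = k * X'" using X m(2,4) by (rule proportional)
    then have "L = quadric_param X X' \<nu> \<nu>'" using m(1) by (simp add: quadric_param_scale)
    with m(3) show "L \<in> C" unfolding C by (intro CollectI exI conjI)
  qed
  show ?thesis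
  proof (cases "X' = 0")
    case False
    show ?thesis
      by (rule standard_curve_fst_const[of 1 1 _ 0 0 "X / X'"], simp, simp, rule curve_given_byI[OF eq])
         (use False in \<open>simp add: field_simps\<close>)
  next
    case True
    \<comment> \<open>the fibre \<open>\<mu>' = 0\<close> over \<open>\<infinity>\<close>, as the power equation with one coefficient zero\<close>
    show ?thesis
      by (rule standard_curve_power[of 1 1 _ 0 0 1 0 1 0], simp, simp, rule curve_given_byI[OF eq])
         (use True X in simp)
  qed
next
  fix Y Y' assume Y: "(Y, Y') \<noteq> (0, 0)" and C: "C = {quadric_param \<mu> \<mu>' Y Y' | \<mu> \<mu>'. (\<mu>, \<mu>') \<noteq> (0, 0)}"
  have eq: "C = {quadric_param \<mu> \<mu>' \<nu> \<nu>' | \<mu> \<mu>' \<nu> \<nu>'. (\<mu>, \<mu>') \<noteq> (0, 0) \<and> (\<nu>, \<nu>') \<noteq> (0, 0) \<and> \<nu> * Y' = Y * \<nu>'}" (is "C = ?M")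
  proof (intro subset_antisym subsetI)
    fix L assume "L \<in> C"
    then obtain \<mu> \<mu>' where "L = quadric_param \<mu> \<mu>' Y Y'" "(\<mu>, \<mu>') \<noteq> (0, 0)" unfolding C mem_Collect_eq by (elim exE conjE)
    with Y show "L \<in> ?M"
      by (intro CollectI exI[of _ \<mu>] exI[of _ \<mu>'] exI[of _ Y] exI[of _ Y'] conjI) simp_all
  next
    fix L assume "L \<in> ?M"
    then obtain \<mu> \<mu>' \<nu> \<nu>' where m: "L = quadric_param \<mu> \<mu>' \<nu> \<nu>'" "(\<mu>, \<mu>') \<noteq> (0, 0)" "(\<nu>, \<nu>') \<noteq> (0, 0)" "\<nu> * Y' = Y * \<nu>'"
      unfolding mem_Collect_eq by (elim exE conjE)
    obtain k where "k \<noteq> 0" "\<nu> = k * Y" "\<nu>' = k * Y'" using Y m(3,4) by (rule proportional)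
    then have "L = quadric_param \<mu> \<mu>' Y Y'" using m(1) by (simp add: quadric_param_scale)
    with m(2) show "L \<in> C" unfolding C by (intro CollectI exI conjI)
  qed
  show ?thesis
  proof (cases "Y' = 0")
    case False
    show ?thesis
      by (rule standard_curve_snd_const[of 1 1 _ 0 0 "Y / Y'"], simp, simp, rule curve_given_byI[OF eq])
         (use False in \<open>simp add: field_simps\<close>)
  next
    case True
    \<comment> \<open>the fibre \<open>\<nu>' = 0\<close> over \<open>\<infinity>\<close>\<close>
    show ?thesis
      by (rule standard_curve_power[of 1 1 _ 0 0 0 1 0 1], simp, simp, rule curve_given_byI[OF eq])
         (use True Y in simp)
  qed
qed

text \<open>
  The affine map that sends the root \<open>\<beta> / \<beta>'\<close> of the first linear form to \<open>- \<sigma>\<close> and the root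
  \<open>\<alpha> / \<alpha>'\<close> of the second one to \<open>\<sigma>\<close>.
\<close>

lemma finite_roots:
  fixes \<alpha> \<alpha>' \<beta> \<beta>' \<sigma> :: complex
  assumes "\<alpha> * \<beta>' - \<alpha>' * \<beta> = 1" "\<alpha>' \<noteq> 0" "\<beta>' \<noteq> 0" "\<sigma> = 1 \<or> \<sigma> = - 1"
  obtains s0 s1 k k' where "s1 \<noteq> 0" "k \<noteq> 0" "k' \<noteq> 0"
    "\<And>\<mu> \<mu>'. \<beta>' * \<mu> - \<beta> * \<mu>' = k * (s0 * \<mu>' + s1 * \<mu> + \<sigma> * \<mu>')"
    "\<And>\<mu> \<mu>'. \<alpha> * \<mu>' - \<alpha>' * \<mu> = k' * (s0 * \<mu>' + s1 * \<mu> - \<sigma> * \<mu>')"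
proof (rule that)
  have \<sigma>: "\<sigma> \<noteq> 0" using assms(4) by auto
  show "2 * \<sigma> * \<alpha>' * \<beta>' \<noteq> 0" "1 / (2 * \<sigma> * \<alpha>') \<noteq> 0" "- 1 / (2 * \<sigma> * \<beta>') \<noteq> 0" using assms(2,3) \<sigma> by simp_all
  fix \<mu> \<mu>'
  have "2 * \<sigma> * \<alpha>' * (\<beta>' * \<mu> - \<beta> * \<mu>') = (- \<sigma> - 2 * \<sigma> * \<alpha>' * \<beta>) * \<mu>' + 2 * \<sigma> * \<alpha>' * \<beta>' * \<mu> + \<sigma> * \<mu>'" by algebra
  then show "\<beta>' * \<mu> - \<beta> * \<mu>' = 1 / (2 * \<sigma> * \<alpha>') * ((- \<sigma> - 2 * \<sigma> * \<alpha>' * \<beta>) * \<mu>' + 2 * \<sigma> * \<alpha>' * \<beta>' * \<mu> + \<sigma> * \<mu>')"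
    using \<sigma> assms(2) by (simp only: flip: \<open>2 * \<sigma> * \<alpha>' * (\<beta>' * \<mu> - \<beta> * \<mu>') = _\<close>) simp
  have "(- 2 * \<sigma> * \<beta>') * (\<alpha> * \<mu>' - \<alpha>' * \<mu>) = (- \<sigma> - 2 * \<sigma> * \<alpha>' * \<beta>) * \<mu>' + 2 * \<sigma> * \<alpha>' * \<beta>' * \<mu> - \<sigma> * \<mu>'"
    using assms(1) by algebra
  then show "\<alpha> * \<mu>' - \<alpha>' * \<mu> = - 1 / (2 * \<sigma> * \<beta>') * ((- \<sigma> - 2 * \<sigma> * \<alpha>' * \<beta>) * \<mu>' + 2 * \<sigma> * \<alpha>' * \<beta>' * \<mu> - \<sigma> * \<mu>')"
    using \<sigma> assms(3) by (simp only: flip: \<open>(- 2 * \<sigma> * \<beta>') * (\<alpha> * \<mu>' - \<alpha>' * \<mu>) = _\<close>) simp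
qed

lemma root_cases:
  fixes \<alpha> \<alpha>' \<beta> \<beta>' :: complex
  assumes "\<alpha> * \<beta>' - \<alpha>' * \<beta> = 1"
  obtains (finite) "\<beta>' \<noteq> 0" "\<alpha>' \<noteq> 0"
    | (infinite_snd) s0 s1 k where "s1 \<noteq> 0" "k \<noteq> 0"
      "\<And>\<mu> \<mu>'. \<beta>' * \<mu> - \<beta> * \<mu>' = s0 * \<mu>' + s1 * \<mu>" "\<And>\<mu> \<mu>'. \<alpha> * \<mu>' - \<alpha>' * \<mu> = k * \<mu>'"
    | (infinite_fst) s0 s1 k where "s1 \<noteq> 0" "k \<noteq> 0"
      "\<And>\<mu> \<mu>'. \<beta>' * \<mu> - \<beta> * \<mu>' = k * \<mu>'" "\<And>\<mu> \<mu>'. \<alpha> * \<mu>' - \<alpha>' * \<mu> = s0 * \<mu>' + s1 * \<mu>"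
proof -
  consider "\<beta>' \<noteq> 0" "\<alpha>' \<noteq> 0" | "\<alpha>' = 0" | "\<beta>' = 0" by blast
  then show thesis
  proof cases
    case 1 then show thesis by (rule finite)
  next
    case 2 then show thesis using assms by (intro infinite_snd[of \<beta>' \<alpha> "- \<beta>"]) auto
  next
    case 3 then show thesis using assms by (intro infinite_fst[of "- \<alpha>'" "- \<beta>" \<alpha>]) auto
  qed
qed

text \<open>
  Each factor has two finite roots, or one of its two roots at \<open>\<infinity>\<close>.  Finite roots are sent to \<open>\<plusminus>1\<close>,
  in the order that puts the resulting equation into standard form.  If both factors have a root at
  \<open>\<infinity>\<close>, the order of the roots cannot be changed, which is why a negative power may remain.
\<close>

lemma monomial_curve_standard:
  assumes "monomial_curve C"
  shows "standard_curve C"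
proof -
  obtain \<alpha> \<alpha>' \<beta> \<beta>' \<gamma> \<gamma>' \<delta> \<delta>' A B c where
    fst: "\<alpha> * \<beta>' - \<alpha>' * \<beta> = 1" and snd: "\<gamma> * \<delta>' - \<gamma>' * \<delta> = 1" and AB: "A > 0" "B > 0" and c: "c \<noteq> 0" and
    C: "C = {quadric_param \<mu> \<mu>' \<nu> \<nu>' | \<mu> \<mu>' \<nu> \<nu>'. (\<mu>, \<mu>') \<noteq> (0, 0) \<and> (\<nu>, \<nu>') \<noteq> (0, 0) \<and>
       (\<beta>' * \<mu> - \<beta> * \<mu>') ^ A * (\<delta>' * \<nu> - \<delta> * \<nu>') ^ B =
       c * ((\<alpha> * \<mu>' - \<alpha>' * \<mu>) ^ A * (\<gamma> * \<nu>' - \<gamma>' * \<nu>) ^ B)}"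
    using assms unfolding monomial_curve_def by (elim exE conjE)
  note given = curve_given_byI[OF C]
  show ?thesis
  proof (cases rule: root_cases[OF fst, case_names finite infinite_snd infinite_fst])
    case finite
    note fin = finite_roots[OF fst finite(2,1)]
    show ?thesis
    proof (cases rule: root_cases[OF snd, case_names finite infinite_snd infinite_fst])
      case b: finite
      obtain s0 s1 k k' where s: "s1 \<noteq> 0" "k \<noteq> 0" "k' \<noteq> 0"
        "\<And>\<mu> \<mu>'. \<beta>' * \<mu> - \<beta> * \<mu>' = k * (s0 * \<mu>' + s1 * \<mu> + 1 * \<mu>')"
        "\<And>\<mu> \<mu>'. \<alpha> * \<mu>' - \<alpha>' * \<mu> = k' * (s0 * \<mu>' + s1 * \<mu> - 1 * \<mu>')"
        using fin[of 1] by (metis (no_types))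
      obtain t0 t1 h h' where t: "t1 \<noteq> 0" "h \<noteq> 0" "h' \<noteq> 0"
        "\<And>\<mu> \<mu>'. \<delta>' * \<mu> - \<delta> * \<mu>' = h * (t0 * \<mu>' + t1 * \<mu> + (- 1) * \<mu>')"
        "\<And>\<mu> \<mu>'. \<gamma> * \<mu>' - \<gamma>' * \<mu> = h' * (t0 * \<mu>' + t1 * \<mu> - (- 1) * \<mu>')"
        using finite_roots[OF snd b(2,1), of "- 1"] by (metis (no_types))
      show ?thesis
        by (rule standard_curve_distinct_distinct[where ?s0.0 = s0 and ?t0.0 = t0 and ?c0.0 = "k ^ A * h ^ B" and ?d1.0 = B and ?d2.0 = A and ?c1.0 = "c * k' ^ A * h' ^ B",
              OF s(1) t(1) given])
           (simp only: s(4,5) t(4,5) power_mult_distrib, auto simp: mult_ac)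
    next
      case b: (infinite_snd t0 t1 h)
      obtain s0 s1 k k' where s: "s1 \<noteq> 0" "k \<noteq> 0" "k' \<noteq> 0"
        "\<And>\<mu> \<mu>'. \<beta>' * \<mu> - \<beta> * \<mu>' = k * (s0 * \<mu>' + s1 * \<mu> + 1 * \<mu>')"
        "\<And>\<mu> \<mu>'. \<alpha> * \<mu>' - \<alpha>' * \<mu> = k' * (s0 * \<mu>' + s1 * \<mu> - 1 * \<mu>')"
        using fin[of 1] by (metis (no_types))
      show ?thesis
        by (rule standard_curve_distinct_fst[where ?s0.0 = s0 and ?t0.0 = t0 and ?c0.0 = "c * k' ^ A * h ^ B" and ?d1.0 = A and ?d2.0 = B and ?c1.0 = "k ^ A",
              OF s(1) b(1) given])
           (simp only: s(4,5) b(3,4) power_mult_distrib, auto simp: mult_ac)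
    next
      case b: (infinite_fst t0 t1 h)
      obtain s0 s1 k k' where s: "s1 \<noteq> 0" "k \<noteq> 0" "k' \<noteq> 0"
        "\<And>\<mu> \<mu>'. \<beta>' * \<mu> - \<beta> * \<mu>' = k * (s0 * \<mu>' + s1 * \<mu> + (- 1) * \<mu>')"
        "\<And>\<mu> \<mu>'. \<alpha> * \<mu>' - \<alpha>' * \<mu> = k' * (s0 * \<mu>' + s1 * \<mu> - (- 1) * \<mu>')"
        using fin[of "- 1"] by (metis (no_types))
      show ?thesis
        by (rule standard_curve_distinct_fst[where ?s0.0 = s0 and ?t0.0 = t0 and ?c0.0 = "k ^ A * h ^ B" and ?d1.0 = A and ?d2.0 = B and ?c1.0 = "c * k' ^ A",
              OF s(1) b(1) given])
           (simp only: s(4,5) b(3,4) power_mult_distrib, auto simp: mult_ac)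
    qed
  next
    case a: (infinite_snd s0 s1 k)
    show ?thesis
    proof (cases rule: root_cases[OF snd, case_names finite infinite_snd infinite_fst])
      case b: finite
      obtain t0 t1 h h' where t: "t1 \<noteq> 0" "h \<noteq> 0" "h' \<noteq> 0"
        "\<And>\<mu> \<mu>'. \<delta>' * \<mu> - \<delta> * \<mu>' = h * (t0 * \<mu>' + t1 * \<mu> + 1 * \<mu>')"
        "\<And>\<mu> \<mu>'. \<gamma> * \<mu>' - \<gamma>' * \<mu> = h' * (t0 * \<mu>' + t1 * \<mu> - 1 * \<mu>')"
        using finite_roots[OF snd b(2,1), of 1] by (metis (no_types))
      show ?thesis
        by (rule standard_curve_distinct_snd[where ?s0.0 = s0 and ?t0.0 = t0 and ?c0.0 = "c * k ^ A * h' ^ B" and ?d1.0 = B and ?d2.0 = A and ?c1.0 = "h ^ B",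
              OF a(1) t(1) given])
           (simp only: a(3,4) t(4,5) power_mult_distrib, auto simp: mult_ac)
    next
      case b: (infinite_snd t0 t1 h)
      show ?thesis
        by (rule standard_curve_negative_power[where ?s0.0 = s0 and ?t0.0 = t0 and ?c0.0 = 1 and ?c1.0 = "c * k ^ A * h ^ B",
              OF a(1) b(1) _ _ AB(2,1) given])
           (simp add: a(2) b(2) c, simp add: a(2) b(2) c,
             simp only: a(3,4) b(3,4) power_mult_distrib, auto simp: mult_ac)
    next
      case b: (infinite_fst t0 t1 h)
      show ?thesis
        by (rule standard_curve_power[where ?s0.0 = s0 and ?t0.0 = t0 and ?c0.0 = "c * k ^ A" and ?d1.0 = B and ?d2.0 = A and ?c1.0 = "h ^ B",
              OF a(1) b(1) given])
           (simp only: a(3,4) b(3,4) power_mult_distrib, auto simp: mult_ac)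
    qed
  next
    case a: (infinite_fst s0 s1 k)
    show ?thesis
    proof (cases rule: root_cases[OF snd, case_names finite infinite_snd infinite_fst])
      case b: finite
      obtain t0 t1 h h' where t: "t1 \<noteq> 0" "h \<noteq> 0" "h' \<noteq> 0"
        "\<And>\<mu> \<mu>'. \<delta>' * \<mu> - \<delta> * \<mu>' = h * (t0 * \<mu>' + t1 * \<mu> + (- 1) * \<mu>')"
        "\<And>\<mu> \<mu>'. \<gamma> * \<mu>' - \<gamma>' * \<mu> = h' * (t0 * \<mu>' + t1 * \<mu> - (- 1) * \<mu>')"
        using finite_roots[OF snd b(2,1), of "- 1"] by (metis (no_types))
      show ?thesis
        by (rule standard_curve_distinct_snd[where ?s0.0 = s0 and ?t0.0 = t0 and ?c0.0 = "k ^ A * h ^ B" and ?d1.0 = B and ?d2.0 = A and ?c1.0 = "c * h' ^ B",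
              OF a(1) t(1) given])
           (simp only: a(3,4) t(4,5) power_mult_distrib, auto simp: mult_ac)
    next
      case b: (infinite_snd t0 t1 h)
      show ?thesis
        by (rule standard_curve_power[where ?s0.0 = s0 and ?t0.0 = t0 and ?c0.0 = "k ^ A" and ?d1.0 = B and ?d2.0 = A and ?c1.0 = "c * h ^ B",
              OF a(1) b(1) given])
           (simp only: a(3,4) b(3,4) power_mult_distrib, auto simp: mult_ac)
    next
      case b: (infinite_fst t0 t1 h)
      show ?thesis
        by (rule standard_curve_negative_power[where ?s0.0 = s0 and ?t0.0 = t0 and ?c0.0 = c and ?c1.0 = "k ^ A * h ^ B",
              OF a(1) b(1) _ _ AB(2,1) given])
           (simp add: a(2) b(2) c, simp add: a(2) b(2) c,
             simp only: a(3,4) b(3,4) power_mult_distrib, auto simp: mult_ac)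
    qed
  qed
qed

theorem theorem4p3:
  fixes C :: "(complex ^ 4) set set" and a b c p q r :: complex
  assumes "p * c + q * b + r * a \<noteq> 0"
    and "algebraic_curve C"
    and "C \<subseteq> quadric"
    and "legendrian (contact_form a b c p q r) C"
  shows "\<exists>s0 s1 t0 t1 :: complex. s1 \<noteq> 0 \<and> t1 \<noteq> 0 \<and>
    ((\<exists>c0 c1 d1 d2. C = curve_given_by s0 s1 t0 t1 (\<lambda>\<mu> \<mu>' \<nu> \<nu>'.
        c0 * (\<nu> - \<nu>') ^ d1 * (\<mu> + \<mu>') ^ d2 = c1 * (\<mu> - \<mu>') ^ d2 * (\<nu> + \<nu>') ^ d1)) \<or>
     (\<exists>c0 c1 d1 d2. C = curve_given_by s0 s1 t0 t1 (\<lambda>\<mu> \<mu>' \<nu> \<nu>'.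
        c0 * \<nu> ^ d1 * \<mu>' ^ d2 = c1 * \<mu> ^ d2 * \<nu>' ^ d1)) \<or>
     (\<exists>c0 c1 d1 d2. c0 \<noteq> 0 \<and> c1 \<noteq> 0 \<and> d1 > 0 \<and> d2 > 0 \<and>
        C = curve_given_by s0 s1 t0 t1 (\<lambda>\<mu> \<mu>' \<nu> \<nu>'.
        c0 * \<nu> ^ d1 * \<mu> ^ d2 = c1 * \<mu>' ^ d2 * \<nu>' ^ d1)) \<or>
     (\<exists>c0 c1 d1 d2. C = curve_given_by s0 s1 t0 t1 (\<lambda>\<mu> \<mu>' \<nu> \<nu>'.
        c0 * (\<nu> - \<nu>') ^ d1 * \<mu>' ^ d2 = c1 * \<mu> ^ d2 * (\<nu> + \<nu>') ^ d1)) \<or>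
     (\<exists>c0 c1 d1 d2. C = curve_given_by s0 s1 t0 t1 (\<lambda>\<mu> \<mu>' \<nu> \<nu>'.
        c0 * (\<mu> - \<mu>') ^ d1 * \<nu>' ^ d2 = c1 * \<nu> ^ d2 * (\<mu> + \<mu>') ^ d1)) \<or>
     (\<exists>c0 c1 c2. C = curve_given_by s0 s1 t0 t1 (\<lambda>\<mu> \<mu>' \<nu> \<nu>'.
        c0 * \<mu> * \<nu> + c1 * \<mu> * \<nu>' + c2 * \<mu>' * \<nu> = 0)) \<or>
     (\<exists>c0 c1 c2. C = curve_given_by s0 s1 t0 t1 (\<lambda>\<mu> \<mu>' \<nu> \<nu>'.
        c0 * \<mu> * \<nu>' + c1 * \<mu>' * \<nu> + c2 * \<mu>' * \<nu>' = 0)) \<or>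
     (\<exists>c0 c1 c2. C = curve_given_by s0 s1 t0 t1 (\<lambda>\<mu> \<mu>' \<nu> \<nu>'.
        c0 * \<mu> * \<nu> + c1 * \<mu> * \<nu>' + c2 * \<mu>' * \<nu>' = 0)) \<or>
     (\<exists>c0 c1 c2. C = curve_given_by s0 s1 t0 t1 (\<lambda>\<mu> \<mu>' \<nu> \<nu>'.
        c0 * \<mu> * \<nu> + c1 * \<mu>' * \<nu> + c2 * \<mu>' * \<nu>' = 0)) \<or>
     (\<exists>c0. C = curve_given_by s0 s1 t0 t1 (\<lambda>\<mu> \<mu>' \<nu> \<nu>'. \<mu> = c0 * \<mu>')) \<or>
     (\<exists>c0. C = curve_given_by s0 s1 t0 t1 (\<lambda>\<mu> \<mu>' \<nu> \<nu>'. \<nu> = c0 * \<nu>')))"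
  using legendrian_curve_on_quadric[OF assms] fibre_curve_standard monomial_curve_standard
  unfolding standard_curve_def[symmetric] by (elim disjE)

end
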